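(* Let $(M,g)$ be a compact riemannian manifold with metric $g=\langle\cdot,\cdot\rangle$ and Levi-Civita connection $\nabla$, let $W:M\to\mathbb{R}$ be a smooth function, let $E$ be a smooth vector field on $M$, and let $h\in\mathbb{R}$ be such that $W(q)<h$ for all $q\in M$. Consider the isoenergetic dynamics $$\frac{dq}{dt}=v,\qquad \frac{Dv}{dt}=-\nabla W+E-\frac{\langle E,v\rangle}{v^2}\,v,$$ where $\frac{D}{dt}=\nabla_v$ and $v^2=\langle v,v\rangle$, restricted to the energy level $\frac12 v^2+W=h$. Reparametrized by the arc length of $g$, this dynamics defines a flow on the unit tangent bundle $SM$ which coincides with the W-flow for the vector field $$\widetilde E=\frac{-\nabla W+E}{2(h-W)}.$$ In particular, in the isokinetic case ($W=0$) on the energy level $v^2=1$, the equations $$\frac{dq}{dt}=v,\qquad \frac{Dv}{dt}=E-\langle E,v\rangle v$$ define the W-flow for the field $E$ itself.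
   Context: Weyl connection. For a smooth vector field $F$ on the riemannian manifold $(M,g)$, let $\varphi(\cdot)=\langle F,\cdot\rangle$. The Weyl connection determined by $g$ and $F$ is the symmetric linear connection $$\widehat\nabla_XY=\nabla_XY+\varphi(Y)X+\varphi(X)Y-\langle X,Y\rangle F$$ for vector fields $X,Y$ on $M$. Its geodesics are the projections $q(s)$ to $M$ of solutions of $\frac{dq}{ds}=w$, $\widehat\nabla_w w=0$. W-flow. The W-flow for the field $F$ is the flow $\Phi^t:SM\to SM$ obtained by parametrizing the geodesics of the Weyl connection by the arc length of $g$: the projection to $M$ of a trajectory of $\Phi^t$ is a geodesic of $\widehat\nabla$ (up to reparametrization), $t$ is its arc length parameter with respect to $g$, and the trajectory is the natural lift $(q(t),\dot q(t))$ of this arc-length parametrized curve to $SM$. Reparametrizing the isoenergetic dynamics by arc length means taking the projected trajectories $q(t)$ of the dynamics, parametrizing them by $g$-arc length, and lifting them to $SM$ by their unit tangent vectors. *)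

theory Defs
  imports "HOL-Analysis.Analysis"
begin

text \<open>
  A manifold is a topology \<open>X\<close> together with an atlas \<open>A\<close> of charts into a Euclidean space \<open>'e\<close>,
  whose dimension is the dimension of the manifold. A chart is a pair of its domain and its
  coordinate map; only the values of the coordinate map on the domain matter.
\<close>

type_synonym ('a, 'e) chart = "'a set \<times> ('a \<Rightarrow> 'e)"

abbreviation chart_inv :: "('a, 'e) chart \<Rightarrow> 'e \<Rightarrow> 'a" where
  "chart_inv c \<equiv> inv_into (fst c) (snd c)"

text \<open>Smoothness of maps between normed spaces; used only for open sets \<open>S\<close>.\<close>

primrec Ck_on :: "nat \<Rightarrow> 'e::real_normed_vector set \<Rightarrow> ('e \<Rightarrow> 'f::real_normed_vector) \<Rightarrow> bool" where
  "Ck_on 0 S f \<longleftrightarrow> continuous_on S f"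
| "Ck_on (Suc k) S f \<longleftrightarrow>
     f differentiable_on S \<and> (\<forall>v. Ck_on k S (\<lambda>x. frechet_derivative f (at x) v))"

definition smooth_on :: "'e::real_normed_vector set \<Rightarrow> ('e \<Rightarrow> 'f::real_normed_vector) \<Rightarrow> bool" where
  "smooth_on S f \<longleftrightarrow> (\<forall>k. Ck_on k S f)"

definition smooth_manifold :: "'a topology \<Rightarrow> ('a, 'e::euclidean_space) chart set \<Rightarrow> bool" where
  "smooth_manifold X A \<longleftrightarrow>
     Hausdorff_space X \<and> second_countable X \<and>
     (\<Union>c\<in>A. fst c) = topspace X \<and>
     (\<forall>c\<in>A. openin X (fst c) \<and> open (snd c ` fst c) \<and>
        homeomorphic_map (subtopology X (fst c)) (top_of_set (snd c ` fst c)) (snd c)) \<and>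
     (\<forall>c\<in>A. \<forall>d\<in>A. smooth_on (snd c ` (fst c \<inter> fst d)) (\<lambda>x. snd d (chart_inv c x)))"

text \<open>
  At every point \<open>p\<close> one chart around \<open>p\<close> is singled out, and the tangent space at \<open>p\<close> is represented
  by the model space \<open>'e\<close>: the vector \<open>v :: 'e\<close> stands for the tangent vector at \<open>p\<close> whose components
  in the chart \<open>chart_at A p\<close> are \<open>v\<close>. The chosen chart may jump from point to point, so a
  vector field \<open>'a \<Rightarrow> 'e\<close> must be converted to the components in a fixed chart before it is
  differentiated. \<open>tangent_coord A c p v\<close> gives the components of \<open>v\<close> in the chart \<open>c\<close>;
  \<open>coord_field A c \<xi>\<close> is the vector field on the domain of \<open>c\<close> with constant components \<open>\<xi>\<close> in \<open>c\<close>.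
\<close>

definition chart_at :: "('a, 'e) chart set \<Rightarrow> 'a \<Rightarrow> ('a, 'e) chart" where
  "chart_at A p = (SOME c. c \<in> A \<and> p \<in> fst c)"

definition tangent_coord ::
    "('a, 'e::euclidean_space) chart set \<Rightarrow> ('a, 'e) chart \<Rightarrow> 'a \<Rightarrow> 'e \<Rightarrow> 'e" where
  "tangent_coord A c p v =
     (let k = chart_at A p in frechet_derivative (\<lambda>x. snd c (chart_inv k x)) (at (snd k p)) v)"

definition coord_field ::
    "('a, 'e::euclidean_space) chart set \<Rightarrow> ('a, 'e) chart \<Rightarrow> 'e \<Rightarrow> 'a \<Rightarrow> 'e" where
  "coord_field A c \<xi> p =
     frechet_derivative (\<lambda>x. snd (chart_at A p) (chart_inv c x)) (at (snd c p)) \<xi>"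

definition tangent_topology ::
    "'a topology \<Rightarrow> ('a, 'e::euclidean_space) chart set \<Rightarrow> ('a \<times> 'e) topology" where
  "tangent_topology X A = topology_generated_by
     {{(p, v). p \<in> fst c \<and> (snd c p, tangent_coord A c p v) \<in> B} | c B. c \<in> A \<and> open B}"

definition smooth_fun ::
    "('a, 'e::euclidean_space) chart set \<Rightarrow> 'a set \<Rightarrow> ('a \<Rightarrow> real) \<Rightarrow> bool" where
  "smooth_fun A U f \<longleftrightarrow> (\<forall>c\<in>A. smooth_on (snd c ` (U \<inter> fst c)) (\<lambda>x. f (chart_inv c x)))"

definition smooth_field ::
    "('a, 'e::euclidean_space) chart set \<Rightarrow> 'a set \<Rightarrow> ('a \<Rightarrow> 'e) \<Rightarrow> bool" where
  "smooth_field A U Y \<longleftrightarrow>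
     (\<forall>c\<in>A. smooth_on (snd c ` (U \<inter> fst c))
        (\<lambda>x. tangent_coord A c (chart_inv c x) (Y (chart_inv c x))))"

text \<open>The derivative of the function \<open>f\<close> in the direction of the tangent vector \<open>v\<close> at \<open>p\<close>.\<close>

definition dfun :: "('a, 'e::euclidean_space) chart set \<Rightarrow> ('a \<Rightarrow> real) \<Rightarrow> 'a \<Rightarrow> 'e \<Rightarrow> real" where
  "dfun A f p v =
     (let k = chart_at A p in frechet_derivative (\<lambda>x. f (chart_inv k x)) (at (snd k p)) v)"

definition riemannian_manifold ::
    "'a topology \<Rightarrow> ('a, 'e::euclidean_space) chart set \<Rightarrow> ('a \<Rightarrow> 'e \<Rightarrow> 'e \<Rightarrow> real) \<Rightarrow> bool" where
  "riemannian_manifold X A g \<longleftrightarrow>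
     smooth_manifold X A \<and>
     (\<forall>p\<in>topspace X. bilinear (g p) \<and> (\<forall>u v. g p u v = g p v u) \<and> (\<forall>v. v \<noteq> 0 \<longrightarrow> g p v v > 0)) \<and>
     (\<forall>c\<in>A. \<forall>\<xi> \<eta>. smooth_fun A (fst c) (\<lambda>p. g p (coord_field A c \<xi> p) (coord_field A c \<eta> p)))"

definition gradient ::
    "('a, 'e::euclidean_space) chart set \<Rightarrow> ('a \<Rightarrow> 'e \<Rightarrow> 'e \<Rightarrow> real) \<Rightarrow> ('a \<Rightarrow> real) \<Rightarrow> 'a \<Rightarrow> 'e" where
  "gradient A g W p = (THE u. \<forall>v. g p u v = dfun A W p v)"

text \<open>
  A connection \<open>nabla\<close> is taken as acting on vector fields defined near a point:
  \<open>nabla p v Y\<close> is the covariant derivative at \<open>p\<close> of the field \<open>Y\<close>, smooth in some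
  neighbourhood of \<open>p\<close>, in the direction of the tangent vector \<open>v\<close> at \<open>p\<close>. For vector fields \<open>X\<close>, \<open>Y\<close>
  the field usually written $\nabla_X Y$ is \<open>\<lambda>p. nabla p (X p) Y\<close>.
\<close>

type_synonym ('a, 'e) connection = "'a \<Rightarrow> 'e \<Rightarrow> ('a \<Rightarrow> 'e) \<Rightarrow> 'e"

definition linear_connection ::
    "'a topology \<Rightarrow> ('a, 'e::euclidean_space) chart set \<Rightarrow> ('a, 'e) connection \<Rightarrow> bool" where
  "linear_connection X A nabla \<longleftrightarrow>
     (\<forall>U Y. openin X U \<and> smooth_field A U Y \<longrightarrow>
        (\<forall>p\<in>U. linear (\<lambda>v. nabla p v Y)) \<and>
        (\<forall>Z. smooth_field A U Z \<longrightarrow>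
           (\<forall>p\<in>U. \<forall>v. nabla p v (\<lambda>q. Y q + Z q) = nabla p v Y + nabla p v Z) \<and>
           ((\<forall>q\<in>U. Y q = Z q) \<longrightarrow> (\<forall>p\<in>U. \<forall>v. nabla p v Y = nabla p v Z)) \<and>
           smooth_field A U (\<lambda>p. nabla p (Z p) Y)) \<and>
        (\<forall>f. smooth_fun A U f \<longrightarrow>
           (\<forall>p\<in>U. \<forall>v. nabla p v (\<lambda>q. f q *\<^sub>R Y q) = dfun A f p v *\<^sub>R Y p + f p *\<^sub>R nabla p v Y)))"

text \<open>
  Torsion-freeness, $\nabla_Y Z - \nabla_Z Y = [Y, Z]$, is expressed by evaluating both sides on
  functions, where $[Y, Z] f = Y (Z f) - Z (Y f)$.
\<close>

definition torsion_free ::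
    "'a topology \<Rightarrow> ('a, 'e::euclidean_space) chart set \<Rightarrow> ('a, 'e) connection \<Rightarrow> bool" where
  "torsion_free X A nabla \<longleftrightarrow>
     (\<forall>U Y Z f. openin X U \<and> smooth_field A U Y \<and> smooth_field A U Z \<and> smooth_fun A U f \<longrightarrow>
        (\<forall>p\<in>U. dfun A f p (nabla p (Y p) Z - nabla p (Z p) Y) =
           dfun A (\<lambda>q. dfun A f q (Z q)) p (Y p) - dfun A (\<lambda>q. dfun A f q (Y q)) p (Z p)))"

definition metric_connection ::
    "'a topology \<Rightarrow> ('a, 'e::euclidean_space) chart set \<Rightarrow> ('a \<Rightarrow> 'e \<Rightarrow> 'e \<Rightarrow> real) \<Rightarrow>
     ('a, 'e) connection \<Rightarrow> bool" where
  "metric_connection X A g nabla \<longleftrightarrow>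
     (\<forall>U Y Z. openin X U \<and> smooth_field A U Y \<and> smooth_field A U Z \<longrightarrow>
        (\<forall>p\<in>U. \<forall>v. dfun A (\<lambda>q. g q (Y q) (Z q)) p v =
           g p (nabla p v Y) (Z p) + g p (Y p) (nabla p v Z)))"

definition levi_civita ::
    "'a topology \<Rightarrow> ('a, 'e::euclidean_space) chart set \<Rightarrow> ('a \<Rightarrow> 'e \<Rightarrow> 'e \<Rightarrow> real) \<Rightarrow>
     ('a, 'e) connection \<Rightarrow> bool" where
  "levi_civita X A g nabla \<longleftrightarrow>
     linear_connection X A nabla \<and> torsion_free X A nabla \<and> metric_connection X A g nabla"

definition weyl_connection ::
    "('a \<Rightarrow> 'e::euclidean_space \<Rightarrow> 'e \<Rightarrow> real) \<Rightarrow> ('a, 'e) connection \<Rightarrow> ('a \<Rightarrow> 'e) \<Rightarrow>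
     ('a, 'e) connection" where
  "weyl_connection g nabla F p v Y =
     nabla p v Y + g p (F p) (Y p) *\<^sub>R v + g p (F p) v *\<^sub>R Y p - g p v (Y p) *\<^sub>R F p"

definition has_velocity ::
    "'a topology \<Rightarrow> ('a, 'e::euclidean_space) chart set \<Rightarrow> (real \<Rightarrow> 'a) \<Rightarrow> 'e \<Rightarrow> real \<Rightarrow> bool" where
  "has_velocity X A q v t \<longleftrightarrow>
     limitin X q (q t) (at t) \<and>
     ((\<lambda>s. snd (chart_at A (q t)) (q s)) has_vector_derivative v) (at t)"

text \<open>
  The covariant derivative along the curve \<open>q\<close> of the vector field \<open>V\<close> along \<open>q\<close>: expanding \<open>V\<close> in the
  coordinate fields $\partial_b$ of a chart around \<open>q t\<close>, $V = \sum_b V^b \partial_b$, the derivative is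
  $\sum_b (\dot V^b \partial_b + V^b \nabla_{\dot q} \partial_b)$. In the chart \<open>chart_at A (q t)\<close> the
  vector $\partial_b$ at \<open>q t\<close> is \<open>b\<close>, and \<open>V t\<close> is its own vector of components.
\<close>

definition has_covariant_derivative ::
    "'a topology \<Rightarrow> ('a, 'e::euclidean_space) chart set \<Rightarrow> ('a, 'e) connection \<Rightarrow>
     (real \<Rightarrow> 'a) \<Rightarrow> (real \<Rightarrow> 'e) \<Rightarrow> 'e \<Rightarrow> real \<Rightarrow> bool" where
  "has_covariant_derivative X A nabla q V a t \<longleftrightarrow>
     (let k = chart_at A (q t) in
      \<exists>w V'. has_velocity X A q w t \<and>
        ((\<lambda>s. tangent_coord A k (q s) (V s)) has_vector_derivative V') (at t) \<and>
        a = V' + (\<Sum>b\<in>Basis. (V t \<bullet> b) *\<^sub>R nabla (q t) w (coord_field A k b)))"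

definition open_interval :: "real set \<Rightarrow> bool" where
  "open_interval I \<longleftrightarrow> open I \<and> is_interval I \<and> I \<noteq> {}"

text \<open>
  Families of curves are predicates on the domain and the curve; families of curves in the tangent
  bundle are predicates on the domain, the base curve and the vector along it.
\<close>

type_synonym 'a curves = "real set \<Rightarrow> (real \<Rightarrow> 'a) \<Rightarrow> bool"
type_synonym ('a, 'e) lifted_curves = "real set \<Rightarrow> (real \<Rightarrow> 'a) \<Rightarrow> (real \<Rightarrow> 'e) \<Rightarrow> bool"

text \<open>
  The curve \<open>r\<close> on \<open>J\<close> is \<open>q\<close> on \<open>I\<close>, parametrized by the arc length \<open>\<sigma>\<close> of \<open>q\<close>. The additive
  constant in \<open>\<sigma>\<close> is free.
\<close>

definition arc_length_reparam ::
    "'a topology \<Rightarrow> ('a, 'e::euclidean_space) chart set \<Rightarrow> ('a \<Rightarrow> 'e \<Rightarrow> 'e \<Rightarrow> real) \<Rightarrow>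
     real set \<Rightarrow> (real \<Rightarrow> 'a) \<Rightarrow> real set \<Rightarrow> (real \<Rightarrow> 'a) \<Rightarrow> bool" where
  "arc_length_reparam X A g I q J r \<longleftrightarrow>
     (\<exists>\<sigma>. bij_betw \<sigma> I J \<and>
        (\<forall>t\<in>I. r (\<sigma> t) = q t \<and>
           (\<exists>v. v \<noteq> 0 \<and> has_velocity X A q v t \<and>
              (\<sigma> has_real_derivative sqrt (g (q t) v v)) (at t))))"

definition arc_length_lifts ::
    "'a topology \<Rightarrow> ('a, 'e::euclidean_space) chart set \<Rightarrow> ('a \<Rightarrow> 'e \<Rightarrow> 'e \<Rightarrow> real) \<Rightarrow>
     'a curves \<Rightarrow> ('a, 'e) lifted_curves" where
  "arc_length_lifts X A g T J r u \<longleftrightarrow>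
     (\<exists>I q. T I q \<and> arc_length_reparam X A g I q J r) \<and> (\<forall>s\<in>J. has_velocity X A r (u s) s)"

definition unit_tangent_bundle ::
    "'a topology \<Rightarrow> ('a \<Rightarrow> 'e::euclidean_space \<Rightarrow> 'e \<Rightarrow> real) \<Rightarrow> ('a \<times> 'e) set" where
  "unit_tangent_bundle X g = {(p, v). p \<in> topspace X \<and> g p v v = 1}"

definition is_flow :: "'b topology \<Rightarrow> (real \<Rightarrow> 'b \<Rightarrow> 'b) \<Rightarrow> bool" where
  "is_flow B \<Phi> \<longleftrightarrow>
     continuous_map (prod_topology euclideanreal B) B (\<lambda>(t, x). \<Phi> t x) \<and>
     (\<forall>x\<in>topspace B. \<Phi> 0 x = x) \<and>
     (\<forall>s t. \<forall>x\<in>topspace B. \<Phi> (s + t) x = \<Phi> s (\<Phi> t x))"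

text \<open>
  The curves of the family \<open>L\<close> are exactly the orbit segments of the flow: every complete orbit belongs
  to \<open>L\<close>, and every curve of \<open>L\<close> is part of an orbit. In particular \<open>L\<close> determines \<open>\<Phi>\<close> on the unit
  tangent bundle (its values elsewhere are irrelevant).
\<close>

definition defines_flow ::
    "'a topology \<Rightarrow> ('a, 'e::euclidean_space) chart set \<Rightarrow> ('a \<Rightarrow> 'e \<Rightarrow> 'e \<Rightarrow> real) \<Rightarrow>
     ('a, 'e) lifted_curves \<Rightarrow> (real \<Rightarrow> 'a \<times> 'e \<Rightarrow> 'a \<times> 'e) \<Rightarrow> bool" where
  "defines_flow X A g L \<Phi> \<longleftrightarrow>
     is_flow (subtopology (tangent_topology X A) (unit_tangent_bundle X g)) \<Phi> \<and>
     (\<forall>x\<in>unit_tangent_bundle X g. L UNIV (\<lambda>t. fst (\<Phi> t x)) (\<lambda>t. snd (\<Phi> t x))) \<and>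
     (\<forall>J r u. L J r u \<longrightarrow> (\<forall>s\<in>J. \<forall>t. s + t \<in> J \<longrightarrow> \<Phi> t (r s, u s) = (r (s + t), u (s + t))))"

text \<open>Constant geodesics have no arc length parametrization and are left out.\<close>

definition geodesics ::
    "'a topology \<Rightarrow> ('a, 'e::euclidean_space) chart set \<Rightarrow> ('a, 'e) connection \<Rightarrow> 'a curves" where
  "geodesics X A nabla I q \<longleftrightarrow>
     open_interval I \<and>
     (\<exists>w. \<forall>t\<in>I. w t \<noteq> 0 \<and> has_velocity X A q (w t) t \<and>
        has_covariant_derivative X A nabla q w 0 t)"

definition W_flow ::
    "'a topology \<Rightarrow> ('a, 'e::euclidean_space) chart set \<Rightarrow> ('a \<Rightarrow> 'e \<Rightarrow> 'e \<Rightarrow> real) \<Rightarrow>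
     ('a, 'e) connection \<Rightarrow> ('a \<Rightarrow> 'e) \<Rightarrow> (real \<Rightarrow> 'a \<times> 'e \<Rightarrow> 'a \<times> 'e) \<Rightarrow> bool" where
  "W_flow X A g nabla F \<Phi> \<longleftrightarrow>
     defines_flow X A g
       (arc_length_lifts X A g (geodesics X A (weyl_connection g nabla F))) \<Phi>"

definition isoenergetic_curves ::
    "'a topology \<Rightarrow> ('a, 'e::euclidean_space) chart set \<Rightarrow> ('a \<Rightarrow> 'e \<Rightarrow> 'e \<Rightarrow> real) \<Rightarrow>
     ('a, 'e) connection \<Rightarrow> ('a \<Rightarrow> real) \<Rightarrow> ('a \<Rightarrow> 'e) \<Rightarrow> real \<Rightarrow> 'a curves" where
  "isoenergetic_curves X A g nabla W E h I q \<longleftrightarrow>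
     open_interval I \<and>
     (\<exists>v. \<forall>t\<in>I. has_velocity X A q (v t) t \<and>
        has_covariant_derivative X A nabla q v
          (- gradient A g W (q t) + E (q t)
            - (g (q t) (E (q t)) (v t) / g (q t) (v t) (v t)) *\<^sub>R v t) t \<and>
        g (q t) (v t) (v t) / 2 + W (q t) = h)"

definition isokinetic_curves ::
    "'a topology \<Rightarrow> ('a, 'e::euclidean_space) chart set \<Rightarrow> ('a \<Rightarrow> 'e \<Rightarrow> 'e \<Rightarrow> real) \<Rightarrow>
     ('a, 'e) connection \<Rightarrow> ('a \<Rightarrow> 'e) \<Rightarrow> ('a, 'e) lifted_curves" where
  "isokinetic_curves X A g nabla E I q v \<longleftrightarrow>
     open_interval I \<and>
     (\<forall>t\<in>I. has_velocity X A q (v t) t \<and>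
        has_covariant_derivative X A nabla q v
          (E (q t) - g (q t) (E (q t)) (v t) *\<^sub>R v t) t \<and>
        g (q t) (v t) (v t) = 1)"

end

theory Submission
  imports Defs
begin

text \<open>
  Let a curve with velocity \<open>v\<close> satisfy \<open>Dv/dt = \<bar>v\<bar>\<^sup>2 F + \<kappa> v\<close>. Reparametrized by arc length, its unit
  tangent vector \<open>u\<close> satisfies \<open>Du/ds = F - \<langle>F, u\<rangle> u\<close>, because only the component of the acceleration
  orthogonal to \<open>v\<close> survives. Weyl geodesics satisfy the equation with \<open>\<kappa> = - 2 \<langle>F, v\<rangle>\<close>, isoenergetic
  trajectories satisfy it with \<open>F = (E - \<nabla>W) / (2 (h - W))\<close>, since \<open>\<bar>v\<bar>\<^sup>2 = 2 (h - W)\<close>. Conversely, every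
  solution of the isokinetic equation acquires either law after a time change \<open>dt/ds = 1/\<rho>\<close>, where
  \<open>\<rho>'/\<rho> = - \<langle>F, u\<rangle>\<close> for geodesics and \<open>\<rho>\<^sup>2 = 2 (h - W)\<close> for the isoenergetic dynamics.

  It remains to integrate the isokinetic equation. In a chart of the tangent bundle it is an ordinary
  differential equation with a locally Lipschitz right-hand side, which preserves the unit tangent
  bundle. Local solutions depend continuously on the initial value, and compactness of the unit tangent
  bundle makes their lifetime uniform, so they extend to a flow.
\<close>

section \<open>Differentiable and Lipschitz maps\<close>

text \<open>Both equivalences are reduced to equalities between families of curves, with
  \<open>isokinetic_curves\<close> as the common value; statements about every flow
  \<open>\<Phi>\<close> then follow by rewriting. One inclusion would not do, since
  \<open>defines_flow\<close> asks complete orbits to belong to the family and also constrains every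
  member of it. Regularity is kept at local Lipschitz bounds. The gradient is known only as the
  solution of a linear system with the Gram matrix of the metric; coercivity of the metric bounds
  its variation without inverting the matrix, and this is enough for existence, uniqueness and
  continuous dependence. The chart that represents tangent vectors may jump from point to point.
  Hence derivatives along a curve are transferred to one fixed chart; for covariant derivatives this
  transfer is the transformation law of the Christoffel symbols. The passage from local solutions to
  a flow is made for an abstract predicate on curves in a compact Hausdorff space, so that no
  coordinates enter there.\<close>

lemma frechet_derivative_cong_open:
  assumes "open S" "x \<in> S" "\<And>y. y \<in> S \<Longrightarrow> f y = g y"
  shows "frechet_derivative f (at x) = frechet_derivative g (at x)"
proof -
  \<comment> \<open>\<open>frechet_derivative\<close> is a choice among the maps that are
    derivatives. Both functions admit the same candidates, so the chosen maps agree, even at points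
    where no derivative exists.\<close>
  have "(f has_derivative D) (at x) \<longleftrightarrow> (g has_derivative D) (at x)" for D
    using assms by (metis has_derivative_transform_within_open)
  then show ?thesis
    unfolding frechet_derivative_def by simp
qed

lemma Ck_on_SucD:
  assumes "open S" "Ck_on (Suc k) S f" "x \<in> S"
  shows "(f has_derivative frechet_derivative f (at x)) (at x)"
  using assms by (simp add: differentiable_on_eq_differentiable_at frechet_derivative_works)

lemma Ck_on_cong:
  assumes "open S" "\<And>x. x \<in> S \<Longrightarrow> f x = g x" "Ck_on k S f"
  shows "Ck_on k S g"
  using assms(2,3)
proof (induction k arbitrary: f g)
  case 0
  then show ?case by (metis Ck_on.simps(1) continuous_on_cong)
next
  case (Suc k)
  have "frechet_derivative f (at x) = frechet_derivative g (at x)" if "x \<in> S" for x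
    using frechet_derivative_cong_open[OF assms(1) that] Suc.prems(1) by blast
  then have "Ck_on k S (\<lambda>x. frechet_derivative g (at x) v)" for v
    using Suc.IH[of "\<lambda>x. frechet_derivative f (at x) v" "\<lambda>x. frechet_derivative g (at x) v"] Suc.prems
    by simp
  moreover have "g differentiable_on S"
    using Suc.prems assms(1) unfolding Ck_on.simps differentiable_on_eq_differentiable_at[OF assms(1)]
    by (metis differentiable_def has_derivative_transform_within_open)
  ultimately show ?case by simp
qed

text \<open>By uniqueness of derivatives an explicit formula \<open>f'\<close> may replace the
  chosen \<open>frechet_derivative\<close>; the rules for sums, products and compositions enter
  here.\<close>

lemma Ck_on_SucI:
  assumes "open S" "\<And>x. x \<in> S \<Longrightarrow> (f has_derivative f' x) (at x)"
    and "\<And>v. Ck_on k S (\<lambda>x. f' x v)"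
  shows "Ck_on (Suc k) S f"
proof -
  have "f' x v = frechet_derivative f (at x) v" if "x \<in> S" for x v
    using assms(2)[OF that] frechet_derivative_at by metis
  then have "Ck_on k S (\<lambda>x. frechet_derivative f (at x) v)" for v
    using assms(3)[of v] Ck_on_cong[OF assms(1), of "\<lambda>x. f' x v"] by simp
  moreover have "f differentiable_on S"
    using assms(1,2) by (auto simp: differentiable_on_eq_differentiable_at differentiable_def)
  ultimately show ?thesis by simp
qed

lemma Ck_on_pred:
  assumes "open S" "Ck_on (Suc k) S f"
  shows "Ck_on k S f"
  using assms(2)
proof (induction k arbitrary: f)
  case 0
  then show ?case by (simp add: differentiable_imp_continuous_on)
next
  case (Suc k)
  then show ?case by (metis Ck_on.simps(2))
qed

lemma Ck_on_subset:
  assumes "Ck_on k S f" "open S" "open T" "T \<subseteq> S"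
  shows "Ck_on k T f"
  using assms(1)
proof (induction k arbitrary: f)
  case 0
  then show ?case using assms(4) continuous_on_subset by auto
next
  case (Suc k)
  then show ?case using assms(4) by (auto intro: differentiable_on_subset)
qed

lemma Ck_on_const: "Ck_on k S (\<lambda>x. a)"
proof (induction k arbitrary: a)
  case (Suc k)
  then show ?case by simp
qed simp

lemma Ck_on_add:
  assumes "open S" "Ck_on k S f" "Ck_on k S g"
  shows "Ck_on k S (\<lambda>x. f x + g x)"
  using assms(2,3)
proof (induction k arbitrary: f g)
  case 0
  then show ?case by (simp add: continuous_on_add)
next
  case (Suc k)
  show ?case
  proof (rule Ck_on_SucI[OF assms(1)])
    show "((\<lambda>x. f x + g x) has_derivative
        (\<lambda>v. frechet_derivative f (at x) v + frechet_derivative g (at x) v)) (at x)"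
      if "x \<in> S" for x
      by (rule has_derivative_add[OF Ck_on_SucD[OF assms(1) Suc.prems(1) that]
            Ck_on_SucD[OF assms(1) Suc.prems(2) that]])
    show "Ck_on k S (\<lambda>x. frechet_derivative f (at x) v + frechet_derivative g (at x) v)" for v
      using Suc by simp
  qed
qed

lemma Ck_on_sum:
  assumes "open S" "\<And>i. i \<in> I \<Longrightarrow> Ck_on k S (f i)"
  shows "Ck_on k S (\<lambda>x. \<Sum>i\<in>I. f i x)"
  using assms(2)
  by (induction I rule: infinite_finite_induct) (auto intro: Ck_on_add Ck_on_const assms(1))

text \<open>The product rule gives again a sum of two values of \<open>h\<close>, so the induction
  runs over all \<open>f\<close> and \<open>g\<close>. One factor of each term stays
  undifferentiated, and \<open>Ck_on_pred\<close> lowers its order.\<close>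

lemma Ck_on_bilinear:
  assumes "open S" "bounded_bilinear h" "Ck_on k S f" "Ck_on k S g"
  shows "Ck_on k S (\<lambda>x. h (f x) (g x))"
  using assms(3,4)
proof (induction k arbitrary: f g)
  case 0
  then show ?case by (simp add: bounded_bilinear.continuous_on[OF assms(2)])
next
  case (Suc k)
  show ?case
  proof (rule Ck_on_SucI[OF assms(1)])
    show "((\<lambda>x. h (f x) (g x)) has_derivative
        (\<lambda>v. h (f x) (frechet_derivative g (at x) v) + h (frechet_derivative f (at x) v) (g x))) (at x)"
      if "x \<in> S" for x
      by (rule bounded_bilinear.FDERIV[OF assms(2) Ck_on_SucD[OF assms(1) Suc.prems(1) that]
            Ck_on_SucD[OF assms(1) Suc.prems(2) that]])
    show "Ck_on k S (\<lambda>x. h (f x) (frechet_derivative g (at x) v) + h (frechet_derivative f (at x) v)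
        (g x))" for v
      using Suc.prems Ck_on_pred[OF assms(1) Suc.prems(1)] Ck_on_pred[OF assms(1) Suc.prems(2)]
      by (intro Ck_on_add assms(1) Suc.IH) auto
  qed
qed

lemma Ck_on_bounded_linear:
  assumes "open S" "bounded_linear l" "Ck_on k S f"
  shows "Ck_on k S (\<lambda>x. l (f x))"
  using assms(3)
proof (induction k arbitrary: f)
  case 0
  then show ?case by (simp add: bounded_linear.continuous_on[OF assms(2)])
next
  case (Suc k)
  show ?case
  proof (rule Ck_on_SucI[OF assms(1)])
    show "((\<lambda>x. l (f x)) has_derivative (\<lambda>v. l (frechet_derivative f (at x) v))) (at x)"
      if "x \<in> S" for x
      by (rule bounded_linear.has_derivative[OF assms(2) Ck_on_SucD[OF assms(1) Suc.prems that]])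
    show "Ck_on k S (\<lambda>x. l (frechet_derivative f (at x) v))" for v
      using Suc by simp
  qed
qed

lemma linear_Basis_expansion:
  fixes l :: "'e::euclidean_space \<Rightarrow> 'f::real_vector"
  assumes "linear l"
  shows "l v = (\<Sum>b\<in>Basis. (v \<bullet> b) *\<^sub>R l b)"
proof -
  have "l v = l (\<Sum>b\<in>Basis. (v \<bullet> b) *\<^sub>R b)"
    by (simp add: euclidean_representation)
  also have "\<dots> = (\<Sum>b\<in>Basis. (v \<bullet> b) *\<^sub>R l b)"
    by (simp add: linear_sum[OF assms] linear_cmul[OF assms] o_def)
  finally show ?thesis .
qed

text \<open>\<open>Ck_on\<close> speaks of derivatives in a fixed direction, while the chain rule
  evaluates the derivative of \<open>f\<close> in a direction that varies with \<open>x\<close>.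
  Expanding this direction in \<open>Basis\<close> leaves products of scalar coefficients and
  derivatives in fixed directions.\<close>

lemma Ck_on_compose:
  fixes g :: "'d::real_normed_vector \<Rightarrow> 'e::euclidean_space" and f :: "'e \<Rightarrow> 'f::real_normed_vector"
  assumes "open S" "open T" "Ck_on k T f" "Ck_on k S g" "g ` S \<subseteq> T"
  shows "Ck_on k S (\<lambda>x. f (g x))"
  using assms(3,4)
proof (induction k arbitrary: f)
  case 0
  then show ?case using assms(5) continuous_on_compose2 by auto
next
  case (Suc k)
  show ?case
  proof (rule Ck_on_SucI[OF assms(1)])
    fix x assume x: "x \<in> S"
    then have "g x \<in> T" using assms(5) by auto
    then have f': "(f has_derivative frechet_derivative f (at (g x))) (at (g x))"
      using Ck_on_SucD[OF assms(2) Suc.prems(1)] by blast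
    have "((\<lambda>x. f (g x)) has_derivative
        (\<lambda>v. frechet_derivative f (at (g x)) (frechet_derivative g (at x) v))) (at x)"
      using has_derivative_compose[OF Ck_on_SucD[OF assms(1) Suc.prems(2) x] f'] .
    moreover have "(\<lambda>v. frechet_derivative f (at (g x)) (frechet_derivative g (at x) v)) =
        (\<lambda>v. \<Sum>b\<in>Basis. (frechet_derivative g (at x) v \<bullet> b) *\<^sub>R frechet_derivative f (at (g x)) b)"
      by (rule ext) (rule linear_Basis_expansion[OF has_derivative_linear[OF f']])
    ultimately show "((\<lambda>x. f (g x)) has_derivative
        (\<lambda>v. \<Sum>b\<in>Basis. (frechet_derivative g (at x) v \<bullet> b) *\<^sub>R frechet_derivative f (at (g x)) b))
            (at x)"
      by (rule back_subst)
  next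
    fix v
    show "Ck_on k S (\<lambda>x. \<Sum>b\<in>Basis. (frechet_derivative g (at x) v \<bullet> b) *\<^sub>R frechet_derivative f (at
        (g x)) b)"
    proof (rule Ck_on_sum[OF assms(1)])
      fix b :: 'e
      have "Ck_on k S (\<lambda>x. frechet_derivative g (at x) v \<bullet> b)"
        using Suc.prems(2) by (intro Ck_on_bounded_linear[OF assms(1) bounded_linear_inner_left]) simp
      moreover have "Ck_on k S (\<lambda>x. frechet_derivative f (at (g x)) b)"
        using Suc.IH[of "\<lambda>y. frechet_derivative f (at y) b"] Suc.prems(1)
          Ck_on_pred[OF assms(1) Suc.prems(2)] by simp
      ultimately show "Ck_on k S (\<lambda>x. (frechet_derivative g (at x) v \<bullet> b) *\<^sub>R frechet_derivative f
          (at (g x)) b)"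
        by (rule Ck_on_bilinear[OF assms(1) bounded_bilinear_scaleR])
    qed
  qed
qed

lemma smooth_on_has_derivative:
  assumes "open S" "smooth_on S f" "x \<in> S"
  shows "(f has_derivative frechet_derivative f (at x)) (at x)"
  using assms Ck_on_SucD[of S 0 f] by (auto simp: smooth_on_def)

lemma smooth_on_continuous_on: "smooth_on S f \<Longrightarrow> continuous_on S f"
  unfolding smooth_on_def by (metis Ck_on.simps(1))

lemma smooth_on_derivative:
  "smooth_on S f \<Longrightarrow> smooth_on S (\<lambda>x. frechet_derivative f (at x) v)"
  unfolding smooth_on_def by (metis Ck_on.simps(2))

lemma smooth_on_cong:
  "open S \<Longrightarrow> (\<And>x. x \<in> S \<Longrightarrow> f x = g x) \<Longrightarrow> smooth_on S f \<Longrightarrow> smooth_on S g"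
  unfolding smooth_on_def using Ck_on_cong by blast

lemma smooth_on_subset: "smooth_on S f \<Longrightarrow> open S \<Longrightarrow> open T \<Longrightarrow> T \<subseteq> S \<Longrightarrow> smooth_on T f"
  unfolding smooth_on_def using Ck_on_subset by blast

lemma smooth_on_inner_const:
  "open S \<Longrightarrow> smooth_on S f \<Longrightarrow> smooth_on S (\<lambda>x. f x \<bullet> b)"
  unfolding smooth_on_def using Ck_on_bounded_linear[OF _ bounded_linear_inner_left] by blast

lemma smooth_on_scaleR:
  "open S \<Longrightarrow> smooth_on S f \<Longrightarrow> smooth_on S g \<Longrightarrow> smooth_on S (\<lambda>x. f x *\<^sub>R g x)"
  unfolding smooth_on_def using Ck_on_bilinear[OF _ bounded_bilinear_scaleR] by blast

lemma smooth_on_sum: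
  "open S \<Longrightarrow> (\<And>i. i \<in> I \<Longrightarrow> smooth_on S (f i)) \<Longrightarrow> smooth_on S (\<lambda>x. \<Sum>i\<in>I. f i x)"
  unfolding smooth_on_def by (simp add: Ck_on_sum)

lemma smooth_on_compose:
  fixes g :: "'d::real_normed_vector \<Rightarrow> 'e::euclidean_space"
  shows "open S \<Longrightarrow> open T \<Longrightarrow> smooth_on T f \<Longrightarrow> smooth_on S g \<Longrightarrow> g ` S \<subseteq> T
    \<Longrightarrow> smooth_on S (\<lambda>x. f (g x))"
  unfolding smooth_on_def using Ck_on_compose by blast

section \<open>Lipschitz maps without explicit constants\<close>

definition lipschitz :: "'d::metric_space set \<Rightarrow> ('d \<Rightarrow> 'f::metric_space) \<Rightarrow> bool" where
  "lipschitz S f \<longleftrightarrow> (\<exists>L. L-lipschitz_on S f)"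

lemma lipschitz_continuous_on: "lipschitz S f \<Longrightarrow> continuous_on S f"
  unfolding lipschitz_def using lipschitz_on_continuous_on by blast

lemma lipschitz_subset: "lipschitz S f \<Longrightarrow> T \<subseteq> S \<Longrightarrow> lipschitz T f"
  unfolding lipschitz_def using lipschitz_on_subset by blast

lemma lipschitz_cong: "lipschitz S f \<Longrightarrow> (\<And>x. x \<in> S \<Longrightarrow> f x = h x) \<Longrightarrow> lipschitz S h"
  unfolding lipschitz_def lipschitz_on_def by simp

lemma lipschitz_const: "lipschitz S (\<lambda>x. a)"
  unfolding lipschitz_def by (auto simp: lipschitz_on_def)

lemma lipschitz_compose: "lipschitz S g \<Longrightarrow> lipschitz (g ` S) f \<Longrightarrow> lipschitz S (\<lambda>x. f (g x))"
  unfolding lipschitz_def using lipschitz_on_compose2 by blast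

lemma lipschitz_bounded_linear:
  assumes "bounded_linear l"
  shows "lipschitz S l"
proof -
  obtain K where "\<And>x. norm (l x) \<le> norm x * K" "K \<ge> 0"
    using bounded_linear.nonneg_bounded[OF assms] by blast
  then show ?thesis
    unfolding lipschitz_def lipschitz_on_def
    by (metis dist_norm bounded_linear.linear[OF assms] linear_diff mult.commute)
qed

lemma lipschitz_add:
  fixes f g :: "'d::metric_space \<Rightarrow> 'f::real_normed_vector"
  shows "lipschitz S f \<Longrightarrow> lipschitz S g \<Longrightarrow> lipschitz S (\<lambda>x. f x + g x)"
  unfolding lipschitz_def using lipschitz_on_add by blast

lemma lipschitz_minus:
  fixes f g :: "'d::metric_space \<Rightarrow> 'f::real_normed_vector"
  shows "lipschitz S f \<Longrightarrow> lipschitz S (\<lambda>x. - f x)"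
  unfolding lipschitz_def by (auto simp: lipschitz_on_def dist_minus)

lemma lipschitz_diff:
  fixes f g :: "'d::metric_space \<Rightarrow> 'f::real_normed_vector"
  shows "lipschitz S f \<Longrightarrow> lipschitz S g \<Longrightarrow> lipschitz S (\<lambda>x. f x - g x)"
  using lipschitz_add[of S f "\<lambda>x. - g x"] lipschitz_minus[of S g] by simp

lemma lipschitz_sum:
  fixes f :: "'i \<Rightarrow> 'd::metric_space \<Rightarrow> 'f::real_normed_vector"
  assumes "\<And>i. i \<in> I \<Longrightarrow> lipschitz S (f i)"
  shows "lipschitz S (\<lambda>x. \<Sum>i\<in>I. f i x)"
  using assms by (induction I rule: infinite_finite_induct) (auto intro: lipschitz_add lipschitz_const)

lemma lipschitz_Pair: "lipschitz S f \<Longrightarrow> lipschitz S g \<Longrightarrow> lipschitz S (\<lambda>x. (f x, g x))"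
  unfolding lipschitz_def using lipschitz_on_Pair by blast

text \<open>Compactness bounds both factors, and the difference of two values is split so that only
  one factor changes at a time.\<close>

lemma lipschitz_bilinear:
  fixes f :: "'d::metric_space \<Rightarrow> 'f::real_normed_vector" and g :: "'d \<Rightarrow> 'g::real_normed_vector"
  assumes "bounded_bilinear h" "lipschitz S f" "lipschitz S g" "compact S"
  shows "lipschitz S (\<lambda>x. h (f x) (g x))"
proof -
  obtain K where K: "K > 0" "\<And>a b. norm (h a b) \<le> norm a * norm b * K"
    using bounded_bilinear.pos_bounded[OF assms(1)] by blast
  obtain L M where L: "L-lipschitz_on S f" and M: "M-lipschitz_on S g"
    using assms unfolding lipschitz_def by blast
  have "bounded (f ` S)" "bounded (g ` S)"
    using assms lipschitz_continuous_on compact_continuous_image compact_imp_bounded by blast+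
  then obtain P Q where P: "\<And>x. x \<in> S \<Longrightarrow> norm (f x) \<le> P" "P > 0" and Q: "\<And>x. x \<in> S \<Longrightarrow> norm (g x) \<le>
      Q" "Q > 0"
    by (metis bounded_pos image_eqI)
  have "(K * (P * M + L * Q))-lipschitz_on S (\<lambda>x. h (f x) (g x))"
  proof (rule lipschitz_onI)
    fix x y assume xy: "x \<in> S" "y \<in> S"
    have "h (f x) (g x) - h (f y) (g y) = h (f x) (g x - g y) + h (f x - f y) (g y)"
      by (simp add: bounded_bilinear.diff_left[OF assms(1)] bounded_bilinear.diff_right[OF assms(1)])
    then have "norm (h (f x) (g x) - h (f y) (g y)) \<le> norm (h (f x) (g x - g y)) + norm (h (f x -
        f y) (g y))"
      by (simp add: norm_triangle_ineq)
    also have "\<dots> \<le> norm (f x) * norm (g x - g y) * K + norm (f x - f y) * norm (g y) * K"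
      using K(2) by (intro add_mono)
    also have "\<dots> \<le> P * (M * dist x y) * K + (L * dist x y) * Q * K"
      using P Q xy K lipschitz_onD[OF L xy] lipschitz_onD[OF M xy]
        lipschitz_on_nonneg[OF L] lipschitz_on_nonneg[OF M]
      by (intro add_mono mult_right_mono mult_mono) (auto simp: dist_norm less_imp_le)
    finally show "dist (h (f x) (g x)) (h (f y) (g y)) \<le> K * (P * M + L * Q) * dist x y"
      by (simp add: dist_norm algebra_simps)
  qed (use K P Q lipschitz_on_nonneg[OF L] lipschitz_on_nonneg[OF M] in auto)
  then show ?thesis unfolding lipschitz_def by blast
qed

lemmas lipschitz_scaleR = lipschitz_bilinear[OF bounded_bilinear_scaleR]
lemmas lipschitz_mult = lipschitz_bilinear[OF bounded_bilinear_mult]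

text \<open>A positive continuous function on a compact set is bounded below by some
  \<open>m > 0\<close>, and a difference of reciprocals is the difference of the values divided by a
  product that is at least \<open>m * m\<close>.\<close>

lemma lipschitz_inverse_real:
  fixes f :: "'d::metric_space \<Rightarrow> real"
  assumes "lipschitz S f" "compact S" "\<And>x. x \<in> S \<Longrightarrow> f x > 0"
  shows "lipschitz S (\<lambda>x. 1 / f x)"
proof (cases "S = {}")
  case True
  then show ?thesis unfolding lipschitz_def by (auto simp: lipschitz_on_def)
next
  case False
  obtain x0 where x0: "x0 \<in> S" "\<And>x. x \<in> S \<Longrightarrow> f x0 \<le> f x"
    using continuous_attains_inf[OF assms(2) False lipschitz_continuous_on[OF assms(1)]] by blast
  define m where "m = f x0"
  have m: "m > 0" "\<And>x. x \<in> S \<Longrightarrow> m \<le> f x" using x0 assms m_def by auto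
  obtain L where L: "L-lipschitz_on S f"
    using assms unfolding lipschitz_def by blast
  have "(L / (m * m))-lipschitz_on S (\<lambda>x. 1 / f x)"
  proof (rule lipschitz_onI)
    fix x y assume xy: "x \<in> S" "y \<in> S"
    have "f x > 0" "f y > 0" using assms xy by auto
    then have "\<bar>1 / f x - 1 / f y\<bar> = \<bar>f x - f y\<bar> / (f x * f y)"
      by (simp add: field_simps abs_div_pos[symmetric] abs_minus_commute)
    also have "\<dots> \<le> (L * dist x y) / (m * m)"
      using lipschitz_onD[OF L xy] m xy lipschitz_on_nonneg[OF L]
      by (intro frac_le mult_mono) (auto simp: dist_real_def intro: less_imp_le order_trans)
    finally show "dist (1 / f x) (1 / f y) \<le> L / (m * m) * dist x y"
      by (simp add: dist_real_def)
  qed (use lipschitz_on_nonneg[OF L] m in auto)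
  then show ?thesis unfolding lipschitz_def by blast
qed

text \<open>The derivative is controlled through its values on \<open>Basis\<close>: these are
  continuous, hence bounded on \<open>K\<close>, and their bounds add up to a bound \<open>C\<close>
  of the operator norm. The mean value inequality on the convex set \<open>K\<close> does the
  rest.\<close>

lemma smooth_on_lipschitz:
  fixes f :: "'e::euclidean_space \<Rightarrow> 'f::real_normed_vector"
  assumes "smooth_on S f" "open S" "compact K" "convex K" "K \<subseteq> S"
  shows "lipschitz K f"
proof -
  let ?D = "\<lambda>x. frechet_derivative f (at x)"
  have der: "(f has_derivative ?D x) (at x)" if "x \<in> K" for x
    using smooth_on_has_derivative[OF assms(2,1)] that assms(5) by blast
  have "\<exists>B. \<forall>x\<in>K. norm (?D x b) \<le> B" for b
  proof -
    have "continuous_on K (\<lambda>x. ?D x b)"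
      using smooth_on_continuous_on[OF smooth_on_derivative[OF assms(1)]] assms(5)
          continuous_on_subset by blast
    then have "bounded ((\<lambda>x. ?D x b) ` K)"
      using assms(3) compact_continuous_image compact_imp_bounded by blast
    then show ?thesis by (simp add: bounded_iff)
  qed
  then obtain B where B: "\<And>b x. x \<in> K \<Longrightarrow> norm (?D x b) \<le> B b" by metis
  define C where "C = (\<Sum>b\<in>Basis. \<bar>B b\<bar>)"
  have "norm (?D x v) \<le> C * norm v" if "x \<in> K" for x v
  proof -
    have "norm (?D x v) = norm (\<Sum>b\<in>Basis. (v \<bullet> b) *\<^sub>R ?D x b)"
      using linear_Basis_expansion[OF has_derivative_linear[OF der[OF that]], of v] by metis
    also have "\<dots> \<le> (\<Sum>b\<in>Basis. norm v * \<bar>B b\<bar>)"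
    proof (rule sum_norm_le)
      fix b :: 'e assume "b \<in> Basis"
      then have "\<bar>v \<bullet> b\<bar> \<le> norm v" by (rule Basis_le_norm)
      moreover have "norm (?D x b) \<le> \<bar>B b\<bar>" using B[OF that, of b] by linarith
      ultimately show "norm ((v \<bullet> b) *\<^sub>R ?D x b) \<le> norm v * \<bar>B b\<bar>"
        by (simp add: mult_mono)
    qed
    finally show ?thesis by (simp add: C_def sum_distrib_left mult.commute)
  qed
  then have "onorm (?D x) \<le> C" if "x \<in> K" for x
    using that onorm_bound[of C "?D x"] by (auto simp: C_def sum_nonneg)
  moreover have "C \<ge> 0" by (simp add: C_def sum_nonneg)
  ultimately have "C-lipschitz_on K f"
    using bounded_derivative_imp_lipschitz[of K f ?D C] der assms(4) has_derivative_at_withinI by blast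
  then show ?thesis unfolding lipschitz_def by blast
qed

section \<open>Ordinary differential equations\<close>

text \<open>The end points may be infinite; \<open>ereal\<close> covers all open intervals at once,
  in the form that \<open>einterval_antiderivative\<close> takes.\<close>

lemma open_interval_einterval:
  assumes "open_interval I"
  obtains a b :: ereal where "a < b" "\<And>x. x \<in> I \<longleftrightarrow> a < ereal x \<and> ereal x < b"
proof -
  have I: "open I" "is_interval I" "I \<noteq> {}" using assms by (auto simp: open_interval_def)
  define a b where "a = Inf (ereal ` I)" and "b = Sup (ereal ` I)"
  have 1: "a < ereal x \<and> ereal x < b" if x: "x \<in> I" for x
  proof -
    obtain e where e: "e > 0" "cball x e \<subseteq> I"
      using I(1) x open_contains_cball by blast
    then have "x - e \<in> I" "x + e \<in> I" by (auto simp: subset_iff dist_real_def)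
    then have "a \<le> ereal (x - e)" "ereal (x + e) \<le> b"
      unfolding a_def b_def by (auto intro: Inf_lower Sup_upper)
    then show ?thesis using e
      by (metis diff_less_eq ereal_less_eq(3) less_add_same_cancel1 linorder_not_le order_trans)
  qed
  moreover have "x \<in> I" if "a < ereal x" "ereal x < b" for x
  proof -
    have "\<exists>y\<in>ereal ` I. y < ereal x" using that(1) unfolding a_def Inf_less_iff .
    moreover have "\<exists>z\<in>ereal ` I. ereal x < z" using that(2) unfolding b_def less_Sup_iff .
    ultimately obtain y z where "y \<in> I" "z \<in> I" "y < x" "x < z" by auto
    then
    show ?thesis using I(2) by (meson less_imp_le mem_is_interval_1_I)
  qed
  moreover have "a < b" using I(3) 1 by (meson ex_in_conv less_trans)
  ultimately show ?thesis using that by blast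
qed

lemma antiderivative_open_interval:
  fixes f :: "real \<Rightarrow> 'a::euclidean_space"
  assumes "open_interval I" "continuous_on I f"
  shows "\<exists>F. \<forall>x\<in>I. (F has_vector_derivative f x) (at x)"
proof -
  obtain a b where ab: "a < b" "\<And>x. x \<in> I \<longleftrightarrow> a < ereal x \<and> ereal x < b"
    using open_interval_einterval[OF assms(1)] by blast
  have "isCont f x" if "a < ereal x" "ereal x < b" for x
    using assms that ab(2) by (simp add: open_interval_def continuous_on_eq_continuous_at)
  then show ?thesis
    using einterval_antiderivative[OF ab(1)] ab(2) by metis
qed

lemma real_antiderivative_open_interval:
  fixes f :: "real \<Rightarrow> real"
  assumes "open_interval I" "continuous_on I f"
  shows "\<exists>F. \<forall>x\<in>I. (F has_real_derivative f x) (at x)"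
  unfolding has_real_derivative_iff_has_vector_derivative
      by (rule antiderivative_open_interval[OF assms])

text \<open>Integrating factor: with \<open>H\<close> an antiderivative of \<open>h\<close>, the
  product \<open>\<phi> s * exp (- H s)\<close> has zero derivative on the interval and vanishes at
  \<open>t0\<close>.\<close>

lemma linear_ode_zero:
  fixes \<phi> h :: "real \<Rightarrow> real"
  assumes "open_interval J" "continuous_on J h"
    and "\<And>t. t \<in> J \<Longrightarrow> (\<phi> has_real_derivative h t * \<phi> t) (at t)"
    and "t0 \<in> J" "\<phi> t0 = 0" "t \<in> J"
  shows "\<phi> t = 0"
proof -
  obtain H where H: "\<And>x. x \<in> J \<Longrightarrow> (H has_real_derivative h x) (at x)"
    using real_antiderivative_open_interval[OF assms(1,2)] by auto
  have "((\<lambda>s. \<phi> s * exp (- H s)) has_real_derivative 0) (at x within J)" if "x \<in> J" for x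
    by (rule DERIV_subset[OF _ subset_UNIV])
       (auto intro!: derivative_eq_intros assms(3)[OF that] H[OF that])
  moreover have "convex J"
    using assms(1) by (simp add: open_interval_def is_interval_convex)
  ultimately obtain c where "\<And>x. x \<in> J \<Longrightarrow> \<phi> x * exp (- H x) = c"
    using has_field_derivative_zero_constant[of J "\<lambda>s. \<phi> s * exp (- H s)"] by blast
  from this[OF assms(4)] this[OF assms(6)] show ?thesis
    using assms(5) by simp
qed

text \<open>The projection onto a compact convex set is 1-Lipschitz. It extends a vector field on
  \<open>K\<close> to the whole space while keeping its range, so that a field given only near a
  point can be treated as a global one.\<close>

lemma lipschitz_closest_point_compose:
  fixes f :: "'e::euclidean_space \<Rightarrow> 'f::metric_space"
  assumes "lipschitz K f" "compact K" "convex K" "K \<noteq> {}"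
  shows "lipschitz UNIV (\<lambda>z. f (closest_point K z))"
proof (rule lipschitz_compose[where g = "closest_point K"])
  have "closed K" using assms compact_imp_closed by blast
  then have "1-lipschitz_on UNIV (closest_point K)"
    using closest_point_lipschitz[OF assms(3) _ assms(4)] by (auto intro!: lipschitz_onI)
  then show "lipschitz UNIV (closest_point K)" unfolding lipschitz_def by blast
  show "lipschitz (range (closest_point K)) f"
    using lipschitz_subset[OF assms(1)] closest_point_in_set[OF \<open>closed K\<close> assms(4)] by blast
qed

text \<open>
  The Picard operator acts on functions of time and initial value simultaneously, so that the
  fixed point is jointly continuous. Time is clamped to \<open>{-\<epsilon>..\<epsilon>}\<close>, and the integral from \<open>0\<close> to \<open>t\<close>
  is rescaled to the fixed interval \<open>{0..1}\<close>.
\<close>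

lemma picard_global:
  fixes f :: "'e::euclidean_space \<Rightarrow> 'e"
  assumes "lipschitz UNIV f" "bounded (range f)" "\<delta> > 0"
  obtains \<epsilon> \<phi> where "\<epsilon> > 0" "continuous_on UNIV (\<lambda>(t, z). \<phi> t z)"
    "\<And>z. \<phi> 0 z = z" "\<And>t z. norm (\<phi> t z - z) \<le> \<delta>"
    "\<And>t z. \<bar>t\<bar> < \<epsilon> \<Longrightarrow> ((\<lambda>t. \<phi> t z) has_vector_derivative f (\<phi> t z)) (at t)"
proof -
  obtain L where L: "L-lipschitz_on UNIV f" using assms unfolding lipschitz_def by blast
  then have L0: "L \<ge> 0" by (rule lipschitz_on_nonneg)
  obtain B where B: "\<And>z. norm (f z) \<le> B" "B > 0"
    using assms(2) by (metis bounded_pos rangeI)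
  have contf: "continuous_on UNIV f" using assms lipschitz_continuous_on by blast
  \<comment> \<open>The first bound makes the operator a contraction with factor 1/2, the second
    keeps the displacement within \<open>\<delta>\<close>. The summand 1 in \<open>L + 1\<close>
    keeps the denominator positive when \<open>L\<close> is 0.\<close>
  define \<epsilon> where "\<epsilon> = min (1 / (2 * (L + 1))) (\<delta> / B)"
  have e0: "\<epsilon> > 0" using L0 B assms by (simp add: \<epsilon>_def)
  have "\<epsilon> \<le> 1 / (2 * (L + 1))" by (simp add: \<epsilon>_def)
  then have "\<epsilon> * (2 * (L + 1)) \<le> 1" using L0 by (simp add: pos_le_divide_eq)
  then have eL: "\<epsilon> * L \<le> 1/2" using e0 by (simp add: algebra_simps)
  have eB: "\<epsilon> * B \<le> \<delta>" using B by (simp add: \<epsilon>_def min_def field_simps)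
  define c where "c t = max (- \<epsilon>) (min \<epsilon> t)" for t :: real
  have c: "\<bar>c t\<bar> \<le> \<epsilon>" for t using e0 by (auto simp: c_def)
  \<comment> \<open>The unknown is the displacement \<open>\<phi> t z - z\<close> rather than
    \<open>\<phi>\<close> itself: it is bounded, and so lies in the complete space of bounded
    continuous functions, where the fixed-point theorem applies.\<close>
  define T :: "((real \<times> 'e) \<Rightarrow>\<^sub>C 'e) \<Rightarrow> (real \<times> 'e) \<Rightarrow> 'e"
    where "T \<psi> p = c (fst p) *\<^sub>R integral {0..1} (\<lambda>s. f (snd p + apply_bcontfun \<psi> (c (fst p) *
        s, snd p)))" for \<psi> p
  have integrand: "continuous_on UNIV (\<lambda>(p, s). f (snd p + apply_bcontfun \<psi> (c (fst p) * s, snd p)))"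
    for \<psi> :: "(real \<times> 'e) \<Rightarrow>\<^sub>C 'e"
    unfolding split_beta c_def
    by (intro continuous_on_compose2[OF contf] continuous_intros
        continuous_on_compose2[OF continuous_on_apply_bcontfun[of UNIV \<psi>]]) auto
  have int: "(\<lambda>s. f (snd p + apply_bcontfun \<psi> (c (fst p) * s, snd p))) integrable_on {0..1}"
    for \<psi> :: "(real \<times> 'e) \<Rightarrow>\<^sub>C 'e" and p
  proof -
    have "continuous_on {0..1} (\<lambda>s. f (snd p + apply_bcontfun \<psi> (c (fst p) * s, snd p)))"
      using continuous_on_compose2[OF integrand, of "{0..1}" "\<lambda>s. (p, s)"]
      by (simp add: continuous_on_Pair continuous_on_const continuous_on_id)
    then show ?thesis by (rule integrable_continuous_real)
  qed
  have bound: "norm (T \<psi> p) \<le> \<delta>" for \<psi> p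
  proof -
    have "norm (integral {0..1} (\<lambda>s. f (snd p + apply_bcontfun \<psi> (c (fst p) * s, snd p)))) \<le>
        integral {0..1::real} (\<lambda>_. B)"
      by (rule integral_norm_bound_integral[OF int]) (use B in auto)
    then have "norm (integral {0..1} (\<lambda>s. f (snd p + apply_bcontfun \<psi> (c (fst p) * s, snd p)))) \<le> B"
      by simp
    then have "norm (T \<psi> p) \<le> \<epsilon> * B"
      unfolding T_def using c[of "fst p"] e0 by (simp add: mult_mono)
    then show ?thesis using eB by simp
  qed
  have contT: "continuous_on UNIV (T \<psi>)" for \<psi>
  proof -
    have "continuous_on UNIV (\<lambda>p. integral (cbox 0 1) (\<lambda>s::real. f (snd p + apply_bcontfun \<psi> (c
        (fst p) * s, snd p))))"
      by (rule integral_continuous_on_param) (rule continuous_on_subset[OF integrand], simp)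
    then have "continuous_on UNIV (\<lambda>p. integral {0..1} (\<lambda>s::real. f (snd p + apply_bcontfun \<psi> (c
        (fst p) * s, snd p))))"
      by simp
    then show ?thesis unfolding T_def
      by (rule continuous_on_scaleR[rotated]) (unfold c_def, intro continuous_intros)
  qed
  have inb: "T \<psi> \<in> bcontfun" for \<psi>
    using bound contT by (auto simp: bcontfun_def bounded_iff)
  define P where "P \<psi> = Bcontfun (T \<psi>)" for \<psi>
  have P: "apply_bcontfun (P \<psi>) = T \<psi>" for \<psi>
    unfolding P_def using inb by (simp add: Bcontfun_inverse)
  have "dist (P \<psi>) (P \<xi>) \<le> 1/2 * dist \<psi> \<xi>" for \<psi> \<xi>
  proof (rule dist_bound)
    fix p
    let ?g = "\<lambda>\<psi> s. f (snd p + apply_bcontfun \<psi> (c (fst p) * s, snd p))"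
    have "norm (integral {0..1} (\<lambda>s. ?g \<psi> s - ?g \<xi> s)) \<le> integral {0..1::real} (\<lambda>_. L * dist \<psi> \<xi>)"
    proof (rule integral_norm_bound_integral)
      fix s :: real
      have "dist (?g \<psi> s) (?g \<xi> s) \<le> L * dist (snd p + apply_bcontfun \<psi> (c (fst p) * s, snd p))
          (snd p + apply_bcontfun \<xi> (c (fst p) * s, snd p))"
        by (rule lipschitz_onD[OF L]) auto
      also have "\<dots> \<le> L * dist \<psi> \<xi>"
        using L0 dist_bounded[of \<psi> _ \<xi>] by (simp add: mult_left_mono)
      finally show "norm (?g \<psi> s - ?g \<xi> s) \<le> L * dist \<psi> \<xi>" by (simp add: dist_norm)
    qed (auto intro: integrable_diff int)
    then have "norm (integral {0..1} (?g \<psi>) - integral {0..1} (?g \<xi>)) \<le> L * dist \<psi> \<xi>"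
      by (simp add: integral_diff[OF int int])
    then have "norm (T \<psi> p - T \<xi> p) \<le> \<epsilon> * (L * dist \<psi> \<xi>)"
      unfolding T_def using c[of "fst p"] e0
      by (simp add: scaleR_diff_right[symmetric] mult_mono)
    also have "\<dots> \<le> 1/2 * dist \<psi> \<xi>"
      using mult_right_mono[OF eL, of "dist \<psi> \<xi>"] by (simp add: mult.assoc)
    finally show "dist (apply_bcontfun (P \<psi>) p) (apply_bcontfun (P \<xi>) p) \<le> 1/2 * dist \<psi> \<xi>"
      by (simp add: P dist_norm)
  qed
  then have "\<exists>!\<psi>. P \<psi> = \<psi>" by (intro banach_fix_type[of "1/2"]) auto
  then obtain \<psi> where "P \<psi> = \<psi>" by blast
  then have fix\<psi>: "apply_bcontfun \<psi> = T \<psi>" using P by metis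
  define \<phi> where "\<phi> t z = z + apply_bcontfun \<psi> (t, z)" for t z
  have "continuous_on UNIV (\<lambda>p. snd p + apply_bcontfun \<psi> p)"
    by (intro continuous_intros continuous_on_apply_bcontfun)
  then have cont: "continuous_on UNIV (\<lambda>(t, z). \<phi> t z)"
    by (simp add: \<phi>_def split_beta)
  have deriv: "((\<lambda>t. \<phi> t z) has_vector_derivative f (\<phi> t z)) (at t)" if t: "\<bar>t\<bar> < \<epsilon>" for t z
  proof -
    have "open_interval (UNIV::real set)" by (simp add: open_interval_def)
    moreover have "continuous_on UNIV (\<lambda>s. f (\<phi> s z))"
    proof (rule continuous_on_compose2[OF contf])
      show "continuous_on UNIV (\<lambda>s. \<phi> s z)"
        using continuous_on_compose2[OF cont, of UNIV "\<lambda>s. (s, z)"]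
        by (simp add: continuous_on_Pair continuous_on_const continuous_on_id)
    qed simp
    ultimately obtain H where H: "\<And>x. (H has_vector_derivative f (\<phi> x z)) (at x)"
      using antiderivative_open_interval[of UNIV "\<lambda>s. f (\<phi> s z)"] by auto
    \<comment> \<open>The fixed-point equation is rewritten with an antiderivative \<open>H\<close>
      of the right-hand side along the solution. For small \<open>s\<close> the clamp is the
      identity, and \<open>H (s * r)\<close> as a function of \<open>r\<close> is an antiderivative
      of the rescaled integrand times \<open>s\<close>. Differentiating in time then means
      differentiating \<open>H\<close>.\<close>
    have eq: "\<phi> s z = z + (H s - H 0)" if s: "\<bar>s\<bar> < \<epsilon>" for s
    proof -
      have cs: "c s = s" using s by (auto simp: c_def)
      have d: "((\<lambda>r. H (s * r)) has_vector_derivative s *\<^sub>R f (\<phi> (s * x) z)) (at x within {0..1})" for x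
      proof -
        have "((\<lambda>r. s * r) has_vector_derivative s) (at x)"
          by (auto intro!: derivative_eq_intros simp:
              has_real_derivative_iff_has_vector_derivative[symmetric])
        from vector_diff_chain_at[OF this H]
        show ?thesis by (simp add: o_def has_vector_derivative_at_within)
      qed
      have "((\<lambda>r. s *\<^sub>R f (\<phi> (s * r) z)) has_integral H (s * 1) - H (s * 0)) {0..1}"
        by (rule fundamental_theorem_of_calculus) (auto intro: d)
      then have "integral {0..1} (\<lambda>r. s *\<^sub>R f (\<phi> (s * r) z)) = H (s * 1) - H (s * 0)"
        by (rule integral_unique)
      moreover have "apply_bcontfun \<psi> (s, z) = s *\<^sub>R integral {0..1} (\<lambda>r. f (\<phi> (s * r) z))"
        using fun_cong[OF fix\<psi>, of "(s, z)"] by (simp add: T_def cs \<phi>_def)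
      ultimately show ?thesis by (simp add: \<phi>_def)
    qed
    have "((\<lambda>s. z + (H s - H 0)) has_vector_derivative f (\<phi> t z)) (at t)"
      by (auto intro!: derivative_eq_intros H)
    then show ?thesis
      by (rule has_vector_derivative_transform_within_open[of _ _ _ "{-\<epsilon><..<\<epsilon>}"]) (use t eq in auto)
  qed
  have "\<phi> 0 z = z" for z
    using fun_cong[OF fix\<psi>, of "(0, z)"] e0 by (simp add: \<phi>_def T_def c_def)
  moreover have "norm (\<phi> t z - z) \<le> \<delta>" for t z
    using bound fix\<psi> by (simp add: \<phi>_def)
  ultimately show ?thesis using that[of \<epsilon> \<phi>] e0 cont deriv by blast
qed

text \<open>\<open>\<phi>\<close> solves the equation for the extended field, and inside
  \<open>K\<close> the two fields agree. With \<open>ball z0 R\<close> inside \<open>K\<close>, a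
  start within \<open>R / 2\<close> and a displacement of at most \<open>R / 3\<close> remain in
  \<open>K\<close>, since the sum is below \<open>R\<close>. The bound on the displacement holds for
  all times, and so does membership in \<open>K\<close>.\<close>

lemma picard_local:
  fixes f :: "'e::euclidean_space \<Rightarrow> 'e"
  assumes "lipschitz K f" "compact K" "convex K" "z0 \<in> interior K"
  obtains r \<epsilon> \<phi> where "r > 0" "\<epsilon> > 0" "continuous_on UNIV (\<lambda>(t, z). \<phi> t z)" "\<And>z. \<phi> 0 z = z"
    "\<And>t z. z \<in> ball z0 r \<Longrightarrow> \<phi> t z \<in> K"
    "\<And>t z. z \<in> ball z0 r \<Longrightarrow> \<bar>t\<bar> < \<epsilon> \<Longrightarrow> ((\<lambda>t. \<phi> t z) has_vector_derivative f (\<phi> t z)) (at t)"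
proof -
  have ne: "K \<noteq> {}" "closed K" using assms interior_subset compact_imp_closed by auto
  obtain R where R: "R > 0" "ball z0 R \<subseteq> K" using assms(4) by (metis mem_interior)
  let ?f = "\<lambda>z. f (closest_point K z)"
  have "bounded (f ` K)"
    using assms lipschitz_continuous_on compact_continuous_image compact_imp_bounded by blast
  moreover have "range ?f \<subseteq> f ` K" using closest_point_in_set[OF ne(2,1)] by auto
  ultimately have "bounded (range ?f)" using bounded_subset by blast
  moreover have "R / 3 > 0" using R(1) by simp
  ultimately obtain \<epsilon> \<phi> where \<phi>: "\<epsilon> > 0" "continuous_on UNIV (\<lambda>(t, z). \<phi> t z)"
    "\<And>z. \<phi> 0 z = z" "\<And>t z. norm (\<phi> t z - z) \<le> R / 3"
    "\<And>t z. \<bar>t\<bar> < \<epsilon> \<Longrightarrow> ((\<lambda>t. \<phi> t z) has_vector_derivative ?f (\<phi> t z)) (at t)"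
    using picard_global[OF lipschitz_closest_point_compose[OF assms(1-3) ne(1)], of "R / 3"] by blast
  have inK: "\<phi> t z \<in> K" if "z \<in> ball z0 (R / 2)" for t z
  proof -
    have "dist z0 (\<phi> t z) \<le> dist z0 z + norm (\<phi> t z - z)"
      by (metis dist_norm dist_triangle norm_minus_commute)
    also have "\<dots> < R" using that \<phi>(4)[of t z] R(1) by (auto simp: field_simps)
    finally show ?thesis using R(2) by auto
  qed
  have "((\<lambda>t. \<phi> t z) has_vector_derivative f (\<phi> t z)) (at t)" if "z \<in> ball z0 (R / 2)" "\<bar>t\<bar> < \<epsilon>" for t z
    using \<phi>(5)[OF that(2)] inK[OF that(1)] closest_point_self by metis
  then show ?thesis using that[of "R / 2" \<epsilon> \<phi>] R(1) \<phi>(1-3) inK by simp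
qed

text \<open>Gronwall argument for the squared distance \<open>d\<close>: the Lipschitz bound gives
  |d'| <= 2 L d. Hence \<open>d\<close> times an exponential of rate \<open>- 2 * L\<close> is
  nonincreasing, which settles later times, and \<open>d\<close> times one of rate
  \<open>2 * L\<close> is nondecreasing, which settles earlier times.\<close>

lemma ode_unique:
  fixes x y :: "real \<Rightarrow> 'e::real_inner"
  assumes "lipschitz K f" "is_interval J" "a \<in> J" "t \<in> J" "x a = y a"
    and x: "\<And>s. s \<in> J \<Longrightarrow> x s \<in> K \<and> (x has_vector_derivative f (x s)) (at s)"
    and y: "\<And>s. s \<in> J \<Longrightarrow> y s \<in> K \<and> (y has_vector_derivative f (y s)) (at s)"
  shows "x t = y t"
proof -
  obtain L where L: "L-lipschitz_on K f" using assms(1) unfolding lipschitz_def by blast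
  define d where "d s = (x s - y s) \<bullet> (x s - y s)" for s
  define d' where "d' s = 2 * ((x s - y s) \<bullet> (f (x s) - f (y s)))" for s
  have der: "(d has_real_derivative d' s) (at s)" if "s \<in> J" for s
  proof -
    have v: "((\<lambda>s. x s - y s) has_vector_derivative (f (x s) - f (y s))) (at s)"
      using x[OF that] y[OF that] by (intro has_vector_derivative_diff) auto
    from bounded_bilinear.has_vector_derivative[OF bounded_bilinear_inner v v]
    show ?thesis
      unfolding has_real_derivative_iff_has_vector_derivative d_def d'_def
      by (simp add: inner_commute)
  qed
  have bd: "\<bar>d' s\<bar> \<le> 2 * L * d s" if "s \<in> J" for s
  proof -
    have "\<bar>(x s - y s) \<bullet> (f (x s) - f (y s))\<bar> \<le> norm (x s - y s) * norm (f (x s) - f (y s))"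
      by (rule Cauchy_Schwarz_ineq2)
    also have "\<dots> \<le> norm (x s - y s) * (L * norm (x s - y s))"
      using lipschitz_onD[OF L, of "x s" "y s"] x[OF that] y[OF that]
      by (intro mult_left_mono) (auto simp: dist_norm)
    finally show ?thesis
      by (simp add: d'_def d_def dot_square_norm power2_eq_square algebra_simps)
  qed
  have "d t \<le> 0"
  proof (cases "a \<le> t")
    case True
    have sub: "s \<in> J" if "a \<le> s" "s \<le> t" for s
      using assms(2-4) that by (meson mem_is_interval_1_I)
    have "d t * exp (- (2 * L) * t) \<le> d a * exp (- (2 * L) * a)"
    proof (rule DERIV_nonpos_imp_nonincreasing[OF True])
      fix s assume s: "a \<le> s" "s \<le> t"
      have "((\<lambda>s. d s * exp (- (2 * L) * s)) has_real_derivative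
          (d' s - 2 * L * d s) * exp (- (2 * L) * s)) (at s)"
        by (auto intro!: derivative_eq_intros der[OF sub[OF s]] simp: algebra_simps)
      moreover have "(d' s - 2 * L * d s) * exp (- (2 * L) * s) \<le> 0"
        using bd[OF sub[OF s]] by (intro mult_nonpos_nonneg) auto
      ultimately show "\<exists>D. ((\<lambda>s. d s * exp (- (2 * L) * s)) has_real_derivative D) (at s) \<and> D \<le> 0"
        by blast
    qed
    then show ?thesis using assms(5) by (simp add: d_def mult_le_0_iff not_le)
  next
    case False
    then have le: "t \<le> a" by simp
    have sub: "s \<in> J" if "t \<le> s" "s \<le> a" for s
      using assms(2-4) that by (meson mem_is_interval_1_I)
    have "d t * exp (2 * L * t) \<le> d a * exp (2 * L * a)"
    proof (rule DERIV_nonneg_imp_nondecreasing[OF le])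
      fix s assume s: "t \<le> s" "s \<le> a"
      have "((\<lambda>s. d s * exp (2 * L * s)) has_real_derivative
          (d' s + 2 * L * d s) * exp (2 * L * s)) (at s)"
        by (auto intro!: derivative_eq_intros der[OF sub[OF s]] simp: algebra_simps)
      moreover have "(d' s + 2 * L * d s) * exp (2 * L * s) \<ge> 0"
        using bd[OF sub[OF s]] by (intro mult_nonneg_nonneg) auto
      ultimately show "\<exists>D. ((\<lambda>s. d s * exp (2 * L * s)) has_real_derivative D) (at s) \<and> D \<ge> 0"
        by blast
    qed
    then show ?thesis using assms(5) by (simp add: d_def mult_le_0_iff not_le)
  qed
  moreover have "d t \<ge> 0" by (simp add: d_def)
  ultimately have "d t = 0" by simp
  then show ?thesis by (simp add: d_def)
qed

text \<open>Invariance of domain makes the image open; then the inverse is continuous and defined on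
  a neighbourhood of each value, as the inverse function rule demands. It serves to pass between arc
  length and other times.\<close>

lemma increasing_inverse_function:
  fixes \<sigma> :: "real \<Rightarrow> real"
  assumes "open_interval I" "\<And>t. t \<in> I \<Longrightarrow> (\<sigma> has_real_derivative \<sigma>' t) (at t)"
    "\<And>t. t \<in> I \<Longrightarrow> \<sigma>' t > 0"
  shows "inj_on \<sigma> I" "open_interval (\<sigma> ` I)"
    "\<And>t. t \<in> I \<Longrightarrow> (inv_into I \<sigma> has_real_derivative 1 / \<sigma>' t) (at (\<sigma> t))"
proof -
  have I: "open I" "is_interval I" "I \<noteq> {}" using assms by (auto simp: open_interval_def)
  have lt: "\<sigma> s < \<sigma> t" if "s \<in> I" "t \<in> I" "s < t" for s t
  proof (rule DERIV_pos_imp_increasing[OF that(3)])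
    fix x assume "s \<le> x" "x \<le> t"
    then have "x \<in> I" using I(2) that by (meson mem_is_interval_1_I)
    then show "\<exists>D. (\<sigma> has_real_derivative D) (at x) \<and> D > 0" using assms by blast
  qed
  show inj: "inj_on \<sigma> I"
    by (rule inj_onI) (metis lt less_irrefl linorder_neqE_linordered_idom)
  have cont: "continuous_on I \<sigma>"
    using assms(2) by (meson DERIV_isCont continuous_at_imp_continuous_on)
  have op: "open (\<sigma> ` I)"
    by (rule invariance_of_domain[OF cont I(1) inj])
  have "is_interval (\<sigma> ` I)"
    using I(2) cont connected_continuous_image is_interval_connected_1 by blast
  then show "open_interval (\<sigma> ` I)"
    using op I(3) by (simp add: open_interval_def)
  have contg: "continuous_on (\<sigma> ` I) (inv_into I \<sigma>)"
    by (rule continuous_on_inverse_open[OF I(1) cont]) (auto simp: inj)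
  show "(inv_into I \<sigma> has_real_derivative 1 / \<sigma>' t) (at (\<sigma> t))" if t: "t \<in> I" for t
  proof -
    have "\<sigma> t \<in> \<sigma> ` I" using t by auto
    then obtain e where e: "e > 0" "ball (\<sigma> t) e \<subseteq> \<sigma> ` I" using op open_contains_ball by blast
    have "(inv_into I \<sigma> has_real_derivative inverse (\<sigma>' t)) (at (\<sigma> t))"
    proof (rule DERIV_inverse_function[where a = "\<sigma> t - e" and b = "\<sigma> t + e"])
      show "(\<sigma> has_real_derivative \<sigma>' t) (at (inv_into I \<sigma> (\<sigma> t)))"
        using assms(2)[OF t] inj t by simp
      show "isCont (inv_into I \<sigma>) (\<sigma> t)"
        using contg op t by (simp add: continuous_on_eq_continuous_at)
      show "\<sigma> (inv_into I \<sigma> y) = y" if "\<sigma> t - e < y" "y < \<sigma> t + e" for y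
      proof (rule f_inv_into_f)
        show "y \<in> \<sigma> ` I" using e(2) that by (auto simp: subset_iff dist_real_def)
      qed
    qed (use e assms(3)[OF t] in auto)
    then show ?thesis by (simp add: inverse_eq_divide)
  qed
qed

section \<open>Flows from local solutions on compact spaces\<close>

text \<open>A local flow over \<open>N\<close> without the group law: the lifetime is common to all
  starting points, and the dependence on time and start is jointly continuous. The group law comes
  later from uniqueness.\<close>

abbreviation flow_box ::
    "'b topology \<Rightarrow> ((real \<Rightarrow> 'b) \<Rightarrow> real \<Rightarrow> bool) \<Rightarrow> 'b set \<Rightarrow> real \<Rightarrow> (real \<Rightarrow> 'b \<Rightarrow> 'b) \<Rightarrow> bool" where
  "flow_box B D N \<epsilon> \<phi> \<equiv>
     continuous_map (subtopology (prod_topology euclideanreal B) ({-\<epsilon><..<\<epsilon>} \<times> N)) B (\<lambda>(t, y). \<phi> t y) \<and>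
     (\<forall>y\<in>N. \<phi> 0 y = y \<and> (\<forall>t\<in>{-\<epsilon><..<\<epsilon>}. D (\<lambda>t. \<phi> t y) t))"

text \<open>\<open>D \<gamma> t\<close> says that the curve \<open>\<gamma>\<close> satisfies the equation of motion at time \<open>t\<close>.\<close>

locale local_flow =
  fixes B :: "'b topology" and D :: "(real \<Rightarrow> 'b) \<Rightarrow> real \<Rightarrow> bool"
  assumes compact_B: "compact_space B" and Hausdorff_B: "Hausdorff_space B"
    and D_cont: "D \<gamma> t \<Longrightarrow> limitin B \<gamma> (\<gamma> t) (at t)"
    and D_cong: "D \<gamma> t \<Longrightarrow> \<forall>\<^sub>F s in nhds t. \<delta> s = \<gamma> s \<Longrightarrow> D \<delta> t"
    and D_shift: "D \<gamma> (s + t) \<Longrightarrow> D (\<lambda>x. \<gamma> (s + x)) t"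
    and D_unique: "\<forall>\<^sub>F s in nhds t. D \<gamma> s \<Longrightarrow> \<forall>\<^sub>F s in nhds t. D \<delta> s \<Longrightarrow> \<gamma> t = \<delta> t \<Longrightarrow>
      \<forall>\<^sub>F s in nhds t. \<gamma> s = \<delta> s"
    and D_exist: "z \<in> topspace B \<Longrightarrow> \<exists>N \<epsilon> \<phi>. openin B N \<and> z \<in> N \<and> \<epsilon> > 0 \<and>
      flow_box B D N \<epsilon> \<phi>"
begin

lemma D_topspace: "D \<gamma> t \<Longrightarrow> \<gamma> t \<in> topspace B"
  using D_cont limitin_topspace by metis

lemma eventually_D: "open J \<Longrightarrow> t \<in> J \<Longrightarrow> (\<And>s. s \<in> J \<Longrightarrow> D \<gamma> s) \<Longrightarrow> \<forall>\<^sub>F s in nhds t. D \<gamma> s"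
  unfolding eventually_nhds by blast

lemma D_cong_open:
  assumes "open J" "t \<in> J" "D \<gamma> t" "\<And>s. s \<in> J \<Longrightarrow> \<delta> s = \<gamma> s"
  shows "D \<delta> t"
  using D_cong[OF assms(3)] assms unfolding eventually_nhds by blast

lemma D_nhds:
  assumes "D \<gamma> t" "openin B U" "\<gamma> t \<in> U"
  shows "\<forall>\<^sub>F s in nhds t. \<gamma> s \<in> U"
proof -
  have "\<forall>\<^sub>F s in at t. \<gamma> s \<in> U"
    using D_cont[OF assms(1)] assms(2,3) by (simp add: limitin_def)
  then have "\<forall>\<^sub>F s in nhds t. s \<noteq> t \<longrightarrow> \<gamma> s \<in> U"
    by (simp add: eventually_at_filter)
  then show ?thesis
    by (rule eventually_mono) (use assms(3) in metis)
qed

text \<open>The interval is connected. The set where the curves agree is open by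
  \<open>D_unique\<close>, and the set where they differ is open because the curves are continuous
  into a Hausdorff space.\<close>

lemma solution_unique:
  assumes "open_interval J" "\<And>t. t \<in> J \<Longrightarrow> D \<gamma> t" "\<And>t. t \<in> J \<Longrightarrow> D \<delta> t"
    and "t0 \<in> J" "\<gamma> t0 = \<delta> t0" "t \<in> J"
  shows "\<gamma> t = \<delta> t"
proof (rule ccontr)
  assume ne: "\<gamma> t \<noteq> \<delta> t"
  have J: "open J" "connected J"
    using assms(1) by (auto simp: open_interval_def is_interval_connected)
  define S T where "S = {t \<in> J. \<gamma> t = \<delta> t}" and "T = {t \<in> J. \<gamma> t \<noteq> \<delta> t}"
  have evJ: "\<forall>\<^sub>F s in nhds t. s \<in> J" if "t \<in> J" for t
    using J(1) that eventually_nhds by blast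
  have "open S"
    unfolding open_subopen[of S]
  proof
    fix t assume t: "t \<in> S"
    then have "\<forall>\<^sub>F s in nhds t. \<gamma> s = \<delta> s"
      using D_unique[where t = t and \<gamma> = \<gamma> and \<delta> = \<delta>] eventually_D[OF J(1)] assms(2,3)
          by (auto simp: S_def)
    then have "\<forall>\<^sub>F s in nhds t. s \<in> S"
      using evJ[of t] t by (auto simp: S_def elim: eventually_elim2)
    then show "\<exists>T. open T \<and> t \<in> T \<and> T \<subseteq> S"
      unfolding eventually_nhds by blast
  qed
  moreover have "open T"
    unfolding open_subopen[of T]
  proof
    fix t assume t: "t \<in> T"
    then have D: "D \<gamma> t" "D \<delta> t" using assms by (auto simp: T_def)
    obtain U V where UV: "openin B U" "openin B V" "\<gamma> t \<in> U" "\<delta> t \<in> V" "disjnt U V"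
      using Hausdorff_B D_topspace[OF D(1)] D_topspace[OF D(2)] t
      unfolding Hausdorff_space_def T_def by blast
    have "t \<in> J" using t by (simp add: T_def)
    have "\<forall>\<^sub>F s in nhds t. s \<in> T"
      using D_nhds[OF D(1) UV(1,3)] D_nhds[OF D(2) UV(2,4)] evJ[OF \<open>t \<in> J\<close>]
    proof eventually_elim
      case (elim s)
      then show ?case using UV(5) by (auto simp: T_def disjnt_iff)
    qed
    then show "\<exists>R. open R \<and> t \<in> R \<and> R \<subseteq> T"
      unfolding eventually_nhds by blast
  qed
  moreover have "S \<inter> T \<inter> J = {}" "J \<subseteq> S \<union> T" by (auto simp: S_def T_def)
  ultimately have "S \<inter> J = {} \<or> T \<inter> J = {}"
    using connectedD[OF J(2)] by blast
  then show False using assms ne by (auto simp: S_def T_def)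
qed

text \<open>The time \<open>a\<close> is the same for every starting point, so a solution can be
  restarted at any of its points for another time \<open>a\<close>.\<close>

definition solvable :: "real \<Rightarrow> bool" where
  "solvable a \<longleftrightarrow> (\<forall>z\<in>topspace B. \<exists>\<gamma>. \<gamma> 0 = z \<and> (\<forall>t\<in>{-a<..<a}. D \<gamma> t))"

lemma solvable_mono: "solvable a \<Longrightarrow> b \<le> a \<Longrightarrow> solvable b"
  unfolding solvable_def by (meson greaterThanLessThan_iff less_le_trans minus_le_iff order_trans
      le_less_trans neg_le_iff_le)

lemma open_interval_box: "a < b \<Longrightarrow> open_interval {a<..<b::real}"
  by (simp add: open_interval_def is_interval_oo)

text \<open>Solutions restarted at the times \<open>a / 2\<close> and \<open>- (a / 2)\<close> live
  for another \<open>a\<close>, hence reach \<open>3 / 2 * a\<close> on both sides. On the overlaps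
  they agree with the first solution by uniqueness.\<close>

lemma solvable_extend:
  assumes "solvable a" "a > 0"
  shows "solvable (3 / 2 * a)"
  unfolding solvable_def
proof
  fix z assume "z \<in> topspace B"
  then obtain \<gamma> where \<gamma>: "\<gamma> 0 = z" "\<And>t. t \<in> {-a<..<a} \<Longrightarrow> D \<gamma> t"
    using assms(1) unfolding solvable_def by blast
  have ex: "\<exists>\<delta>. (\<forall>t\<in>{c-a<..<c+a}. D \<delta> t) \<and> (\<forall>t\<in>{-a<..<a} \<inter> {c-a<..<c+a}. \<delta> t = \<gamma> t)"
    if c: "c \<in> {-a<..<a}" for c
  proof -
    obtain \<delta> where \<delta>: "\<delta> 0 = \<gamma> c" "\<And>t. t \<in> {-a<..<a} \<Longrightarrow> D \<delta> t"
      using assms(1) D_topspace[OF \<gamma>(2)[OF c]] unfolding solvable_def by blast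
    have D: "D (\<lambda>t. \<delta> (-c + t)) t" if "t \<in> {c-a<..<c+a}" for t
      using that by (intro D_shift \<delta>(2)) auto
    moreover have "\<delta> (-c + t) = \<gamma> t" if t: "t \<in> {-a<..<a} \<inter> {c-a<..<c+a}" for t
    proof (rule solution_unique[of "{max (-a) (c-a)<..<min a (c+a)}" "\<lambda>t. \<delta> (-c + t)" \<gamma> c t])
      show "open_interval {max (-a) (c-a)<..<min a (c+a)}"
        using t by (intro open_interval_box) auto
    qed (use \<gamma>(2) D t c assms(2) \<delta>(1) in auto)
    ultimately show ?thesis by blast
  qed
  have "a / 2 \<in> {-a<..<a}" "- (a / 2) \<in> {-a<..<a}" using assms(2) by auto
  from ex[OF this(1)] ex[OF this(2)] obtain \<delta> \<eta> where
    \<delta>: "\<And>t. t \<in> {a/2-a<..<a/2+a} \<Longrightarrow> D \<delta> t" "\<And>t. t \<in> {-a<..<a} \<inter> {a/2-a<..<a/2+a} \<Longrightarrow> \<delta> t = \<gamma> t" and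
    \<eta>: "\<And>t. t \<in> {-(a/2)-a<..<-(a/2)+a} \<Longrightarrow> D \<eta> t" "\<And>t. t \<in> {-a<..<a} \<inter> {-(a/2)-a<..<-(a/2)+a} \<Longrightarrow> \<eta> t = \<gamma> t"
    by blast
  \<comment> \<open>Since the pieces agree on the overlaps, \<open>\<kappa>\<close> coincides with a
    single piece on each of the three open intervals, and \<open>D_cong_open\<close> applies at
    every time.\<close>
  define \<kappa> where "\<kappa> t = (if t \<in> {-a<..<a} then \<gamma> t else if t > 0 then \<delta> t else \<eta> t)" for t
  have "D \<kappa> t" if t: "t \<in> {- (3/2*a)<..<3/2*a}" for t
  proof -
    consider "t \<in> {-a<..<a}" | "t \<in> {a/2-a<..<a/2+a}" | "t \<in> {-(a/2)-a<..<-(a/2)+a}"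
      using t by fastforce
    then show ?thesis
    proof cases
      case 1
      then show ?thesis
        by (intro D_cong_open[of "{-a<..<a}" t \<gamma> \<kappa>] \<gamma>(2)) (auto simp: \<kappa>_def)
    next
      case 2
      then show ?thesis
        using \<delta> assms(2) by (intro D_cong_open[of "{a/2-a<..<a/2+a}" t \<delta> \<kappa>]) (auto simp: \<kappa>_def)
    next
      case 3
      then show ?thesis
        using \<eta> assms(2) by (intro D_cong_open[of "{-(a/2)-a<..<-(a/2)+a}" t \<eta> \<kappa>]) (auto simp: \<kappa>_def)
    qed
  qed
  moreover have "\<kappa> 0 = z" using \<gamma>(1) assms(2) by (simp add: \<kappa>_def)
  ultimately show "\<exists>\<gamma>. \<gamma> 0 = z \<and> (\<forall>t\<in>{- (3/2*a)<..<3/2*a}. D \<gamma> t)" by blast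
qed

text \<open>Compactness: finitely many flow boxes cover the space, and the least of their lifetimes
  serves everywhere.\<close>

lemma uniform_time:
  obtains \<epsilon> where "\<epsilon> > 0" "\<And>z. z \<in> topspace B \<Longrightarrow> \<exists>N \<phi>. openin B N \<and> z \<in> N \<and>
      flow_box B D N \<epsilon> \<phi>"
proof -
  obtain N \<epsilon> \<phi> where N: "\<And>z. z \<in> topspace B \<Longrightarrow> openin B (N z) \<and> z \<in> N z \<and> \<epsilon> z > (0::real) \<and>
      flow_box B D (N z) (\<epsilon> z) (\<phi> z)"
    using D_exist by metis
  have "\<exists>F. finite F \<and> F \<subseteq> N ` topspace B \<and> topspace B \<subseteq> \<Union>F"
  proof -
    have "compactin B (topspace B)" using compact_B by (simp add: compact_space_def)
    moreover have "openin B U" if "U \<in> N ` topspace B" for U using that N by blast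
    moreover have "topspace B \<subseteq> \<Union>(N ` topspace B)" using N by blast
    ultimately show ?thesis
      using compactinD[of B "topspace B" "N ` topspace B"] by simp
  qed
  then obtain Z where Z: "finite Z" "Z \<subseteq> topspace B" "topspace B \<subseteq> \<Union>(N ` Z)"
    by (metis finite_subset_image)
  \<comment> \<open>The extra 1 keeps the set nonempty when \<open>Z\<close> is empty, which can
    happen over an empty space.\<close>
  define e where "e = Min (insert 1 (\<epsilon> ` Z))"
  have e: "e > 0" "\<And>z. z \<in> Z \<Longrightarrow> e \<le> \<epsilon> z"
    using Z N by (auto simp: e_def)
  have P: "flow_box B D (N z) e (\<phi> z)" if "z \<in> Z" for z
  proof -
    have PN: "flow_box B D (N z) (\<epsilon> z) (\<phi> z)" using N Z(2) that by blast
    have sub: "{-e<..<e} \<subseteq> {-\<epsilon> z<..<\<epsilon> z}" using e(2)[OF that] by auto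
    have "continuous_map (subtopology (prod_topology euclideanreal B) ({-e<..<e} \<times> N z)) B (\<lambda>(t, y).
        \<phi> z t y)"
      by (rule continuous_map_from_subtopology_mono[OF conjunct1[OF PN]]) (use sub in auto)
    moreover have "\<forall>t\<in>{-e<..<e}. D (\<lambda>t. \<phi> z t y) t" if "y \<in> N z" for y
      using PN sub that by (meson subsetD)
    ultimately show ?thesis using PN by simp
  qed
  show ?thesis
  proof (rule that[OF e(1)])
    fix z assume "z \<in> topspace B"
    then obtain z' where "z' \<in> Z" "z \<in> N z'" using Z(3) by blast
    then show "\<exists>N \<phi>. openin B N \<and> z \<in> N \<and> flow_box B D N e \<phi>"
      using P[of z'] N[of z'] Z(2) by (intro exI[of _ "N z'"] exI[of _ "\<phi> z'"]) auto
  qed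
qed

lemma solvable_all: "solvable a"
proof -
  obtain \<epsilon> where \<epsilon>: "\<epsilon> > 0" "solvable \<epsilon>"
    using uniform_time unfolding solvable_def by metis
  have "solvable ((3/2) ^ n * \<epsilon>)" for n
  proof (induction n)
    case (Suc n)
    then show ?case using solvable_extend[OF Suc] \<epsilon>(1) by (simp add: mult.assoc)
  qed (use \<epsilon> in simp)
  moreover obtain n where "a / \<epsilon> < (3/2) ^ n"
    using real_arch_pow[of "3/2" "a / \<epsilon>"] by auto
  then have "a \<le> (3/2) ^ n * \<epsilon>" using \<epsilon>(1) by (simp add: field_simps)
  ultimately show ?thesis using solvable_mono by blast
qed

text \<open>For each \<open>a\<close> a solution on the interval of radius \<open>a\<close> is
  chosen independently. Reading time \<open>t\<close> off the one of radius |t| + 1 is consistent by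
  uniqueness, so near every time \<open>\<Phi>\<close> coincides with a single solution.\<close>

lemma global_solutions:
  obtains \<Phi> where "\<And>z. z \<in> topspace B \<Longrightarrow> \<Phi> 0 z = z"
    "\<And>z t. z \<in> topspace B \<Longrightarrow> D (\<lambda>t. \<Phi> t z) t"
proof -
  obtain \<Gamma> where \<Gamma>: "\<And>a z. z \<in> topspace B \<Longrightarrow> \<Gamma> a z 0 = z \<and> (\<forall>t\<in>{-a<..<a}. D (\<Gamma> a z) t)"
    using solvable_all unfolding solvable_def by metis
  define \<Phi> where "\<Phi> t z = \<Gamma> (\<bar>t\<bar> + 1) z t" for t z
  have eq: "\<Phi> t z = \<Gamma> a z t" if "z \<in> topspace B" "\<bar>t\<bar> < a" for t z a
    unfolding \<Phi>_def
  proof (rule solution_unique[of "{-min a (\<bar>t\<bar> + 1)<..<min a (\<bar>t\<bar> + 1)}" "\<Gamma> (\<bar>t\<bar> + 1) z" "\<Gamma> a z" 0])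
    show "open_interval {-min a (\<bar>t\<bar> + 1)<..<min a (\<bar>t\<bar> + 1)}"
      using that by (intro open_interval_box) auto
  qed (use \<Gamma>[OF that(1)] that(2) in auto)
  have "D (\<lambda>t. \<Phi> t z) t" if z: "z \<in> topspace B" for z t
  proof (rule D_cong_open[of "{-(\<bar>t\<bar> + 1)<..<\<bar>t\<bar> + 1}" t "\<Gamma> (\<bar>t\<bar> + 1) z"])
    show "\<Phi> s z = \<Gamma> (\<bar>t\<bar> + 1) z s" if "s \<in> {-(\<bar>t\<bar> + 1)<..<\<bar>t\<bar> + 1}" for s
      by (rule eq[OF z]) (use that in auto)
    have "t \<in> {-(\<bar>t\<bar> + 1)<..<\<bar>t\<bar> + 1}" by auto
    then show "D (\<Gamma> (\<bar>t\<bar> + 1) z) t" using \<Gamma>[OF z, of "\<bar>t\<bar> + 1"] by blast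
  qed auto
  moreover have "\<Phi> 0 z = z" if "z \<in> topspace B" for z
    using \<Gamma>[OF that] by (simp add: \<Phi>_def)
  ultimately show ?thesis using that by blast
qed

text \<open>The group law and the orbit property are consequences of uniqueness. Joint continuity
  holds for short times by flow boxes of a common lifetime and reaches all times by
  doubling.\<close>

theorem flow_exists:
  obtains \<Phi> where "is_flow B \<Phi>" "\<And>z t. z \<in> topspace B \<Longrightarrow> D (\<lambda>t. \<Phi> t z) t"
    "\<And>J \<gamma> s t. open_interval J \<Longrightarrow> (\<And>t. t \<in> J \<Longrightarrow> D \<gamma> t) \<Longrightarrow> s \<in> J \<Longrightarrow> s + t \<in> J \<Longrightarrow> \<Phi> t (\<gamma> s) = \<gamma> (s + t)"
proof -
  obtain \<Phi> where \<Phi>0: "\<And>z. z \<in> topspace B \<Longrightarrow> \<Phi> 0 z = z"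
    and \<Phi>D: "\<And>z t. z \<in> topspace B \<Longrightarrow> D (\<lambda>t. \<Phi> t z) t"
    using global_solutions by blast
  have orbit: "\<Phi> t (\<gamma> s) = \<gamma> (s + t)"
    if J: "open_interval J" "\<And>t. t \<in> J \<Longrightarrow> D \<gamma> t" "s \<in> J" "s + t \<in> J" for J \<gamma> s t
  proof -
    have z: "\<gamma> s \<in> topspace B" using D_topspace J by blast
    have D: "D (\<lambda>t. \<Phi> (-s + t) (\<gamma> s)) t" for t
      using D_shift[OF \<Phi>D[OF z]] .
    have "\<Phi> (-s + (s + t)) (\<gamma> s) = \<gamma> (s + t)"
      by (rule solution_unique[of J "\<lambda>t. \<Phi> (-s + t) (\<gamma> s)" \<gamma> s "s + t"])
        (use J D \<Phi>0[OF z] in auto)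
    then show ?thesis by simp
  qed
  have \<Phi>T: "\<Phi> t z \<in> topspace B" if "z \<in> topspace B" for t z
    using D_topspace[OF \<Phi>D[OF that]] .
  have grp: "\<Phi> (s + t) z = \<Phi> s (\<Phi> t z)" if "z \<in> topspace B" for s t z
    using orbit[of UNIV "\<lambda>t. \<Phi> t z" t s] \<Phi>D[OF that]
    by (simp add: open_interval_def add.commute)
  define C where "C a \<longleftrightarrow> continuous_map (subtopology (prod_topology euclideanreal B) ({-a<..<a} \<times>
      topspace B)) B (\<lambda>(t, z). \<Phi> t z)"
    for a :: real
  obtain \<epsilon> where \<epsilon>: "\<epsilon> > 0" "\<And>z. z \<in> topspace B \<Longrightarrow> \<exists>N \<phi>. openin B N \<and> z \<in> N \<and>
      flow_box B D N \<epsilon> \<phi>"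
    using uniform_time by blast
  have "\<exists>N. openin B N \<and> z \<in> N \<and>
      continuous_map (subtopology (prod_topology euclideanreal B) ({-\<epsilon><..<\<epsilon>} \<times> N)) B (\<lambda>(t, y). \<Phi> t y)"
    if z: "z \<in> topspace B" for z
  proof -
    obtain N \<phi> where N: "openin B N" "z \<in> N"
      "continuous_map (subtopology (prod_topology euclideanreal B) ({-\<epsilon><..<\<epsilon>} \<times> N)) B (\<lambda>(t, y). \<phi> t y)"
      "\<And>y. y \<in> N \<Longrightarrow> \<phi> 0 y = y \<and> (\<forall>t\<in>{-\<epsilon><..<\<epsilon>}. D (\<lambda>t. \<phi> t y) t)"
      using \<epsilon>(2)[OF z] by blast
    have "\<phi> t y = \<Phi> t y" if "t \<in> {-\<epsilon><..<\<epsilon>}" "y \<in> N" for t y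
      using orbit[OF open_interval_box, of "-\<epsilon>" \<epsilon> "\<lambda>t. \<phi> t y" 0 t] N(4)[OF that(2)] \<epsilon>(1) that(1)
      by simp
    then have "continuous_map (subtopology (prod_topology euclideanreal B) ({-\<epsilon><..<\<epsilon>} \<times> N)) B
        (\<lambda>(t, y). \<Phi> t y)"
      by (intro continuous_map_eq[OF N(3)]) auto
    then show ?thesis using N by blast
  qed
  then obtain N where N: "\<And>z. z \<in> topspace B \<Longrightarrow> openin B (N z) \<and> z \<in> N z \<and>
      continuous_map (subtopology (prod_topology euclideanreal B) ({-\<epsilon><..<\<epsilon>} \<times> N z)) B (\<lambda>(t, y). \<Phi> t y)"
    by metis
  \<comment> \<open>The boxes share the time interval and differ only in the open set of starting
    points, so they can be glued over the whole space.\<close>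
  have C\<epsilon>: "C \<epsilon>"
    unfolding C_def
  proof (rule pasting_lemma[where I = "topspace B" and T = "\<lambda>z. {-\<epsilon><..<\<epsilon>} \<times> N z"
      and f = "\<lambda>_ (t, z). \<Phi> t z"])
    fix z assume z: "z \<in> topspace B"
    have sub: "N z \<subseteq> topspace B" using N[OF z] openin_subset by blast
    then show "continuous_map (subtopology (subtopology (prod_topology euclideanreal B) ({-\<epsilon><..<\<epsilon>} \<times>
        topspace B)) ({-\<epsilon><..<\<epsilon>} \<times> N z)) B (\<lambda>(t, z). \<Phi> t z)"
      using N[OF z] by (simp add: subtopology_subtopology Times_Int_Times Int_absorb1)
    have "openin (prod_topology euclideanreal B) ({-\<epsilon><..<\<epsilon>} \<times> N z)"
      using N[OF z] by (simp add: openin_prod_Times_iff)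
    then show "openin (subtopology (prod_topology euclideanreal B) ({-\<epsilon><..<\<epsilon>} \<times> topspace B))
        ({-\<epsilon><..<\<epsilon>} \<times> N z)"
      using sub by (auto intro!: openin_subtopology_Int2 simp: openin_subtopology)
  next
    fix x assume "x \<in> topspace (subtopology (prod_topology euclideanreal B) ({-\<epsilon><..<\<epsilon>} \<times> topspace B))"
    then show "\<exists>j. j \<in> topspace B \<and> x \<in> {-\<epsilon><..<\<epsilon>} \<times> N j \<and> (case x of (t, z) \<Rightarrow> \<Phi> t z) =
        (case x of (t, z) \<Rightarrow> \<Phi> t z)"
      using N by auto
  qed simp
  \<comment> \<open>The map at time \<open>t\<close> is the map at time \<open>t / 2\<close> applied
    twice, so continuity over a time interval passes to the interval twice as long.\<close>
  have C2: "C (2 * a)" if "C a" for a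
  proof -
    let ?X = "subtopology (prod_topology euclideanreal B) ({-(2*a)<..<2*a} \<times> topspace B)"
    let ?Y = "subtopology (prod_topology euclideanreal B) ({-a<..<a} \<times> topspace B)"
    have h: "continuous_map ?X euclideanreal (\<lambda>p. fst p / 2)"
      using continuous_map_real_divide[of ?X fst "\<lambda>_. 2"]
      by (simp add: continuous_map_from_subtopology continuous_map_fst)
    have snd: "continuous_map ?X B snd"
      by (simp add: continuous_map_from_subtopology continuous_map_snd)
    have 1: "continuous_map ?X ?Y (\<lambda>p. (fst p / 2, snd p))"
      by (rule continuous_map_into_subtopology[OF continuous_map_pairedI[OF h snd]]) auto
    have 2: "continuous_map ?X B (\<lambda>p. \<Phi> (fst p / 2) (snd p))"
      using continuous_map_compose[OF 1 that[unfolded C_def]] by (simp add: o_def)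
    have 3: "continuous_map ?X ?Y (\<lambda>p. (fst p / 2, \<Phi> (fst p / 2) (snd p)))"
      by (rule continuous_map_into_subtopology[OF continuous_map_pairedI[OF h 2]]) (auto intro: \<Phi>T)
    have "continuous_map ?X B (\<lambda>p. \<Phi> (fst p / 2) (\<Phi> (fst p / 2) (snd p)))"
      using continuous_map_compose[OF 3 that[unfolded C_def]] by (simp add: o_def)
    then show ?thesis
      unfolding C_def by (rule continuous_map_eq) (auto simp: grp[symmetric])
  qed
  have Cn: "C (2 ^ n * \<epsilon>)" for n :: nat
  proof (induction n)
    case (Suc n)
    then show ?case using C2[OF Suc] by (simp add: mult.assoc)
  qed (simp add: C\<epsilon>)
  have "continuous_map (prod_topology euclideanreal B) B (\<lambda>(t, z). \<Phi> t z)"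
  proof (rule pasting_lemma[where I = UNIV and T = "\<lambda>n::nat. {-(2^n*\<epsilon>)<..<2^n*\<epsilon>} \<times> topspace B"
      and f = "\<lambda>_ (t, z). \<Phi> t z"])
    fix n :: nat
    show "openin (prod_topology euclideanreal B) ({-(2^n*\<epsilon>)<..<2^n*\<epsilon>} \<times> topspace B)"
      by (simp add: openin_prod_Times_iff)
    show "continuous_map (subtopology (prod_topology euclideanreal B) ({-(2^n*\<epsilon>)<..<2^n*\<epsilon>} \<times>
        topspace B)) B (\<lambda>(t, z). \<Phi> t z)"
      using Cn unfolding C_def .
  next
    fix x assume x: "x \<in> topspace (prod_topology euclideanreal B)"
    obtain n where "\<bar>fst x\<bar> / \<epsilon> < 2 ^ n"
      using real_arch_pow[of 2] by auto
    then have "\<bar>fst x\<bar> < 2 ^ n * \<epsilon>" using \<epsilon>(1) by (simp add: field_simps)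
    then show "\<exists>n. n \<in> UNIV \<and> x \<in> {-(2^n*\<epsilon>)<..<2^n*\<epsilon>} \<times> topspace B \<and> (case x of (t, z) \<Rightarrow> \<Phi> t z) =
        (case x of (t, z) \<Rightarrow> \<Phi> t z)"
      using x by (intro exI[of _ n]) (auto simp: mem_Times_iff)
  qed simp
  then have "is_flow B \<Phi>"
    using \<Phi>0 grp by (simp add: is_flow_def)
  then show ?thesis using that[of \<Phi>] \<Phi>D orbit by blast
qed

end

section \<open>Charts of the tangent bundle\<close>

locale smooth_atlas =
  fixes X :: "'a topology" and A :: "('a, 'e::euclidean_space) chart set"
  assumes manifold: "smooth_manifold X A"
begin

abbreviation transition :: "('a, 'e) chart \<Rightarrow> ('a, 'e) chart \<Rightarrow> 'e \<Rightarrow> 'e" where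
  "transition c d \<equiv> \<lambda>x. snd d (chart_inv c x)"

text \<open>Both \<open>tangent_coord\<close> and \<open>coord_field\<close> are Jacobians, with the
  chart chosen at the point as source or as target. Their calculus therefore reduces to the chain
  rule \<open>jacobian_compose\<close>.\<close>

definition jacobian :: "('a, 'e) chart \<Rightarrow> ('a, 'e) chart \<Rightarrow> 'e \<Rightarrow> 'e \<Rightarrow> 'e" where
  "jacobian c d x = frechet_derivative (transition c d) (at x)"

lemma chart_openin: "c \<in> A \<Longrightarrow> openin X (fst c)"
  and chart_image_open: "c \<in> A \<Longrightarrow> open (snd c ` fst c)"
  and chart_homeomorphic: "c \<in> A \<Longrightarrow>
    homeomorphic_map (subtopology X (fst c)) (top_of_set (snd c ` fst c)) (snd c)"
  using manifold unfolding smooth_manifold_def by blast+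

lemma chart_subset: "c \<in> A \<Longrightarrow> fst c \<subseteq> topspace X"
  using chart_openin openin_subset by blast

lemma topspace_chart_subtopology: "c \<in> A \<Longrightarrow> topspace (subtopology X (fst c)) = fst c"
  by (simp add: chart_subset Int_absorb1)

lemma chart_inj: "c \<in> A \<Longrightarrow> inj_on (snd c) (fst c)"
  using chart_homeomorphic topspace_chart_subtopology
  unfolding homeomorphic_eq_everything_map by metis

lemma chart_inv_chart: "c \<in> A \<Longrightarrow> p \<in> fst c \<Longrightarrow> chart_inv c (snd c p) = p"
  using chart_inj by simp

lemma chart_continuous: "c \<in> A \<Longrightarrow> continuous_map (subtopology X (fst c)) euclidean (snd c)"
  using homeomorphic_imp_continuous_map[OF chart_homeomorphic] continuous_map_in_subtopology by blast

lemma chart_open_image: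
  assumes "c \<in> A" "openin X U"
  shows "open (snd c ` (U \<inter> fst c))"
proof -
  have "open_map (subtopology X (fst c)) (top_of_set (snd c ` fst c)) (snd c)"
    using chart_homeomorphic[OF assms(1)] homeomorphic_imp_open_map by blast
  moreover have "openin (subtopology X (fst c)) (U \<inter> fst c)"
    using assms(2) openin_subtopology_Int by blast
  ultimately have "openin (top_of_set (snd c ` fst c)) (snd c ` (U \<inter> fst c))"
    unfolding open_map_def by blast
  then show ?thesis using chart_image_open[OF assms(1)] openin_open_trans by blast
qed

lemma chart_open_vimage:
  assumes "c \<in> A" "open S"
  shows "openin X {p \<in> fst c. snd c p \<in> S}"
proof -
  have "openin (subtopology X (fst c)) {p \<in> fst c. snd c p \<in> S}"
    using openin_continuous_map_preimage[OF chart_continuous[OF assms(1)], of S] assms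
    by (simp only: topspace_chart_subtopology[OF assms(1)]) simp
  then show ?thesis using chart_openin[OF assms(1)] openin_open_subtopology by blast
qed

lemma topspace_charts: "topspace X = (\<Union>c\<in>A. fst c)"
  using manifold unfolding smooth_manifold_def by simp

lemma chart_at_in: "p \<in> topspace X \<Longrightarrow> chart_at A p \<in> A"
  and chart_at_dom: "p \<in> topspace X \<Longrightarrow> p \<in> fst (chart_at A p)"
proof -
  assume "p \<in> topspace X"
  then have "\<exists>c. c \<in> A \<and> p \<in> fst c" using topspace_charts by blast
  then have "chart_at A p \<in> A \<and> p \<in> fst (chart_at A p)"
    unfolding chart_at_def by (rule someI_ex)
  then show "chart_at A p \<in> A" "p \<in> fst (chart_at A p)" by auto
qed

lemma overlap_open: "c \<in> A \<Longrightarrow> d \<in> A \<Longrightarrow> open (snd c ` (fst c \<inter> fst d))"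
  using chart_open_image[of c "fst d"] chart_openin[of d] by (simp add: Int_commute)

lemma transition_smooth: "c \<in> A \<Longrightarrow> d \<in> A \<Longrightarrow> smooth_on (snd c ` (fst c \<inter> fst d)) (transition c d)"
  using manifold unfolding smooth_manifold_def by blast

lemma transition_has_derivative:
  assumes "c \<in> A" "d \<in> A" "p \<in> fst c" "p \<in> fst d"
  shows "(transition c d has_derivative jacobian c d (snd c p)) (at (snd c p))"
  unfolding jacobian_def
  using smooth_on_has_derivative[OF overlap_open transition_smooth] assms by blast

lemma jacobian_linear:
  assumes "c \<in> A" "d \<in> A" "p \<in> fst c" "p \<in> fst d"
  shows "linear (jacobian c d (snd c p))"
  using transition_has_derivative[OF assms] has_derivative_linear by blast

text \<open>Chain rule: on the image of the triple overlap, which is open, the composite transition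
  is the direct one.\<close>

lemma jacobian_compose:
  assumes "c \<in> A" "d \<in> A" "e \<in> A" "p \<in> fst c" "p \<in> fst d" "p \<in> fst e"
  shows "jacobian d e (snd d p) (jacobian c d (snd c p) v) = jacobian c e (snd c p) v"
proof -
  have "(transition d e has_derivative jacobian d e (snd d p)) (at (transition c d (snd c p)))"
    using transition_has_derivative[of d e p] assms by (simp add: chart_inv_chart)
  then have "((\<lambda>x. transition d e (transition c d x)) has_derivative
      (\<lambda>v. jacobian d e (snd d p) (jacobian c d (snd c p) v))) (at (snd c p))"
    using has_derivative_compose[OF transition_has_derivative[of c d p]] assms by blast
  moreover have "open (snd c ` (fst d \<inter> fst e \<inter> fst c))"
    using assms by (intro chart_open_image) (auto intro: chart_openin)
  ultimately have "(transition c e has_derivative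
      (\<lambda>v. jacobian d e (snd d p) (jacobian c d (snd c p) v))) (at (snd c p))"
    by (rule has_derivative_transform_within_open) (use assms in \<open>auto simp: chart_inv_chart\<close>)
  then show ?thesis
    using transition_has_derivative[of c e p] assms has_derivative_unique by metis
qed

lemma jacobian_id:
  assumes "c \<in> A" "p \<in> fst c"
  shows "jacobian c c (snd c p) v = v"
proof -
  have "((\<lambda>x. x) has_derivative (\<lambda>v. v)) (at (snd c p))" by (rule has_derivative_ident)
  then have "(transition c c has_derivative (\<lambda>v. v)) (at (snd c p))"
    by (rule has_derivative_transform_within_open[OF _ chart_image_open[OF assms(1)]])
      (use assms in \<open>auto simp: chart_inv_chart\<close>)
  then show ?thesis
    using transition_has_derivative[of c c p] assms has_derivative_unique by metis
qed

lemma jacobian_smooth: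
  "c \<in> A \<Longrightarrow> d \<in> A \<Longrightarrow> smooth_on (snd c ` (fst c \<inter> fst d)) (\<lambda>x. jacobian c d x b)"
  unfolding jacobian_def using smooth_on_derivative[OF transition_smooth] .

lemma tangent_coord_jacobian:
  "tangent_coord A c p v = jacobian (chart_at A p) c (snd (chart_at A p) p) v"
  by (simp add: tangent_coord_def jacobian_def Let_def)

lemma coord_field_jacobian: "coord_field A c \<xi> p = jacobian c (chart_at A p) (snd c p) \<xi>"
  by (simp add: coord_field_def jacobian_def)

context
  fixes c p assumes c: "c \<in> A" and p: "p \<in> fst c"
begin

lemma chart_at_facts: "chart_at A p \<in> A" "p \<in> fst (chart_at A p)"
  using chart_at_in chart_at_dom chart_subset[OF c] p by auto

lemma tangent_coord_linear: "linear (tangent_coord A c p)"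
  unfolding tangent_coord_jacobian using jacobian_linear chart_at_facts c p by blast

lemma coord_field_linear: "linear (\<lambda>\<xi>. coord_field A c \<xi> p)"
  unfolding coord_field_jacobian using jacobian_linear chart_at_facts c p by blast

lemma tangent_coord_coord_field: "d \<in> A \<Longrightarrow> p \<in> fst d \<Longrightarrow>
    tangent_coord A d p (coord_field A c \<xi> p) = jacobian c d (snd c p) \<xi>"
  unfolding tangent_coord_jacobian coord_field_jacobian
  using jacobian_compose chart_at_facts c p by simp

lemma tangent_coord_coord_field_same: "tangent_coord A c p (coord_field A c \<xi> p) = \<xi>"
  using tangent_coord_coord_field[OF c p] jacobian_id c p by simp

lemma coord_field_tangent_coord: "coord_field A c (tangent_coord A c p v) p = v"
  unfolding tangent_coord_jacobian coord_field_jacobian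
  using jacobian_compose jacobian_id chart_at_facts c p by simp

lemma tangent_coord_change: "d \<in> A \<Longrightarrow> p \<in> fst d \<Longrightarrow>
    tangent_coord A d p v = jacobian c d (snd c p) (tangent_coord A c p v)"
  using tangent_coord_coord_field[of d "tangent_coord A c p v"] coord_field_tangent_coord by simp

lemma tangent_coord_chart_at: "tangent_coord A (chart_at A p) p v = v"
  unfolding tangent_coord_jacobian using jacobian_id chart_at_facts by simp

lemma coord_field_chart_at: "coord_field A (chart_at A p) v p = v"
  unfolding coord_field_jacobian using jacobian_id chart_at_facts by simp

text \<open>\<open>dfun\<close> is defined with the chart chosen at the point; the chain rule with
  the transition map makes it computable in any chart around the point.\<close>

lemma dfun_chart:
  assumes "((\<lambda>x. f (chart_inv c x)) has_derivative f') (at (snd c p))"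
  shows "dfun A f p v = f' (tangent_coord A c p v)"
proof -
  let ?k = "chart_at A p"
  note k = chart_at_facts
  have "((\<lambda>x. f (chart_inv c x)) has_derivative f') (at (transition ?k c (snd ?k p)))"
    using assms k by (simp add: chart_inv_chart)
  from has_derivative_compose[OF transition_has_derivative[OF k(1) c k(2) p] this]
  have "((\<lambda>x. f (chart_inv c (transition ?k c x))) has_derivative
      (\<lambda>v. f' (tangent_coord A c p v))) (at (snd ?k p))"
    by (simp add: tangent_coord_jacobian)
  then have "((\<lambda>x. f (chart_inv ?k x)) has_derivative (\<lambda>v. f' (tangent_coord A c p v))) (at (snd ?k p))"
    by (rule has_derivative_transform_within_open[OF _ overlap_open[OF k(1) c]])
      (use k c p in \<open>auto simp: chart_inv_chart\<close>)
  then show ?thesis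
    unfolding dfun_def Let_def by (simp add: frechet_derivative_at[symmetric])
qed

end

text \<open>Continuity in the base point is known for each fixed vector; linearity in the vector
  turns it into joint continuity through the basis expansion.\<close>

lemma jacobian_continuous:
  assumes "c \<in> A" "d \<in> A"
  shows "continuous_on (snd c ` (fst c \<inter> fst d) \<times> UNIV) (\<lambda>(x, v). jacobian c d x v)"
proof -
  have "continuous_on (snd c ` (fst c \<inter> fst d) \<times> UNIV)
      (\<lambda>z. \<Sum>b\<in>Basis. (snd z \<bullet> b) *\<^sub>R jacobian c d (fst z) b)"
  proof (intro continuous_intros)
    fix b
    show "continuous_on (snd c ` (fst c \<inter> fst d) \<times> UNIV) (\<lambda>z::'e \<times> 'e. jacobian c d (fst z) b)"
      by (rule continuous_on_compose2[OF smooth_on_continuous_on[OF jacobian_smooth[OF assms]]])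
        (auto intro: continuous_on_fst)
  qed
  then show ?thesis
    by (rule continuous_on_eq)
      (use assms in \<open>auto simp: linear_Basis_expansion[OF jacobian_linear[OF assms], symmetric]\<close>)
qed

lemma smooth_field_subset:
  assumes "smooth_field A U Y" "openin X U" "openin X V" "V \<subseteq> U"
  shows "smooth_field A V Y"
  unfolding smooth_field_def
proof
  fix c assume c: "c \<in> A"
  show "smooth_on (snd c ` (V \<inter> fst c)) (\<lambda>x. tangent_coord A c (chart_inv c x) (Y (chart_inv c x)))"
    by (rule smooth_on_subset[of "snd c ` (U \<inter> fst c)"])
      (use assms c chart_open_image[OF c] in \<open>auto simp: smooth_field_def\<close>)
qed

lemma smooth_field_scaleR:
  assumes "openin X U" "smooth_fun A U f" "smooth_field A U Y"
  shows "smooth_field A U (\<lambda>p. f p *\<^sub>R Y p)"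
  unfolding smooth_field_def
proof
  fix c assume c: "c \<in> A"
  have "smooth_on (snd c ` (U \<inter> fst c)) (\<lambda>x. f (chart_inv c x) *\<^sub>R tangent_coord A c (chart_inv c x)
      (Y (chart_inv c x)))"
    using assms c chart_open_image[OF c assms(1)] unfolding smooth_fun_def smooth_field_def
    by (intro smooth_on_scaleR) auto
  then show "smooth_on (snd c ` (U \<inter> fst c)) (\<lambda>x. tangent_coord A c (chart_inv c x) (f (chart_inv c
      x) *\<^sub>R Y (chart_inv c x)))"
    by (rule smooth_on_cong[OF chart_open_image[OF c assms(1)], rotated])
      (use c in \<open>auto simp: chart_inv_chart linear_cmul[OF tangent_coord_linear]\<close>)
qed

lemma smooth_field_sum:
  assumes "openin X U" "\<And>i. i \<in> I \<Longrightarrow> smooth_field A U (Y i)"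
  shows "smooth_field A U (\<lambda>p. \<Sum>i\<in>I. Y i p)"
  unfolding smooth_field_def
proof
  fix c assume c: "c \<in> A"
  have "smooth_on (snd c ` (U \<inter> fst c)) (\<lambda>x. \<Sum>i\<in>I. tangent_coord A c (chart_inv c x) (Y i (chart_inv
      c x)))"
    using assms c chart_open_image[OF c assms(1)] unfolding smooth_field_def
    by (intro smooth_on_sum) auto
  then show "smooth_on (snd c ` (U \<inter> fst c)) (\<lambda>x. tangent_coord A c (chart_inv c x) (\<Sum>i\<in>I. Y i
      (chart_inv c x)))"
    by (rule smooth_on_cong[OF chart_open_image[OF c assms(1)], rotated])
      (use c in \<open>auto simp: chart_inv_chart linear_sum[OF tangent_coord_linear] o_def\<close>)
qed

text \<open>In a chart \<open>d\<close> the components are the Jacobian from \<open>c\<close> to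
  \<open>d\<close> evaluated at the transition map from \<open>d\<close> to \<open>c\<close>, a
  composition of smooth maps.\<close>

lemma coord_field_smooth:
  assumes "c \<in> A"
  shows "smooth_field A (fst c) (coord_field A c \<xi>)"
  unfolding smooth_field_def
proof
  fix d assume d: "d \<in> A"
  have "smooth_on (snd d ` (fst d \<inter> fst c)) (\<lambda>x. jacobian c d (transition d c x) \<xi>)"
  proof (rule smooth_on_compose[OF overlap_open[OF d assms] overlap_open[OF assms d],
        where f = "\<lambda>x. jacobian c d x \<xi>" and g = "transition d c"])
    show "smooth_on (snd c ` (fst c \<inter> fst d)) (\<lambda>x. jacobian c d x \<xi>)"
      using jacobian_smooth[OF assms d] .
    show "smooth_on (snd d ` (fst d \<inter> fst c)) (transition d c)"
      using transition_smooth[OF d assms] .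
    show "transition d c ` snd d ` (fst d \<inter> fst c) \<subseteq> snd c ` (fst c \<inter> fst d)"
      using d by (auto simp: chart_inv_chart)
  qed
  then show "smooth_on (snd d ` (fst c \<inter> fst d)) (\<lambda>x. tangent_coord A d (chart_inv d x) (coord_field
      A c \<xi> (chart_inv d x)))"
    unfolding Int_commute[of "fst c"]
    by (rule smooth_on_cong[OF overlap_open[OF d assms], rotated])
      (use assms d in \<open>auto simp: chart_inv_chart tangent_coord_coord_field\<close>)
qed

text \<open>For basis vectors \<open>a\<close> these are the coefficients of a coordinate field of
  \<open>c\<close> in the coordinate fields of \<open>k\<close>; smoothness admits them to the
  Leibniz rule.\<close>

lemma jacobian_smooth_fun:
  assumes "c \<in> A" "k \<in> A"
  shows "smooth_fun A (fst c \<inter> fst k) (\<lambda>p. jacobian c k (snd c p) b \<bullet> a)"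
  unfolding smooth_fun_def
proof
  fix d assume d: "d \<in> A"
  have op: "open (snd d ` (fst c \<inter> fst k \<inter> fst d))"
    using assms d by (intro chart_open_image) (auto intro: chart_openin)
  have "smooth_on (snd d ` (fst c \<inter> fst k \<inter> fst d)) (\<lambda>x. jacobian c k (transition d c x) b)"
  proof (rule smooth_on_compose[OF op overlap_open[OF assms], where f = "\<lambda>x. jacobian c k x b"
      and g = "transition d c"])
    show "smooth_on (snd c ` (fst c \<inter> fst k)) (\<lambda>x. jacobian c k x b)"
      using jacobian_smooth[OF assms] .
    show "smooth_on (snd d ` (fst c \<inter> fst k \<inter> fst d)) (transition d c)"
      by (rule smooth_on_subset[OF transition_smooth[OF d assms(1)] overlap_open[OF d assms(1)] op])
          auto
    show "transition d c ` snd d ` (fst c \<inter> fst k \<inter> fst d) \<subseteq> snd c ` (fst c \<inter> fst k)"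
      using d by (auto simp: chart_inv_chart)
  qed
  then show "smooth_on (snd d ` (fst c \<inter> fst k \<inter> fst d)) (\<lambda>x. jacobian c k (snd c (chart_inv d x)) b
      \<bullet> a)"
    by (rule smooth_on_inner_const[OF op])
qed

section \<open>The tangent bundle: charts and topology\<close>

abbreviation bundle_chart :: "('a, 'e) chart \<Rightarrow> 'a \<times> 'e \<Rightarrow> 'e \<times> 'e" where
  "bundle_chart c \<equiv> \<lambda>z. (snd c (fst z), tangent_coord A c (fst z) (snd z))"

abbreviation bundle_chart_inv :: "('a, 'e) chart \<Rightarrow> 'e \<times> 'e \<Rightarrow> 'a \<times> 'e" where
  "bundle_chart_inv c \<equiv> \<lambda>z. (chart_inv c (fst z), coord_field A c (snd z) (chart_inv c (fst z)))"

lemma bundle_chart_openin: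
  assumes "c \<in> A" "open S"
  shows "openin (tangent_topology X A) {z. fst z \<in> fst c \<and> bundle_chart c z \<in> S}"
proof -
  have "{z. fst z \<in> fst c \<and> bundle_chart c z \<in> S} =
      {(p, v). p \<in> fst c \<and> (snd c p, tangent_coord A c p v) \<in> S}" by auto
  then show ?thesis
    unfolding tangent_topology_def
    by (intro topology_generated_by_Basis CollectI exI[of _ c] exI[of _ S]) (simp add: assms)
qed

lemma topspace_tangent: "topspace (tangent_topology X A) = topspace X \<times> UNIV"
proof -
  have 1: "topspace X \<times> UNIV \<subseteq> topspace (tangent_topology X A)"
  proof
    fix z :: "'a \<times> 'e" assume "z \<in> topspace X \<times> UNIV"
    then have "fst z \<in> topspace X" by (simp add: mem_Times_iff)
    then obtain c where c: "c \<in> A" "fst z \<in> fst c" using topspace_charts by blast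
    then have "z \<in> {z. fst z \<in> fst c \<and> bundle_chart c z \<in> UNIV}" by simp
    then show "z \<in> topspace (tangent_topology X A)"
      using openin_subset[OF bundle_chart_openin[OF c(1) open_UNIV]] by (rule rev_subsetD)
  qed
  have "\<Union>{{(p, v). p \<in> fst c \<and> (snd c p, tangent_coord A c p v) \<in> S} |c S. c \<in> A \<and> open S}
      \<subseteq> topspace X \<times> UNIV"
  proof
    fix z :: "'a \<times> 'e" assume z: "z \<in> \<Union>{{(p, v). p \<in> fst c \<and> (snd c p, tangent_coord A c p v) \<in> S}
        |c S. c \<in> A \<and> open S}"
    obtain U where U: "z \<in> U" "U \<in> {{(p, v). p \<in> fst c \<and> (snd c p, tangent_coord A c p v) \<in> S} |c S.
        c \<in> A \<and> open S}"
      using z by (rule UnionE)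
    from U(2) obtain c S where "U = {(p, v). p \<in> fst c \<and> (snd c p, tangent_coord A c p v) \<in> S}"
        and c: "c \<in> A"
      unfolding mem_Collect_eq by (elim exE conjE) (rule that)
    then have "fst z \<in> fst c" using U(1) by auto
    then show "z \<in> topspace X \<times> UNIV" using chart_subset[OF c] by (auto simp: mem_Times_iff)
  qed
  then have "topspace (tangent_topology X A) \<subseteq> topspace X \<times> UNIV"
    unfolding tangent_topology_def topology_generated_by_topspace .
  with 1 show ?thesis by blast
qed

text \<open>Continuity of the bundle projection. Over each chart the set is the preimage of an open
  set under the bundle chart, and injectivity of the coordinate map recovers \<open>U\<close> from
  its image.\<close>

lemma tangent_projection_openin:
  assumes "openin X U"
  shows "openin (tangent_topology X A) (U \<times> UNIV)"
proof -
  have "z \<in> U \<times> UNIV \<longleftrightarrow> z \<in> (\<Union>c\<in>A. {z. fst z \<in> fst c \<and> bundle_chart c z \<in> (snd c ` (U \<inter> fst c)) \<times>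
      UNIV})" for z
  proof
    assume z: "z \<in> U \<times> UNIV"
    then have "fst z \<in> topspace X" using openin_subset[OF assms] by auto
    then obtain c where "c \<in> A" "fst z \<in> fst c" using topspace_charts by blast
    then show "z \<in> (\<Union>c\<in>A. {z. fst z \<in> fst c \<and> bundle_chart c z \<in> (snd c ` (U \<inter> fst c)) \<times> UNIV})"
      using z by auto
  next
    assume "z \<in> (\<Union>c\<in>A. {z. fst z \<in> fst c \<and> bundle_chart c z \<in> (snd c ` (U \<inter> fst c)) \<times> UNIV})"
    then obtain c where c: "c \<in> A" "fst z \<in> fst c" "snd c (fst z) \<in> snd c ` (U \<inter> fst c)" by auto
    then have "fst z \<in> U" using chart_inj[OF c(1)] by (auto simp: inj_on_def)
    then show "z \<in> U \<times> UNIV" by (simp add: mem_Times_iff)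
  qed
  then have eq: "U \<times> UNIV = (\<Union>c\<in>A. {z. fst z \<in> fst c \<and> bundle_chart c z \<in> (snd c ` (U \<inter> fst c)) \<times>
      UNIV})"
    by (rule set_eqI)
  have "openin (tangent_topology X A) {z. fst z \<in> fst c \<and> bundle_chart c z \<in> (snd c ` (U \<inter> fst c)) \<times>
      UNIV}"
    if "c \<in> A" for c
    using that chart_open_image[OF that assms] by (intro bundle_chart_openin open_Times) auto
  then have "openin (tangent_topology X A) (\<Union>c\<in>A. {z. fst z \<in> fst c \<and> bundle_chart c z \<in> (snd c `
      (U \<inter> fst c)) \<times> UNIV})"
    by (intro openin_Union) auto
  then show ?thesis by (simp only: eq)
qed

lemma bundle_chart_continuous:
  assumes "c \<in> A"
  shows "continuous_map (subtopology (tangent_topology X A) (fst c \<times> UNIV)) euclidean (bundle_chart c)"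
  unfolding continuous_map_def
proof (intro conjI allI impI)
  fix S :: "('e \<times> 'e) set" assume "openin euclidean S"
  then have op: "openin (tangent_topology X A) {z. fst z \<in> fst c \<and> bundle_chart c z \<in> S}"
    using bundle_chart_openin[OF assms] by simp
  have eq: "{z \<in> topspace (subtopology (tangent_topology X A) (fst c \<times> UNIV)). bundle_chart c z \<in> S} =
      {z. fst z \<in> fst c \<and> bundle_chart c z \<in> S} \<inter> (fst c \<times> UNIV)"
    using chart_subset[OF assms] by (auto simp: topspace_tangent)
  show "openin (subtopology (tangent_topology X A) (fst c \<times> UNIV))
      {z \<in> topspace (subtopology (tangent_topology X A) (fst c \<times> UNIV)). bundle_chart c z \<in> S}"
    unfolding eq by (rule openin_subtopology_Int[OF op])
qed auto

lemma bundle_chart_bundle_chart_inv: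
  assumes "c \<in> A" "fst z \<in> snd c ` fst c"
  shows "bundle_chart c (bundle_chart_inv c z) = z"
  using assms by (cases z) (auto simp: chart_inv_chart tangent_coord_coord_field_same)

lemma bundle_chart_inv_bundle_chart:
  assumes "c \<in> A" "fst z \<in> fst c"
  shows "bundle_chart_inv c (bundle_chart c z) = z"
  using assms by (cases z) (auto simp: chart_inv_chart coord_field_tangent_coord)

text \<open>It is enough to test the generators of the topology. For a generator from the chart
  \<open>d\<close> the preimage is that of an open set under the change of bundle charts, which acts
  by the transition map on points and by its Jacobian on vectors and is jointly continuous.\<close>

lemma bundle_chart_inv_continuous:
  assumes "c \<in> A"
  shows "continuous_map (top_of_set (snd c ` fst c \<times> UNIV)) (tangent_topology X A) (bundle_chart_inv c)"
  unfolding tangent_topology_def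
proof (rule continuous_on_generated_topo)
  fix V assume "V \<in> {{(p, v). p \<in> fst d \<and> (snd d p, tangent_coord A d p v) \<in> S} |d S. d \<in> A \<and> open S}"
  then obtain d S where d: "d \<in> A" "open S" and V: "V = {(p, v). p \<in> fst d \<and>
      (snd d p, tangent_coord A d p v) \<in> S}"
    by blast
  let ?O = "snd c ` (fst c \<inter> fst d) \<times> (UNIV :: 'e set)"
  let ?f = "\<lambda>z. (transition c d (fst z), jacobian c d (fst z) (snd z))"
  have "continuous_on ?O ?f"
    using smooth_on_continuous_on[OF transition_smooth[OF assms d(1)]] jacobian_continuous[OF assms
        d(1)]
    by (intro continuous_on_Pair continuous_on_compose2[where g = "transition c d" and f = fst]
        continuous_on_fst continuous_on_id) (auto simp: split_beta)
  then have "open (?O \<inter> ?f -` S)"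
    using overlap_open[OF assms d(1)] d(2) by (intro continuous_open_preimage open_Times) auto
  moreover have "bundle_chart_inv c -` V \<inter> topspace (top_of_set (snd c ` fst c \<times> UNIV)) = ?O \<inter> ?f -` S"
    using assms d by (auto simp: V chart_inv_chart tangent_coord_coord_field)
  ultimately show "openin (top_of_set (snd c ` fst c \<times> UNIV)) (bundle_chart_inv c -` V \<inter> topspace
      (top_of_set (snd c ` fst c \<times> UNIV)))"
    by (auto intro!: open_subset)
next
  show "bundle_chart_inv c ` topspace (top_of_set (snd c ` fst c \<times> UNIV)) \<subseteq>
      \<Union>{{(p, v). p \<in> fst d \<and> (snd d p, tangent_coord A d p v) \<in> S} |d S. d \<in> A \<and> open S}"
  proof
    fix z assume "z \<in> bundle_chart_inv c ` topspace (top_of_set (snd c ` fst c \<times> UNIV))"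
    then have "z \<in> {(p, v). p \<in> fst c \<and> (snd c p, tangent_coord A c p v) \<in> UNIV}"
      using assms by (auto simp: chart_inv_chart)
    then show "z \<in> \<Union>{{(p, v). p \<in> fst d \<and> (snd d p, tangent_coord A d p v) \<in> S} |d S. d \<in> A \<and> open S}"
      using assms open_UNIV by blast
  qed
qed

text \<open>Vectors over different points are separated by sets from the base, vectors over the same
  point inside one bundle chart.\<close>

lemma Hausdorff_tangent: "Hausdorff_space (tangent_topology X A)"
  unfolding Hausdorff_space_def
proof (intro allI impI)
  fix z z' assume zz: "z \<in> topspace (tangent_topology X A) \<and> z' \<in> topspace (tangent_topology X A) \<and>
      z \<noteq> z'"
  then have p: "fst z \<in> topspace X" "fst z' \<in> topspace X" by (auto simp: topspace_tangent)
  show "\<exists>U V. openin (tangent_topology X A) U \<and> openin (tangent_topology X A) V \<and> z \<in> U \<and> z' \<in> V \<and>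
      disjnt U V"
  proof (cases "fst z = fst z'")
    case False
    have "Hausdorff_space X" using manifold unfolding smooth_manifold_def by simp
    then obtain U V where UV: "openin X U" "openin X V" "fst z \<in> U" "fst z' \<in> V" "disjnt U V"
      using p False unfolding Hausdorff_space_def by blast
    have "openin (tangent_topology X A) (U \<times> UNIV)" "openin (tangent_topology X A) (V \<times> UNIV)"
      "z \<in> U \<times> UNIV" "z' \<in> V \<times> UNIV" "disjnt (U \<times> (UNIV::'e set)) (V \<times> UNIV)"
      using UV tangent_projection_openin by (auto simp: mem_Times_iff disjnt_iff)
    then show ?thesis by blast
  next
    case True
    obtain c where c: "c \<in> A" "fst z \<in> fst c" using p topspace_charts by blast
    have "bundle_chart c z \<noteq> bundle_chart c z'"
      using zz True c bundle_chart_inv_bundle_chart[OF c(1)] by metis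
    then obtain S S' where S: "open S" "open S'" "bundle_chart c z \<in> S" "bundle_chart c z' \<in> S'" "S
        \<inter> S' = {}"
      using separation_t2 by (metis (no_types, lifting))
    let ?U = "\<lambda>S. {z. fst z \<in> fst c \<and> bundle_chart c z \<in> S}"
    have "openin (tangent_topology X A) (?U S)" "openin (tangent_topology X A) (?U S')"
      using S c bundle_chart_openin by blast+
    moreover have "z \<in> ?U S" "z' \<in> ?U S'" "disjnt (?U S) (?U S')"
      using S c True by (auto simp: disjnt_iff)
    ultimately show ?thesis by blast
  qed
qed

end

section \<open>Covariant derivatives along curves\<close>

lemma has_vector_derivative_eventually_cong:
  assumes "(f has_vector_derivative f') (at t)" "\<forall>\<^sub>F s in nhds t. f s = g s"
  shows "(g has_vector_derivative f') (at t)"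
proof -
  obtain S where "open S" "t \<in> S" "\<And>s. s \<in> S \<Longrightarrow> f s = g s"
    using assms(2) unfolding eventually_nhds by blast
  then show ?thesis
    using has_vector_derivative_transform_within_open[OF assms(1)] by blast
qed

text \<open>The limit clause of \<open>has_velocity\<close> is what keeps a curve inside a chart
  domain near \<open>t\<close>. Off the domain the coordinate map is arbitrary, so the derivative of
  the coordinates alone would not locate the curve.\<close>

lemma limitin_at_nhds:
  assumes "limitin X q (q t) (at t)" "openin X U" "q t \<in> U"
  shows "\<forall>\<^sub>F s in nhds t. q s \<in> U"
proof -
  have "\<forall>\<^sub>F s in nhds t. s \<noteq> t \<longrightarrow> q s \<in> U"
    using assms by (simp add: limitin_def eventually_at_filter)
  then show ?thesis by (rule eventually_mono) (use assms(3) in metis)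
qed

lemma limitin_atI:
  assumes "q t \<in> topspace X" "\<And>U. openin X U \<Longrightarrow> q t \<in> U \<Longrightarrow> \<forall>\<^sub>F s in nhds t. q s \<in> U"
  shows "limitin X q (q t) (at t)"
  using assms by (simp add: limitin_def eventually_at_filter) (metis (mono_tags, lifting)
      eventually_mono)

lemma has_velocity_limitin: "has_velocity X A q v t \<Longrightarrow> limitin X q (q t) (at t)"
  by (simp add: has_velocity_def)

lemma has_velocity_topspace: "has_velocity X A q v t \<Longrightarrow> q t \<in> topspace X"
  using has_velocity_limitin limitin_topspace by metis

lemma has_velocity_unique: "has_velocity X A q v t \<Longrightarrow> has_velocity X A q w t \<Longrightarrow> v = w"
  unfolding has_velocity_def using vector_derivative_unique_at by blast

lemma has_velocity_cong:
  assumes "has_velocity X A q v t" "\<forall>\<^sub>F s in nhds t. q s = r s"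
  shows "has_velocity X A r v t"
proof -
  have t: "q t = r t" using assms(2) by (rule eventually_nhds_x_imp_x)
  have "limitin X r (r t) (at t)"
  proof (rule limitin_atI)
    show "r t \<in> topspace X" using has_velocity_topspace[OF assms(1)] t by simp
    fix U assume "openin X U" "r t \<in> U"
    then have "\<forall>\<^sub>F s in nhds t. q s \<in> U"
      using limitin_at_nhds[OF has_velocity_limitin[OF assms(1)]] t by metis
    then show "\<forall>\<^sub>F s in nhds t. r s \<in> U"
      using assms(2) by eventually_elim simp
  qed
  moreover have "((\<lambda>s. snd (chart_at A (r t)) (r s)) has_vector_derivative v) (at t)"
    using assms unfolding has_velocity_def t
    by (auto elim!: has_vector_derivative_eventually_cong eventually_mono)
  ultimately show ?thesis by (simp add: has_velocity_def)
qed

lemma has_covariant_derivative_cong: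
  assumes "has_covariant_derivative X A nabla q V a t"
    "\<forall>\<^sub>F s in nhds t. q s = r s" "\<forall>\<^sub>F s in nhds t. V s = U s"
  shows "has_covariant_derivative X A nabla r U a t"
proof -
  have t: "q t = r t" "V t = U t"
    using assms(2,3) by (auto dest: eventually_nhds_x_imp_x)
  obtain w V' where w: "has_velocity X A q w t"
    and V': "((\<lambda>s. tangent_coord A (chart_at A (q t)) (q s) (V s)) has_vector_derivative V') (at t)"
    and a: "a = V' + (\<Sum>b\<in>Basis. (V t \<bullet> b) *\<^sub>R nabla (q t) w (coord_field A (chart_at A (q t)) b))"
    using assms(1) unfolding has_covariant_derivative_def Let_def by blast
  have "\<forall>\<^sub>F s in nhds t. tangent_coord A (chart_at A (q t)) (q s) (V s) =
      tangent_coord A (chart_at A (q t)) (r s) (U s)"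
    using assms(2,3) by eventually_elim simp
  from has_vector_derivative_eventually_cong[OF V' this] has_velocity_cong[OF w assms(2)] a
  show ?thesis unfolding has_covariant_derivative_def Let_def t by blast
qed

locale riemannian = smooth_atlas X A
  for X :: "'a topology" and A :: "('a, 'e::euclidean_space) chart set" +
  fixes g :: "'a \<Rightarrow> 'e \<Rightarrow> 'e \<Rightarrow> real" and nabla :: "('a, 'e) connection"
  assumes riemannian: "riemannian_manifold X A g" and levi_civita: "levi_civita X A g nabla"
begin

lemma has_derivative_chart_change:
  assumes "c \<in> A" "d \<in> A" "q t \<in> fst c" "q t \<in> fst d" "limitin X q (q t) (at t)"
    "((\<lambda>s. snd c (q s)) has_vector_derivative y) (at t)"
  shows "((\<lambda>s. snd d (q s)) has_vector_derivative jacobian c d (snd c (q t)) y) (at t)"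
proof -
  have "((\<lambda>s. transition c d (snd c (q s))) has_vector_derivative jacobian c d (snd c (q t)) y) (at t)"
    using vector_derivative_diff_chain_within[OF assms(6), of "transition c d"]
      has_derivative_at_withinI[OF transition_has_derivative[OF assms(1-4)]]
    by (simp add: o_def)
  moreover have "\<forall>\<^sub>F s in nhds t. transition c d (snd c (q s)) = snd d (q s)"
    using limitin_at_nhds[OF assms(5) chart_openin[OF assms(1)] assms(3)]
    by eventually_elim (simp add: chart_inv_chart[OF assms(1)])
  ultimately show ?thesis by (rule has_vector_derivative_eventually_cong)
qed

text \<open>The definition refers to the chart chosen at \<open>q t\<close>; the chain rule with the
  transition map allows any chart around the point.\<close>

lemma has_velocity_chart:
  assumes "c \<in> A" "q t \<in> fst c"
  shows "has_velocity X A q w t \<longleftrightarrow> limitin X q (q t) (at t) \<and>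
    ((\<lambda>s. snd c (q s)) has_vector_derivative tangent_coord A c (q t) w) (at t)"
proof -
  let ?k = "chart_at A (q t)"
  note k = chart_at_facts[OF assms]
  show ?thesis
  proof (intro iffI conjI)
    assume v: "has_velocity X A q w t"
    then show "limitin X q (q t) (at t)" by (rule has_velocity_limitin)
    show "((\<lambda>s. snd c (q s)) has_vector_derivative tangent_coord A c (q t) w) (at t)"
      using has_derivative_chart_change[where c = ?k and d = c and q = q and t = t and y = w] v assms k
      by (simp add: has_velocity_def tangent_coord_jacobian)
  next
    assume v: "limitin X q (q t) (at t) \<and>
      ((\<lambda>s. snd c (q s)) has_vector_derivative tangent_coord A c (q t) w) (at t)"
    have "((\<lambda>s. snd ?k (q s)) has_vector_derivative jacobian c ?k (snd c (q t)) (tangent_coord A c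
        (q t) w)) (at t)"
      using has_derivative_chart_change[where c = c and d = ?k and q = q and t = t] v assms k by blast
    then show "has_velocity X A q w t"
      using v coord_field_tangent_coord[OF assms] by (simp add: has_velocity_def coord_field_jacobian)
  qed
qed

section \<open>The Levi-Civita connection in coordinates\<close>

lemma linear_connection_nabla: "linear_connection X A nabla"
  using levi_civita unfolding levi_civita_def by blast

context
  fixes U Y assumes U: "openin X U" and Y: "smooth_field A U Y"
begin

lemmas nabla_axioms =
  linear_connection_nabla[unfolded linear_connection_def, THEN spec, THEN spec, THEN mp, OF
      conjI, OF U Y]

lemma nabla_linear: "p \<in> U \<Longrightarrow> linear (\<lambda>v. nabla p v Y)"
  using nabla_axioms[THEN conjunct1] by blast

lemma nabla_add:
  "p \<in> U \<Longrightarrow> smooth_field A U Z \<Longrightarrow> nabla p v (\<lambda>q. Y q + Z q) = nabla p v Y + nabla p v Z"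
  using nabla_axioms[THEN conjunct2, THEN conjunct1, THEN spec, THEN mp, THEN conjunct1] by blast

lemma nabla_cong:
  "p \<in> U \<Longrightarrow> smooth_field A U Z \<Longrightarrow> (\<And>q. q \<in> U \<Longrightarrow> Y q = Z q) \<Longrightarrow> nabla p v Y = nabla p v Z"
  using nabla_axioms[THEN conjunct2, THEN conjunct1, THEN spec, THEN mp, THEN conjunct2, THEN conjunct1]
  by blast

lemma nabla_smooth: "smooth_field A U Z \<Longrightarrow> smooth_field A U (\<lambda>p. nabla p (Z p) Y)"
  using nabla_axioms[THEN conjunct2, THEN conjunct1, THEN spec, THEN mp, THEN conjunct2, THEN
      conjunct2] .

lemma nabla_leibniz:
  "p \<in> U \<Longrightarrow> smooth_fun A U f \<Longrightarrow> nabla p v (\<lambda>q. f q *\<^sub>R Y q) = dfun A f p v *\<^sub>R Y p + f p *\<^sub>R nabla p v Y"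
  using nabla_axioms[THEN conjunct2, THEN conjunct2, THEN spec, THEN mp] by blast

end

lemma nabla_sum:
  assumes "openin X U" "p \<in> U" "finite I" "\<And>i. i \<in> I \<Longrightarrow> smooth_field A U (Y i)"
  shows "nabla p v (\<lambda>q. \<Sum>i\<in>I. Y i q) = (\<Sum>i\<in>I. nabla p v (Y i))"
  using assms(3,4)
proof (induction I)
  case empty
  have "smooth_field A U (\<lambda>q. 0)" using smooth_field_sum[OF assms(1), of "{}"] by simp
  \<comment> \<open>The zero field is the sum of itself with itself, so additivity forces its
    derivative to be 0.\<close>
  from nabla_add[OF assms(1) this assms(2) this, of v] show ?case by simp
next
  case (insert i I)
  then have "smooth_field A U (\<lambda>q. \<Sum>i\<in>I. Y i q)" using smooth_field_sum[OF assms(1)] by blast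
  then show ?case using insert nabla_add[OF assms(1) _ assms(2), of "Y i"] by simp
qed

lemma nabla_coord_field_linear:
  assumes "c \<in> A" "p \<in> fst c"
  shows "linear (\<lambda>v. nabla p v (coord_field A c b))"
  using nabla_linear[OF chart_openin coord_field_smooth] assms by blast

text \<open>The transformation law of the Christoffel symbols. A coordinate field of
  \<open>c\<close> is a combination of those of \<open>d\<close> with Jacobian coefficients; the
  Leibniz rule differentiates these coefficients, which produces the inhomogeneous term with the
  second derivative of the transition map.\<close>

lemma nabla_coord_field_change:
  assumes "c \<in> A" "d \<in> A" "p \<in> fst c" "p \<in> fst d"
  shows "nabla p w (coord_field A c b) =
    coord_field A d (frechet_derivative (\<lambda>x. jacobian c d x b) (at (snd c p)) (tangent_coord A c p
        w)) p +
    (\<Sum>i\<in>Basis. (jacobian c d (snd c p) b \<bullet> i) *\<^sub>R nabla p w (coord_field A d i))"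
proof -
  let ?U = "fst c \<inter> fst d"
  let ?D = "frechet_derivative (\<lambda>x. jacobian c d x b) (at (snd c p))"
  let ?f = "\<lambda>i p. jacobian c d (snd c p) b \<bullet> i"
  have U: "openin X ?U" "p \<in> ?U"
    using assms openin_Int[OF chart_openin chart_openin] by simp_all
  have sm: "smooth_field A ?U (coord_field A d i)" for i
    by (rule smooth_field_subset[OF coord_field_smooth[OF assms(2)] chart_openin[OF assms(2)] U(1)])
        simp
  have smc: "smooth_field A ?U (coord_field A c b)"
    by (rule smooth_field_subset[OF coord_field_smooth[OF assms(1)] chart_openin[OF assms(1)] U(1)])
        simp
  have smf: "smooth_field A ?U (\<lambda>q. ?f i q *\<^sub>R coord_field A d i q)" for i
    by (rule smooth_field_scaleR[OF U(1) jacobian_smooth_fun[OF assms(1,2)] sm])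
  have eq: "coord_field A c b q = (\<Sum>i\<in>Basis. ?f i q *\<^sub>R coord_field A d i q)" if "q \<in> ?U" for q
  proof -
    have "coord_field A c b q = coord_field A d (jacobian c d (snd c q) b) q"
      using coord_field_tangent_coord[of d q "coord_field A c b q"] tangent_coord_coord_field[of c q
          d b] assms that
      by simp
    moreover have "q \<in> fst d" using that by simp
    ultimately show ?thesis
      using trans[OF _ linear_Basis_expansion[OF coord_field_linear[OF assms(2)]]] by blast
  qed
  have "nabla p w (coord_field A c b) = nabla p w (\<lambda>q. \<Sum>i\<in>Basis. ?f i q *\<^sub>R coord_field A d i q)"
    by (rule nabla_cong[OF U(1) smc U(2) smooth_field_sum[OF U(1) smf] eq])
  also have "\<dots> = (\<Sum>i\<in>Basis. nabla p w (\<lambda>q. ?f i q *\<^sub>R coord_field A d i q))"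
    by (rule nabla_sum[OF U finite_Basis smf])
  also have "\<dots> = (\<Sum>i\<in>Basis. dfun A (?f i) p w *\<^sub>R coord_field A d i p + ?f i p *\<^sub>R nabla p w
      (coord_field A d i))"
    by (rule sum.cong[OF refl]) (rule nabla_leibniz[OF U(1) sm U(2) jacobian_smooth_fun[OF assms(1,2)]])
  also have "\<dots> = (\<Sum>i\<in>Basis. (?D (tangent_coord A c p w) \<bullet> i) *\<^sub>R coord_field A d i p) +
      (\<Sum>i\<in>Basis. ?f i p *\<^sub>R nabla p w (coord_field A d i))"
  proof -
    have "dfun A (?f i) p w = ?D (tangent_coord A c p w) \<bullet> i" for i
    proof (rule dfun_chart[OF assms(1,3)])
      have "((\<lambda>x. jacobian c d x b) has_derivative ?D) (at (snd c p))"
        using smooth_on_has_derivative[OF overlap_open jacobian_smooth] assms by blast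
      then have "((\<lambda>x. jacobian c d x b \<bullet> i) has_derivative (\<lambda>v. ?D v \<bullet> i)) (at (snd c p))"
        by (rule has_derivative_inner_left)
      then show "((\<lambda>x. ?f i (chart_inv c x)) has_derivative (\<lambda>v. ?D v \<bullet> i)) (at (snd c p))"
        by (rule has_derivative_transform_within_open[OF _ chart_image_open[OF assms(1)]])
          (use assms in \<open>auto simp: chart_inv_chart\<close>)
    qed
    then show ?thesis by (simp add: sum.distrib)
  qed
  also have "(\<Sum>i\<in>Basis. (?D (tangent_coord A c p w) \<bullet> i) *\<^sub>R coord_field A d i p) =
      coord_field A d (?D (tangent_coord A c p w)) p"
    by (rule linear_Basis_expansion[OF coord_field_linear[OF assms(2,4)], symmetric])
  finally show ?thesis .
qed

text \<open>The formula of \<open>has_covariant_derivative\<close> with an arbitrary chart instead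
  of the chosen one. \<open>coord_field\<close> translates the derivative \<open>V'\<close> of the
  components back to the representation at the point.\<close>

definition covariant_in_chart ::
    "('a, 'e) chart \<Rightarrow> (real \<Rightarrow> 'a) \<Rightarrow> 'e \<Rightarrow> (real \<Rightarrow> 'e) \<Rightarrow> 'e \<Rightarrow> real \<Rightarrow> bool" where
  "covariant_in_chart c q w V a t \<longleftrightarrow>
    (\<exists>V'. ((\<lambda>s. tangent_coord A c (q s) (V s)) has_vector_derivative V') (at t) \<and>
      a = coord_field A c V' (q t) +
        (\<Sum>b\<in>Basis. (tangent_coord A c (q t) (V t) \<bullet> b) *\<^sub>R nabla (q t) w (coord_field A c b)))"

text \<open>The components in \<open>d\<close> are the Jacobian applied to those in
  \<open>c\<close>, so their derivative contains the derivative of the Jacobian along the curve.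
  Precisely this term is supplied by the inhomogeneous part of
  \<open>nabla_coord_field_change\<close>, so both charts give the same vector.\<close>

lemma covariant_chart_change:
  assumes "c \<in> A" "d \<in> A" "q t \<in> fst c" "q t \<in> fst d" "has_velocity X A q w t"
    "covariant_in_chart c q w V a t"
  shows "covariant_in_chart d q w V a t"
proof -
  let ?p = "q t" let ?x = "\<lambda>s. snd c (q s)" let ?Vc = "\<lambda>s. tangent_coord A c (q s) (V s)"
  let ?J = "jacobian c d" let ?D = "\<lambda>b. frechet_derivative (\<lambda>x. ?J x b) (at (?x t))"
  let ?x' = "tangent_coord A c ?p w"
  obtain V' where V': "(?Vc has_vector_derivative V') (at t)"
    and a: "a = coord_field A c V' ?p + (\<Sum>b\<in>Basis. (?Vc t \<bullet> b) *\<^sub>R nabla ?p w (coord_field A c b))"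
    using assms(6) unfolding covariant_in_chart_def by blast
  have x': "(?x has_vector_derivative ?x') (at t)" and lim: "limitin X q ?p (at t)"
    using assms(5) has_velocity_chart[where q = q and t = t, OF assms(1,3)] by blast+
  have Jlin: "linear (?J (?x t))" using jacobian_linear[OF assms(1-4)] .
  have J': "((\<lambda>s. ?J (?x s) b) has_vector_derivative ?D b ?x') (at t)" for b
  proof -
    have "((\<lambda>x. ?J x b) has_derivative ?D b) (at (?x t))"
      using smooth_on_has_derivative[OF overlap_open jacobian_smooth] assms by blast
    from vector_derivative_diff_chain_within[OF x' has_derivative_at_withinI[OF this]]
    show ?thesis by (simp add: o_def)
  qed
  have sm: "((\<lambda>s. (?Vc s \<bullet> b) *\<^sub>R ?J (?x s) b) has_vector_derivative
      ((?Vc t \<bullet> b) *\<^sub>R ?D b ?x' + (V' \<bullet> b) *\<^sub>R ?J (?x t) b)) (at t)" for b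
    using bounded_bilinear.has_vector_derivative[OF bounded_bilinear_scaleR
        bounded_linear.has_vector_derivative[OF bounded_linear_inner_left V'] J'] .
  have "((\<lambda>s. \<Sum>b\<in>Basis. (?Vc s \<bullet> b) *\<^sub>R ?J (?x s) b) has_vector_derivative
      (\<Sum>b\<in>Basis. (?Vc t \<bullet> b) *\<^sub>R ?D b ?x' + (V' \<bullet> b) *\<^sub>R ?J (?x t) b)) (at t)"
    by (rule has_vector_derivative_sum) (rule sm)
  moreover have "\<forall>\<^sub>F s in nhds t. (\<Sum>b\<in>Basis. (?Vc s \<bullet> b) *\<^sub>R ?J (?x s) b) =
      tangent_coord A d (q s) (V s)"
    using limitin_at_nhds[OF lim chart_openin[OF assms(1)] assms(3)] limitin_at_nhds[OF lim
        chart_openin[OF assms(2)] assms(4)]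
  proof eventually_elim
    case (elim s)
    have "tangent_coord A d (q s) (V s) = ?J (?x s) (?Vc s)"
      using tangent_coord_change[OF assms(1) elim(1) assms(2) elim(2)] .
    from trans[OF this linear_Basis_expansion[OF jacobian_linear[OF assms(1,2) elim]]]
    show ?case by (rule sym)
  qed
  ultimately have der: "((\<lambda>s. tangent_coord A d (q s) (V s)) has_vector_derivative
      (\<Sum>b\<in>Basis. (?Vc t \<bullet> b) *\<^sub>R ?D b ?x' + (V' \<bullet> b) *\<^sub>R ?J (?x t) b)) (at t)"
    by (rule has_vector_derivative_eventually_cong)
  have Vd: "tangent_coord A d ?p (V t) = (\<Sum>b\<in>Basis. (?Vc t \<bullet> b) *\<^sub>R ?J (?x t) b)"
    by (rule trans[OF tangent_coord_change[OF assms(1,3,2,4)] linear_Basis_expansion[OF Jlin]])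
  note cl = coord_field_linear[OF assms(2,4)]
  have "(\<Sum>b\<in>Basis. (?Vc t \<bullet> b) *\<^sub>R nabla ?p w (coord_field A c b)) =
      (\<Sum>b\<in>Basis. (?Vc t \<bullet> b) *\<^sub>R coord_field A d (?D b ?x') ?p) +
      (\<Sum>b\<in>Basis. \<Sum>i\<in>Basis. ((?Vc t \<bullet> b) * (?J (?x t) b \<bullet> i)) *\<^sub>R nabla ?p w (coord_field A d i))"
    by (simp add: nabla_coord_field_change[OF assms(1-4)] scaleR_add_right sum.distrib scaleR_sum_right)
  also have "(\<Sum>b\<in>Basis. \<Sum>i\<in>Basis. ((?Vc t \<bullet> b) * (?J (?x t) b \<bullet> i)) *\<^sub>R nabla ?p w (coord_field A d
      i)) =
      (\<Sum>i\<in>Basis. (tangent_coord A d ?p (V t) \<bullet> i) *\<^sub>R nabla ?p w (coord_field A d i))"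
    by (subst sum.swap) (simp add: Vd inner_sum_left scaleR_sum_left)
  also have "(\<Sum>b\<in>Basis. (?Vc t \<bullet> b) *\<^sub>R coord_field A d (?D b ?x') ?p) =
      coord_field A d (\<Sum>b\<in>Basis. (?Vc t \<bullet> b) *\<^sub>R ?D b ?x') ?p"
    by (simp add: linear_sum[OF cl] linear_cmul[OF cl] o_def)
  moreover have "coord_field A c V' ?p = coord_field A d (\<Sum>b\<in>Basis. (V' \<bullet> b) *\<^sub>R ?J (?x t) b) ?p"
  proof -
    have "coord_field A c V' ?p = coord_field A d (?J (?x t) V') ?p"
      using coord_field_tangent_coord[OF assms(2,4), of "coord_field A c V' ?p"]
        tangent_coord_coord_field[OF assms(1,3,2,4)] by simp
    then show ?thesis using linear_Basis_expansion[OF Jlin, of V'] by simp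
  qed
  ultimately have "a = coord_field A d (\<Sum>b\<in>Basis. (?Vc t \<bullet> b) *\<^sub>R ?D b ?x' + (V' \<bullet> b) *\<^sub>R ?J
      (?x t) b) ?p +
      (\<Sum>i\<in>Basis. (tangent_coord A d ?p (V t) \<bullet> i) *\<^sub>R nabla ?p w (coord_field A d i))"
    by (simp add: a sum.distrib linear_add[OF cl])
  with der show ?thesis unfolding covariant_in_chart_def by blast
qed

lemma has_covariant_derivative_chart:
  assumes "c \<in> A" "q t \<in> fst c" "has_velocity X A q w t"
  shows "has_covariant_derivative X A nabla q V a t \<longleftrightarrow> covariant_in_chart c q w V a t"
proof -
  let ?k = "chart_at A (q t)"
  note k = chart_at_facts[OF assms(1,2)]
  have "has_covariant_derivative X A nabla q V a t \<longleftrightarrow> covariant_in_chart ?k q w V a t"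
    unfolding has_covariant_derivative_def covariant_in_chart_def Let_def
      tangent_coord_chart_at[OF assms(1,2)] coord_field_chart_at[OF assms(1,2)]
    using assms(3) has_velocity_unique[OF assms(3)] by blast
  also have "\<dots> \<longleftrightarrow> covariant_in_chart c q w V a t"
    using covariant_chart_change[where t = t and q = q] assms k by blast
  finally show ?thesis .
qed

section \<open>The metric along curves, and reparametrization\<close>

lemma
  assumes "p \<in> topspace X"
  shows metric_bilinear: "bilinear (g p)" and metric_sym: "g p u v = g p v u"
    and metric_pos: "v \<noteq> 0 \<Longrightarrow> g p v v > 0"
  using riemannian assms unfolding riemannian_manifold_def by blast+

text \<open>Smoothness of the metric is stated on coordinate fields; this expansion carries it over
  to arbitrary vectors.\<close>

lemma metric_expansion:
  assumes "p \<in> topspace X" "c \<in> A" "p \<in> fst c"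
  shows "g p u v = (\<Sum>a\<in>Basis. \<Sum>b\<in>Basis. (tangent_coord A c p u \<bullet> a) * (tangent_coord A c p v \<bullet> b) *
    g p (coord_field A c a p) (coord_field A c b p))"
proof -
  have l: "linear (\<lambda>u. g p u v)" "linear (\<lambda>v. g p u v)" for u v
    using metric_bilinear[OF assms(1)] unfolding bilinear_def by auto
  have "u = (\<Sum>a\<in>Basis. (tangent_coord A c p u \<bullet> a) *\<^sub>R coord_field A c a p)" for u
    using linear_Basis_expansion[OF coord_field_linear[OF assms(2,3)], of "tangent_coord A c p u"]
      coord_field_tangent_coord[OF assms(2,3), of u] by simp
  from arg_cong2[OF this this] have "g p u v = g p (\<Sum>a\<in>Basis. (tangent_coord A c p u \<bullet> a) *\<^sub>R
      coord_field A c a p)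
      (\<Sum>b\<in>Basis. (tangent_coord A c p v \<bullet> b) *\<^sub>R coord_field A c b p)" .
  also have "\<dots> = (\<Sum>a\<in>Basis. (tangent_coord A c p u \<bullet> a) * g p (coord_field A c a p)
      (\<Sum>b\<in>Basis. (tangent_coord A c p v \<bullet> b) *\<^sub>R coord_field A c b p))"
    by (simp only: linear_sum[OF l(1)] linear_cmul[OF l(1)] o_def real_scaleR_def)
  also have "\<dots> = (\<Sum>a\<in>Basis. (tangent_coord A c p u \<bullet> a) * (\<Sum>b\<in>Basis. (tangent_coord A c p v \<bullet> b) *
      g p (coord_field A c a p) (coord_field A c b p)))"
    by (simp only: linear_sum[OF l(2)] linear_cmul[OF l(2)] o_def real_scaleR_def)
  finally show ?thesis by (simp add: sum_distrib_left mult.assoc)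
qed

lemma metric_smooth:
  assumes "c \<in> A"
  shows "smooth_on (snd c ` fst c) (\<lambda>x. g (chart_inv c x) (coord_field A c a (chart_inv c x))
      (coord_field A c b (chart_inv c x)))"
proof -
  have "smooth_fun A (fst c) (\<lambda>p. g p (coord_field A c a p) (coord_field A c b p))"
    using riemannian assms unfolding riemannian_manifold_def by blast
  from this[unfolded smooth_fun_def, THEN bspec, OF assms] show ?thesis by simp
qed

lemma metric_compatible:
  assumes "openin X U" "smooth_field A U Y" "smooth_field A U Z" "p \<in> U"
  shows "dfun A (\<lambda>q. g q (Y q) (Z q)) p v = g p (nabla p v Y) (Z p) + g p (Y p) (nabla p v Z)"
  using levi_civita assms unfolding levi_civita_def metric_connection_def by blast

text \<open>Compatibility is stated for fields on open sets, whereas \<open>V\<close> lives only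
  along the curve. Hence \<open>V\<close> is expanded in coordinate fields: compatibility
  differentiates their inner products \<open>?G i j\<close>, and the ordinary product rule treats
  the components.\<close>

lemma metric_along_curve:
  assumes "has_covariant_derivative X A nabla q V a t"
  shows "((\<lambda>s. g (q s) (V s) (V s)) has_real_derivative 2 * g (q t) a (V t)) (at t)"
proof -
  let ?k = "chart_at A (q t)" let ?p = "q t"
  let ?V = "\<lambda>s. tangent_coord A ?k (q s) (V s)"
  let ?G = "\<lambda>i j p. g p (coord_field A ?k i p) (coord_field A ?k j p)"
  obtain w V' where w: "has_velocity X A q w t"
    and V': "(?V has_vector_derivative V') (at t)"
    and a: "a = V' + (\<Sum>b\<in>Basis. (V t \<bullet> b) *\<^sub>R nabla ?p w (coord_field A ?k b))"
    using assms(1) unfolding has_covariant_derivative_def Let_def by blast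
  have p: "?p \<in> topspace X" using has_velocity_topspace[OF w] .
  have k: "?k \<in> A" "?p \<in> fst ?k" using chart_at_in chart_at_dom p by auto
  note at_p = tangent_coord_chart_at[OF k] coord_field_chart_at[OF k]
  have x': "((\<lambda>s. snd ?k (q s)) has_vector_derivative w) (at t)" and lim: "limitin X q ?p (at t)"
    using w unfolding has_velocity_def by auto
  note near = limitin_at_nhds[OF lim chart_openin[OF k(1)] k(2)]
  have l: "linear (\<lambda>u. g ?p u v)" "linear (\<lambda>v. g ?p u v)" for u v
    using metric_bilinear[OF p] unfolding bilinear_def by auto
  define N where "N i = nabla ?p w (coord_field A ?k i)" for i
  have G': "((\<lambda>s. ?G i j (q s)) has_vector_derivative g ?p (N i) j + g ?p i (N j)) (at t)" for i j
  proof -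
    let ?h = "\<lambda>x. ?G i j (chart_inv ?k x)"
    let ?D = "frechet_derivative ?h (at (snd ?k ?p))"
    have D: "(?h has_derivative ?D) (at (snd ?k ?p))"
      using smooth_on_has_derivative[OF chart_image_open metric_smooth] k by blast
    have "?D w = dfun A (?G i j) ?p w"
      using dfun_chart[OF k D, of w] by (simp add: at_p)
    also have "\<dots> = g ?p (N i) j + g ?p i (N j)"
      using metric_compatible[OF chart_openin[OF k(1)] coord_field_smooth[OF k(1)]
          coord_field_smooth[OF k(1)] k(2)]
      by (simp add: at_p N_def)
    finally have "((\<lambda>s. ?h (snd ?k (q s))) has_vector_derivative g ?p (N i) j + g ?p i (N j)) (at t)"
      using vector_derivative_diff_chain_within[OF x' has_derivative_at_withinI[OF D]]
          by (simp add: o_def)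
    moreover have "\<forall>\<^sub>F s in nhds t. ?h (snd ?k (q s)) = ?G i j (q s)"
      using near by eventually_elim (simp add: chart_inv_chart[OF k(1)])
    ultimately show ?thesis by (rule has_vector_derivative_eventually_cong)
  qed
  have Vi: "((\<lambda>s. ?V s \<bullet> i) has_real_derivative V' \<bullet> i) (at t)" for i
    using bounded_linear.has_vector_derivative[OF bounded_linear_inner_left V']
    by (simp add: has_real_derivative_iff_has_vector_derivative)
  have term': "((\<lambda>s. (?V s \<bullet> i) * (?V s \<bullet> j) * ?G i j (q s)) has_real_derivative
      (V' \<bullet> i) * (V t \<bullet> j) * g ?p i j + (V t \<bullet> i) * (V' \<bullet> j) * g ?p i j +
      (V t \<bullet> i) * (V t \<bullet> j) * (g ?p (N i) j + g ?p i (N j))) (at t)" for i j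
    using DERIV_mult[OF DERIV_mult[OF Vi[of i] Vi[of j]] G'[of i j, folded
        has_real_derivative_iff_has_vector_derivative]]
    by (simp add: at_p algebra_simps)
  have "((\<lambda>s. \<Sum>i\<in>Basis. \<Sum>j\<in>Basis. (?V s \<bullet> i) * (?V s \<bullet> j) * ?G i j (q s)) has_real_derivative
      (\<Sum>i\<in>Basis. \<Sum>j\<in>Basis. (V' \<bullet> i) * (V t \<bullet> j) * g ?p i j + (V t \<bullet> i) * (V' \<bullet> j) * g ?p i j +
      (V t \<bullet> i) * (V t \<bullet> j) * (g ?p (N i) j + g ?p i (N j)))) (at t)"
    by (intro DERIV_sum term')
  moreover have "(\<Sum>i\<in>Basis. \<Sum>j\<in>Basis. (V' \<bullet> i) * (V t \<bullet> j) * g ?p i j + (V t \<bullet> i) * (V' \<bullet> j) * g ?p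
      i j +
      (V t \<bullet> i) * (V t \<bullet> j) * (g ?p (N i) j + g ?p i (N j))) = 2 * g ?p a (V t)"
  proof -
    have e: "g ?p u v = (\<Sum>i\<in>Basis. \<Sum>j\<in>Basis. (u \<bullet> i) * (v \<bullet> j) * g ?p i j)" for u v
      using metric_expansion[OF p k, of u v] by (simp add: at_p)
    have "g ?p (\<Sum>i\<in>Basis. (V t \<bullet> i) *\<^sub>R N i) (V t) = (\<Sum>i\<in>Basis. (V t \<bullet> i) * g ?p (N i) (V t))"
      by (simp add: linear_sum[OF l(1)] linear_cmul[OF l(1)] o_def)
    also have "\<dots> = (\<Sum>i\<in>Basis. (V t \<bullet> i) * (\<Sum>j\<in>Basis. (V t \<bullet> j) * g ?p (N i) j))"
      using linear_Basis_expansion[OF l(2), of _ "V t"] by simp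
    finally have e1: "g ?p (\<Sum>i\<in>Basis. (V t \<bullet> i) *\<^sub>R N i) (V t) = (\<Sum>i\<in>Basis. \<Sum>j\<in>Basis. (V t \<bullet> i) *
        (V t \<bullet> j) * g ?p (N i) j)"
      by (simp add: sum_distrib_left mult.assoc)
    \<comment> \<open>Symmetry of the metric and an exchange of the two summation indices show that
      the two connection terms contribute equally.\<close>
    have e2: "g ?p (\<Sum>i\<in>Basis. (V t \<bullet> i) *\<^sub>R N i) (V t) = (\<Sum>i\<in>Basis. \<Sum>j\<in>Basis. (V t \<bullet> i) * (V t \<bullet> j)
        * g ?p i (N j))"
      unfolding e1 by (subst sum.swap) (simp add: metric_sym[OF p] mult.commute)
    have "g ?p a (V t) = g ?p V' (V t) + g ?p (\<Sum>i\<in>Basis. (V t \<bullet> i) *\<^sub>R N i) (V t)"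
      by (simp add: a N_def linear_add[OF l(1)])
    moreover have "g ?p V' (V t) = g ?p (V t) V'" by (rule metric_sym[OF p])
    ultimately have "2 * g ?p a (V t) = (g ?p V' (V t) + g ?p (V t) V') +
        (g ?p (\<Sum>i\<in>Basis. (V t \<bullet> i) *\<^sub>R N i) (V t) + g ?p (\<Sum>i\<in>Basis. (V t \<bullet> i) *\<^sub>R N i) (V t))"
      by simp
    also have "\<dots> = (\<Sum>i\<in>Basis. \<Sum>j\<in>Basis. (V' \<bullet> i) * (V t \<bullet> j) * g ?p i j) +
        (\<Sum>i\<in>Basis. \<Sum>j\<in>Basis. (V t \<bullet> i) * (V' \<bullet> j) * g ?p i j) +
        ((\<Sum>i\<in>Basis. \<Sum>j\<in>Basis. (V t \<bullet> i) * (V t \<bullet> j) * g ?p (N i) j) +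
        (\<Sum>i\<in>Basis. \<Sum>j\<in>Basis. (V t \<bullet> i) * (V t \<bullet> j) * g ?p i (N j)))"
      using e[of V' "V t"] e[of "V t" V'] e1 e2 by simp
    finally show ?thesis by (simp add: sum.distrib[symmetric] algebra_simps)
  qed
  ultimately have "((\<lambda>s. \<Sum>i\<in>Basis. \<Sum>j\<in>Basis. (?V s \<bullet> i) * (?V s \<bullet> j) * ?G i j
      (q s)) has_vector_derivative 2 * g ?p a (V t)) (at t)"
    by (simp add: has_real_derivative_iff_has_vector_derivative)
  moreover have "\<forall>\<^sub>F s in nhds t. (\<Sum>i\<in>Basis. \<Sum>j\<in>Basis. (?V s \<bullet> i) * (?V s \<bullet> j) * ?G i j (q s)) =
      g (q s) (V s) (V s)"
    using near
  proof eventually_elim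
    case (elim s)
    then have "q s \<in> topspace X" using chart_subset[OF k(1)] by blast
    from metric_expansion[OF this k(1) elim, of "V s" "V s"] show ?case by simp
  qed
  ultimately show ?thesis
    unfolding has_real_derivative_iff_has_vector_derivative
        by (rule has_vector_derivative_eventually_cong)
qed

text \<open>Chain rule for the curve and product rule for the factor in one statement. The field
  \<open>u\<close> may differ from the velocity \<open>v\<close>, and \<open>\<rho>\<close> from
  \<open>\<sigma>'\<close>, so time shifts and changes of speed are both covered.\<close>

lemma reparametrize:
  assumes v: "has_velocity X A r v (\<sigma> t)" and u: "has_covariant_derivative X A nabla r u a (\<sigma> t)"
    and \<sigma>: "(\<sigma> has_real_derivative \<sigma>') (at t)" and \<rho>: "(\<rho> has_real_derivative \<rho>') (at t)"
  shows "has_velocity X A (\<lambda>s. r (\<sigma> s)) (\<sigma>' *\<^sub>R v) t"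
    and "has_covariant_derivative X A nabla (\<lambda>s. r (\<sigma> s)) (\<lambda>s. \<rho> s *\<^sub>R u (\<sigma> s))
      (\<rho>' *\<^sub>R u (\<sigma> t) + (\<rho> t * \<sigma>') *\<^sub>R a) t"
proof -
  let ?p = "r (\<sigma> t)" let ?k = "chart_at A ?p"
  have p: "?p \<in> topspace X" using has_velocity_topspace[OF v] .
  have k: "?k \<in> A" "?p \<in> fst ?k" using chart_at_in chart_at_dom p by auto
  have "filterlim \<sigma> (nhds (\<sigma> t)) (nhds t)"
    using DERIV_isCont[OF \<sigma>] by (simp add: isCont_def tendsto_at_iff_tendsto_nhds)
  then have ev: "\<forall>\<^sub>F s in nhds t. P (\<sigma> s)" if "\<forall>\<^sub>F s in nhds (\<sigma> t). P s" for P
    using that by (rule eventually_compose_filterlim[rotated])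
  have lim: "limitin X (\<lambda>s. r (\<sigma> s)) ?p (at t)"
    by (rule limitin_atI[of "\<lambda>s. r (\<sigma> s)", OF p]) (rule ev[OF limitin_at_nhds[OF
        has_velocity_limitin[OF v]]])
  have \<sigma>v: "(\<sigma> has_vector_derivative \<sigma>') (at t)"
    using \<sigma> by (simp add: has_real_derivative_iff_has_vector_derivative)
  have "((\<lambda>s. snd ?k (r s)) has_vector_derivative v) (at (\<sigma> t))"
    using v by (simp add: has_velocity_def)
  from vector_diff_chain_at[OF \<sigma>v this]
  show vel: "has_velocity X A (\<lambda>s. r (\<sigma> s)) (\<sigma>' *\<^sub>R v) t"
    using lim by (simp add: has_velocity_def o_def)
  obtain V' where V': "((\<lambda>s. tangent_coord A ?k (r s) (u s)) has_vector_derivative V') (at (\<sigma> t))"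
    and a: "a = V' + (\<Sum>b\<in>Basis. (u (\<sigma> t) \<bullet> b) *\<^sub>R nabla ?p v (coord_field A ?k b))"
    using u has_velocity_unique[OF v] unfolding has_covariant_derivative_def Let_def by metis
  have \<rho>v: "(\<rho> has_vector_derivative \<rho>') (at t)"
    using \<rho> by (simp add: has_real_derivative_iff_has_vector_derivative)
  have "((\<lambda>s. \<rho> s *\<^sub>R tangent_coord A ?k (r (\<sigma> s)) (u (\<sigma> s))) has_vector_derivative
      (\<rho> t *\<^sub>R (\<sigma>' *\<^sub>R V') + \<rho>' *\<^sub>R u (\<sigma> t))) (at t)"
    using bounded_bilinear.has_vector_derivative[OF bounded_bilinear_scaleR \<rho>v
        vector_diff_chain_at[OF \<sigma>v V']]
    by (simp add: o_def tangent_coord_chart_at[OF k])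
  moreover have "\<forall>\<^sub>F s in nhds t. \<rho> s *\<^sub>R tangent_coord A ?k (r (\<sigma> s)) (u (\<sigma> s)) =
      tangent_coord A ?k (r (\<sigma> s)) (\<rho> s *\<^sub>R u (\<sigma> s))"
    using ev[OF limitin_at_nhds[OF has_velocity_limitin[OF v] chart_openin[OF k(1)] k(2)]]
    by eventually_elim (simp add: linear_cmul[OF tangent_coord_linear] k(1))
  ultimately have "((\<lambda>s. tangent_coord A ?k (r (\<sigma> s)) (\<rho> s *\<^sub>R u (\<sigma> s))) has_vector_derivative
      (\<rho> t *\<^sub>R (\<sigma>' *\<^sub>R V') + \<rho>' *\<^sub>R u (\<sigma> t))) (at t)"
    by (rule has_vector_derivative_eventually_cong)
  \<comment> \<open>Linearity of \<open>nabla\<close> in the direction pulls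
    \<open>\<sigma>'\<close> out of the connection term.\<close>
  moreover have "\<rho>' *\<^sub>R u (\<sigma> t) + (\<rho> t * \<sigma>') *\<^sub>R a = (\<rho> t *\<^sub>R (\<sigma>' *\<^sub>R V') + \<rho>' *\<^sub>R u (\<sigma> t)) +
      (\<Sum>b\<in>Basis. ((\<rho> t *\<^sub>R u (\<sigma> t)) \<bullet> b) *\<^sub>R nabla ?p (\<sigma>' *\<^sub>R v) (coord_field A ?k b))"
    by (simp add: a linear_cmul[OF nabla_coord_field_linear[OF k]] scaleR_add_right scaleR_sum_right
        algebra_simps)
  ultimately show "has_covariant_derivative X A nabla (\<lambda>s. r (\<sigma> s)) (\<lambda>s. \<rho> s *\<^sub>R u (\<sigma> s))
      (\<rho>' *\<^sub>R u (\<sigma> t) + (\<rho> t * \<sigma>') *\<^sub>R a) t"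
    unfolding has_covariant_derivative_def Let_def using vel by blast
qed


end

section \<open>The isokinetic flow\<close>

context riemannian
begin

abbreviation gram :: "('a, 'e) chart \<Rightarrow> 'e \<Rightarrow> 'e \<Rightarrow> 'e \<Rightarrow> real" where
  "gram c x u v \<equiv> g (chart_inv c x) (coord_field A c u (chart_inv c x)) (coord_field A c v
      (chart_inv c x))"

lemma chart_inv_dom: "x \<in> snd c ` fst c \<Longrightarrow> chart_inv c x \<in> fst c"
  by (rule inv_into_into)

lemma chart_chart_inv: "x \<in> snd c ` fst c \<Longrightarrow> snd c (chart_inv c x) = x"
  by (rule f_inv_into_f)

lemma chart_inv_topspace: "c \<in> A \<Longrightarrow> x \<in> snd c ` fst c \<Longrightarrow> chart_inv c x \<in> topspace X"
  using chart_subset[of c] chart_inv_dom[of x c] by blast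

lemma gram_expansion:
  assumes "c \<in> A" "x \<in> snd c ` fst c"
  shows "gram c x u v = (\<Sum>a\<in>Basis. \<Sum>b\<in>Basis. (u \<bullet> a) * (v \<bullet> b) * gram c x a b)"
  using metric_expansion[OF chart_inv_topspace[OF assms] assms(1) chart_inv_dom[OF assms(2)],
      of "coord_field A c u (chart_inv c x)" "coord_field A c v (chart_inv c x)"]
  by (simp add: tangent_coord_coord_field_same[OF assms(1) chart_inv_dom[OF assms(2)]])

lemma gram_pos:
  assumes "c \<in> A" "x \<in> snd c ` fst c" "v \<noteq> 0"
  shows "gram c x v v > 0"
proof (rule metric_pos[OF chart_inv_topspace[OF assms(1,2)]])
  note l = tangent_coord_linear[OF assms(1) chart_inv_dom[OF assms(2)]]
  have "tangent_coord A c (chart_inv c x) (coord_field A c v (chart_inv c x)) \<noteq> 0"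
    using tangent_coord_coord_field_same[OF assms(1) chart_inv_dom[OF assms(2)]] assms(3) by simp
  then show "coord_field A c v (chart_inv c x) \<noteq> 0" using linear_0[OF l] by metis
qed

lemma gram_continuous:
  assumes "c \<in> A"
  shows "continuous_on (snd c ` fst c \<times> UNIV) (\<lambda>z. gram c (fst z) (snd z) (snd z))"
proof -
  have gab: "continuous_on (snd c ` fst c \<times> UNIV) (\<lambda>z::'e \<times> 'e. gram c (fst z) a b)" for a b
    by (rule continuous_on_compose2[OF smooth_on_continuous_on[OF metric_smooth[OF assms]]
        continuous_on_fst[OF continuous_on_id]]) auto
  have "continuous_on (snd c ` fst c \<times> UNIV)
      (\<lambda>z::'e \<times> 'e. \<Sum>a\<in>Basis. \<Sum>b\<in>Basis. (snd z \<bullet> a) * (snd z \<bullet> b) * gram c (fst z) a b)"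
    by (intro continuous_on_sum continuous_on_mult gab continuous_intros)
  then show ?thesis
    by (rule continuous_on_eq) (use gram_expansion[OF assms] in \<open>auto simp: mem_Times_iff\<close>)
qed

text \<open>On the compact set of pairs of a point of \<open>K\<close> and a unit vector the metric
  attains a positive minimum; homogeneity of degree two extends the estimate to all vectors.\<close>

lemma gram_lower_bound:
  assumes "c \<in> A" "compact K" "K \<subseteq> snd c ` fst c"
  obtains m where "m > 0" "\<And>x y. x \<in> K \<Longrightarrow> m * (norm y)\<^sup>2 \<le> gram c x y y"
proof (cases "K = {}")
  case True
  then show ?thesis using that[of 1] by simp
next
  case False
  let ?S = "K \<times> sphere (0::'e) 1"
  have "compact ?S" using assms by (intro compact_Times) auto
  moreover have "?S \<noteq> {}" using False vector_choose_size[of 1] by auto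
  moreover have "continuous_on ?S (\<lambda>z. gram c (fst z) (snd z) (snd z))"
    using gram_continuous[OF assms(1)] by (rule continuous_on_subset) (use assms in auto)
  ultimately obtain z where z: "z \<in> ?S" "\<And>w. w \<in> ?S \<Longrightarrow> gram c (fst z) (snd z) (snd z) \<le>
      gram c (fst w) (snd w) (snd w)"
    using continuous_attains_inf[of ?S] by blast
  define m where "m = gram c (fst z) (snd z) (snd z)"
  have "fst z \<in> snd c ` fst c" "norm (snd z) = 1" using z(1) assms(3) by (auto simp: mem_Times_iff)
  then have "m > 0" unfolding m_def by (intro gram_pos assms) auto
  moreover have "m * (norm y)\<^sup>2 \<le> gram c x y y" if x: "x \<in> K" for x y
  proof (cases "y = 0")
    case True
    then show ?thesis using gram_expansion[OF assms(1), of x 0 0] x assms(3) by auto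
  next
    case False
    define u where "u = (1 / norm y) *\<^sub>R y"
    have u: "norm u = 1" "y = norm y *\<^sub>R u" using False by (simp_all add: u_def)
    have x': "x \<in> snd c ` fst c" using x assms(3) by auto
    have "m \<le> gram c x u u" using z(2)[of "(x, u)"] x u(1) by (simp add: m_def)
    from mult_right_mono[OF this, of "(norm y)\<^sup>2"]
    have "m * (norm y)\<^sup>2 \<le> (norm y)\<^sup>2 * gram c x u u" by (simp add: mult.commute)
    also have "\<dots> = (\<Sum>a\<in>Basis. \<Sum>b\<in>Basis. ((norm y *\<^sub>R u) \<bullet> a) * ((norm y *\<^sub>R u) \<bullet> b) * gram c x a b)"
      unfolding gram_expansion[OF assms(1) x', of u u]
      by (simp add: sum_distrib_left power2_eq_square ac_simps)
    also have "\<dots> = gram c x y y"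
      unfolding gram_expansion[OF assms(1) x', of y y] u(2)[symmetric] ..
    finally show ?thesis .
  qed
  ultimately show ?thesis using that by blast
qed

abbreviation sphere_bundle :: "('a \<times> 'e) topology" where
  "sphere_bundle \<equiv> subtopology (tangent_topology X A) (unit_tangent_bundle X g)"

lemma topspace_sphere_bundle: "topspace sphere_bundle = unit_tangent_bundle X g"
  by (auto simp: topspace_tangent unit_tangent_bundle_def)

text \<open>Over a closed coordinate ball the unit vectors form a closed set in coordinates, and the
  lower bound of the metric makes it bounded, hence compact. Finitely many balls cover the base, and
  the images of these compact sets fill the unit tangent bundle.\<close>

lemma compact_sphere_bundle:
  assumes "compact_space X"
  shows "compact_space sphere_bundle"
proof -
  have "\<exists>c r. c \<in> A \<and> p \<in> fst c \<and> r > 0 \<and> cball (snd c p) r \<subseteq> snd c ` fst c" if p: "p \<in> topspace X"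
      for p
  proof -
    obtain c where c: "c \<in> A" "p \<in> fst c" using p topspace_charts by blast
    then show ?thesis using chart_image_open[OF c(1)] open_contains_cball by blast
  qed
  then obtain c r where c: "\<And>p. p \<in> topspace X \<Longrightarrow>
      c p \<in> A \<and> p \<in> fst (c p) \<and> r p > 0 \<and> cball (snd (c p) p) (r p) \<subseteq> snd (c p) ` fst (c p)"
    by metis
  \<comment> \<open>Open coordinate balls are used for the covering argument; the closed balls of
    the same radius give the compact sets \<open>S p\<close> of unit vectors.\<close>
  define N where "N p = {q \<in> fst (c p). snd (c p) q \<in> ball (snd (c p) p) (r p)}" for p
  define S where "S p = {z. fst z \<in> cball (snd (c p) p) (r p) \<and> gram (c p) (fst z) (snd z) (snd z) =
      1}" for p
  have N: "openin X (N p)" "p \<in> N p" if "p \<in> topspace X" for p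
    unfolding N_def using c[OF that] chart_open_vimage[of "c p" "ball (snd (c p) p) (r p)"] by auto
  have S: "compactin (tangent_topology X A) (bundle_chart_inv (c p) ` S p)" if p: "p \<in> topspace X" for p
  proof -
    let ?K = "cball (snd (c p) p) (r p)"
    have K: "c p \<in> A" "?K \<subseteq> snd (c p) ` fst (c p)" using c[OF p] by auto
    obtain m where m: "m > 0" "\<And>x y. x \<in> ?K \<Longrightarrow> m * (norm y)\<^sup>2 \<le> gram (c p) x y y"
      using gram_lower_bound[OF K(1) compact_cball K(2)] by blast
    \<comment> \<open>With n the norm of \<open>y\<close>, the bound follows from 2 n <= n^2 + 1 and
      n^2 <= 1 / m; it is generous but avoids a square root.\<close>
    have "norm y \<le> 1 / m + 1" if "(x, y) \<in> S p" for x y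
    proof -
      have "m * (norm y)\<^sup>2 \<le> 1" using m(2)[of x y] that by (simp add: S_def)
      then have "(norm y)\<^sup>2 \<le> 1 / m" using m(1) by (simp add: field_simps)
      moreover have "2 * norm y \<le> (norm y)\<^sup>2 + 1" using zero_le_power2[of "norm y - 1"]
          by (simp add: power2_diff)
      moreover have "1 / m > 0" using m(1) by simp
      ultimately show ?thesis using norm_ge_zero[of y] by linarith
    qed
    then have "S p \<subseteq> ?K \<times> cball 0 (1 / m + 1)" by (auto simp: S_def)
    then have "bounded (S p)" using bounded_subset bounded_Times bounded_cball by metis
    moreover have "S p = {z \<in> ?K \<times> UNIV. gram (c p) (fst z) (snd z) (snd z) = 1}"
      by (auto simp: S_def mem_Times_iff)
    moreover have "closed {z \<in> ?K \<times> UNIV. gram (c p) (fst z) (snd z) (snd z) = 1}"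
      by (rule continuous_closed_preimage_constant[OF
          continuous_on_subset[OF gram_continuous[OF K(1)] Sigma_mono[OF K(2) subset_refl]]
          closed_Times[OF closed_cball closed_UNIV]])
    ultimately have "compact (S p)" by (simp add: compact_eq_bounded_closed)
    moreover have "S p \<subseteq> snd (c p) ` fst (c p) \<times> UNIV" using K(2) by (auto simp: S_def)
    ultimately have "compactin (top_of_set (snd (c p) ` fst (c p) \<times> UNIV)) (S p)"
      by (simp add: compactin_subtopology)
    then show ?thesis by (rule image_compactin[OF _ bundle_chart_inv_continuous[OF K(1)]])
  qed
  have "compactin X (topspace X)" using assms by (simp add: compact_space_def)
  moreover have "openin X U" if "U \<in> N ` topspace X" for U using that N by blast
  moreover have "topspace X \<subseteq> \<Union>(N ` topspace X)" using N by blast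
  ultimately have "\<exists>F. finite F \<and> F \<subseteq> N ` topspace X \<and> topspace X \<subseteq> \<Union>F"
    using compactinD[of X "topspace X" "N ` topspace X"] by simp
  then obtain P where P: "finite P" "P \<subseteq> topspace X" "topspace X \<subseteq> \<Union>(N ` P)"
    by (metis finite_subset_image)
  have "compactin (tangent_topology X A) (\<Union>p\<in>P. bundle_chart_inv (c p) ` S p)"
    by (rule compactin_Union) (use P S in auto)
  moreover have "(\<Union>p\<in>P. bundle_chart_inv (c p) ` S p) = unit_tangent_bundle X g"
  proof (intro subset_antisym subsetI)
    fix z assume "z \<in> (\<Union>p\<in>P. bundle_chart_inv (c p) ` S p)"
    then obtain p w where p: "p \<in> P" "w \<in> S p" "z = bundle_chart_inv (c p) w" by blast
    have "p \<in> topspace X" using p P(2) by blast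
    moreover have "fst w \<in> cball (snd (c p) p) (r p)" using p(2) by (simp add: S_def)
    ultimately have "c p \<in> A" "fst w \<in> snd (c p) ` fst (c p)" using c subsetD by blast+
    then show "z \<in> unit_tangent_bundle X g"
      using p chart_inv_topspace[of "c p" "fst w"] by (simp add: unit_tangent_bundle_def S_def)
  next
    fix z assume z: "z \<in> unit_tangent_bundle X g"
    then have "fst z \<in> topspace X" by (auto simp: unit_tangent_bundle_def)
    then obtain p where p: "p \<in> P" "fst z \<in> N p" using P(3) by blast
    then have cp: "c p \<in> A" "fst z \<in> fst (c p)" using c P(2) by (auto simp: N_def)
    then have S: "bundle_chart (c p) z \<in> S p"
      using z p(2) by (auto simp: S_def N_def unit_tangent_bundle_def chart_inv_chart
          coord_field_tangent_coord)
    have "z \<in> bundle_chart_inv (c p) ` S p"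
      using imageI[OF S, of "bundle_chart_inv (c p)"] unfolding bundle_chart_inv_bundle_chart[OF cp] .
    with p(1) show "z \<in> (\<Union>p\<in>P. bundle_chart_inv (c p) ` S p)" by (rule UN_I)
  qed
  ultimately show ?thesis by (simp add: compact_space_subtopology)
qed

section \<open>The equation of motion in coordinates\<close>

definition locally_lipschitz_field :: "('a \<Rightarrow> 'e) \<Rightarrow> bool" where
  "locally_lipschitz_field F \<longleftrightarrow> (\<forall>c\<in>A. \<forall>x\<in>snd c ` fst c. \<exists>r>0. cball x r \<subseteq> snd c ` fst c \<and>
     lipschitz (cball x r) (\<lambda>x. tangent_coord A c (chart_inv c x) (F (chart_inv c x))))"

text \<open>On unit vectors this is the part of \<open>F\<close> orthogonal to \<open>v\<close>. For
  general \<open>v\<close> its inner product with \<open>v\<close> is <F, v> (1 - |v|^2).\<close>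

definition thermostat :: "('a \<Rightarrow> 'e) \<Rightarrow> 'a \<Rightarrow> 'e \<Rightarrow> 'e" where
  "thermostat F p v = F p - g p (F p) v *\<^sub>R v"

text \<open>First-order form of the equation in a bundle chart. The sum is the Christoffel term; it
  is quadratic in the fibre coordinate \<open>snd z\<close>, which enters as coefficient and through
  the direction \<open>v\<close>.\<close>

definition spray :: "('a, 'e) chart \<Rightarrow> ('a \<Rightarrow> 'e) \<Rightarrow> 'e \<times> 'e \<Rightarrow> 'e \<times> 'e" where
  "spray c F z = (let p = chart_inv c (fst z); v = coord_field A c (snd z) p in
     (snd z, tangent_coord A c p (thermostat F p v) -
       (\<Sum>b\<in>Basis. (snd z \<bullet> b) *\<^sub>R tangent_coord A c p (nabla p v (coord_field A c b)))))"

text \<open>These components are the Christoffel symbols of the chart; \<open>nabla_smooth\<close>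
  applies to pairs of coordinate fields.\<close>

lemma christoffel_smooth:
  assumes "c \<in> A"
  shows "smooth_on (snd c ` fst c) (\<lambda>x. tangent_coord A c (chart_inv c x)
    (nabla (chart_inv c x) (coord_field A c a (chart_inv c x)) (coord_field A c b)))"
proof -
  have "smooth_field A (fst c) (\<lambda>p. nabla p (coord_field A c a p) (coord_field A c b))"
    using nabla_smooth[OF chart_openin coord_field_smooth coord_field_smooth] assms by blast
  from this[unfolded smooth_field_def, THEN bspec, OF assms] show ?thesis by simp
qed

text \<open>In the fibre coordinate the field is polynomial, with coefficients that are Lipschitz in
  the base coordinate: smooth ones from metric and connection, and those of \<open>F\<close>.
  Products stay Lipschitz because the domain, a product of closed balls, is compact; its convexity
  serves the Picard theorem. The last function is <F, v>, whose continuity along solutions matters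
  for the speed and for the time change of geodesics.\<close>

lemma spray_lipschitz:
  assumes F: "locally_lipschitz_field F" and c: "c \<in> A" and x0: "x0 \<in> snd c ` fst c"
  obtains K where "compact K" "convex K" "(x0, y0) \<in> interior K" "K \<subseteq> snd c ` fst c \<times> UNIV"
    "lipschitz K (spray c F)"
    "lipschitz K (\<lambda>z. let p = chart_inv c (fst z) in g p (F p) (coord_field A c (snd z) p))"
proof -
  let ?F = "\<lambda>x. tangent_coord A c (chart_inv c x) (F (chart_inv c x))"
  obtain r where r: "r > 0" "cball x0 r \<subseteq> snd c ` fst c" "lipschitz (cball x0 r) ?F"
    using F c x0 unfolding locally_lipschitz_field_def by blast
  define K where "K = cball x0 r \<times> cball y0 r"
  have K: "compact K" "convex K" by (auto simp: K_def intro: compact_Times convex_Times)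
  have "ball x0 r \<times> ball y0 r \<subseteq> interior K"
    by (rule interior_maximal) (auto simp: K_def open_Times)
  then have z0: "(x0, y0) \<in> interior K" using r(1) by auto
  have sub: "K \<subseteq> snd c ` fst c \<times> UNIV" using r(2) by (auto simp: K_def)
  have lfst: "lipschitz K (\<lambda>z. h (fst z))" if "lipschitz (cball x0 r) h" for h :: "'e \<Rightarrow>
      'f::metric_space"
  proof (rule lipschitz_compose[where g = fst])
    show "lipschitz K fst" by (rule lipschitz_bounded_linear[OF bounded_linear_fst])
    show "lipschitz (fst ` K) h" using that by (rule lipschitz_subset) (auto simp: K_def)
  qed
  have lsnd: "lipschitz K snd" by (rule lipschitz_bounded_linear[OF bounded_linear_snd])
  have sndb: "lipschitz K (\<lambda>z. snd z \<bullet> b)" for b :: 'e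
    by (rule lipschitz_bounded_linear) (intro bounded_linear_intros)
  have Fb: "lipschitz K (\<lambda>z. ?F (fst z) \<bullet> b)" for b
    by (rule lfst, rule lipschitz_compose[OF r(3)]) (rule lipschitz_bounded_linear[OF
        bounded_linear_inner_left])
  have gab: "lipschitz K (\<lambda>z. gram c (fst z) a b)" for a b
    by (rule lfst[OF smooth_on_lipschitz[OF metric_smooth[OF c] chart_image_open[OF c] compact_cball
        convex_cball r(2)]])
  let ?C = "\<lambda>a b x. tangent_coord A c (chart_inv c x)
    (nabla (chart_inv c x) (coord_field A c a (chart_inv c x)) (coord_field A c b))"
  have Cab: "lipschitz K (\<lambda>z. ?C a b (fst z))" for a b
    by (rule lfst[OF smooth_on_lipschitz[OF christoffel_smooth[OF c] chart_image_open[OF c]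
        compact_cball convex_cball r(2)]])
  let ?G = "\<lambda>z. \<Sum>a\<in>Basis. \<Sum>b\<in>Basis. (?F (fst z) \<bullet> a) * (snd z \<bullet> b) * gram c (fst z) a b"
  have G: "lipschitz K ?G"
    by (intro lipschitz_sum lipschitz_mult Fb sndb gab K)
  have dom: "chart_inv c (fst z) \<in> fst c" "fst z \<in> snd c ` fst c" if "z \<in> K" for z
  proof -
    show "fst z \<in> snd c ` fst c" using that sub by auto
    then show "chart_inv c (fst z) \<in> fst c" by (rule chart_inv_dom)
  qed
  have Geq: "g (chart_inv c (fst z)) (F (chart_inv c (fst z))) (coord_field A c (snd z) (chart_inv c
      (fst z))) = ?G z"
    if "z \<in> K" for z
    using metric_expansion[OF chart_inv_topspace[OF c dom(2)[OF that]] c dom(1)[OF that],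
        of "F (chart_inv c (fst z))" "coord_field A c (snd z) (chart_inv c (fst z))"]
    by (simp add: tangent_coord_coord_field_same[OF c dom(1)[OF that]])
  let ?s = "\<lambda>z. (snd z, ?F (fst z) - ?G z *\<^sub>R snd z -
      (\<Sum>b\<in>Basis. (snd z \<bullet> b) *\<^sub>R (\<Sum>a\<in>Basis. (snd z \<bullet> a) *\<^sub>R ?C a b (fst z))))"
  have s: "lipschitz K ?s"
    by (intro lipschitz_Pair lsnd lipschitz_diff lfst[OF r(3)] lipschitz_scaleR G lipschitz_sum sndb
        Cab K)
  have seq: "spray c F z = ?s z" if z: "z \<in> K" for z
  proof -
    let ?p = "chart_inv c (fst z)"
    note l = tangent_coord_linear[OF c dom(1)[OF z]]
    have "tangent_coord A c ?p (nabla ?p (coord_field A c (snd z) ?p) (coord_field A c b)) =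
        (\<Sum>a\<in>Basis. (snd z \<bullet> a) *\<^sub>R ?C a b (fst z))" for b
      by (rule linear_Basis_expansion)
        (intro linear_compose[OF linear_compose[OF coord_field_linear[OF c dom(1)[OF z]]
            nabla_coord_field_linear[OF c dom(1)[OF z]]] l, unfolded o_def])
    then show ?thesis
      unfolding spray_def Let_def thermostat_def Geq[OF z]
      by (simp add: linear_diff[OF l] linear_cmul[OF l] tangent_coord_coord_field_same[OF c
          dom(1)[OF z]])
  qed
  show ?thesis
  proof (rule that[OF K z0 sub])
    show "lipschitz K (spray c F)" by (rule lipschitz_cong[OF s seq[symmetric]])
    show "lipschitz K (\<lambda>z. let p = chart_inv c (fst z) in g p (F p) (coord_field A c (snd z) p))"
      unfolding Let_def by (rule lipschitz_cong[OF G Geq[symmetric]])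
  qed
qed

section \<open>Solutions in the tangent bundle and in its charts\<close>

definition thermostat_equation :: "('a \<Rightarrow> 'e) \<Rightarrow> (real \<Rightarrow> 'a \<times> 'e) \<Rightarrow> real \<Rightarrow> bool" where
  "thermostat_equation F \<gamma> t \<longleftrightarrow>
     has_velocity X A (\<lambda>s. fst (\<gamma> s)) (snd (\<gamma> t)) t \<and>
     has_covariant_derivative X A nabla (\<lambda>s. fst (\<gamma> s)) (\<lambda>s. snd (\<gamma> s))
       (thermostat F (fst (\<gamma> t)) (snd (\<gamma> t))) t"

text \<open>The covariant derivative differs from the derivative of the components by the
  Christoffel sum, and solving for the latter gives the second component of \<open>spray\<close>.
  The limit clause remains on the right because coordinates outside the chart domain carry no
  information.\<close>

lemma thermostat_equation_chart:
  assumes c: "c \<in> A" and p: "fst (\<gamma> t) \<in> fst c"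
  shows "thermostat_equation F \<gamma> t \<longleftrightarrow> limitin X (\<lambda>s. fst (\<gamma> s)) (fst (\<gamma> t)) (at t) \<and>
    ((\<lambda>s. bundle_chart c (\<gamma> s)) has_vector_derivative spray c F (bundle_chart c (\<gamma> t))) (at t)"
proof -
  let ?p = "fst (\<gamma> t)" let ?v = "snd (\<gamma> t)" let ?a = "thermostat F ?p ?v"
  let ?y = "tangent_coord A c ?p ?v"
  let ?N = "\<Sum>b\<in>Basis. (?y \<bullet> b) *\<^sub>R nabla ?p ?v (coord_field A c b)"
  let ?V = "\<lambda>s. tangent_coord A c (fst (\<gamma> s)) (snd (\<gamma> s))"
  let ?x = "\<lambda>s. snd c (fst (\<gamma> s))"
  note l = tangent_coord_linear[OF c p]
  have spray: "spray c F (bundle_chart c (\<gamma> t)) = (?y, tangent_coord A c ?p (?a - ?N))"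
    using c p by (simp add: spray_def Let_def chart_inv_chart coord_field_tangent_coord
        linear_diff[OF l] linear_sum[OF l] linear_cmul[OF l] o_def)
  have vel: "has_velocity X A (\<lambda>s. fst (\<gamma> s)) ?v t \<longleftrightarrow> limitin X (\<lambda>s. fst (\<gamma> s)) ?p (at t) \<and>
      (?x has_vector_derivative ?y) (at t)"
    using has_velocity_chart[where q = "\<lambda>s. fst (\<gamma> s)" and t = t, OF c p] .
  have cov: "has_covariant_derivative X A nabla (\<lambda>s. fst (\<gamma> s)) (\<lambda>s. snd (\<gamma> s)) ?a t \<longleftrightarrow>
      (?V has_vector_derivative tangent_coord A c ?p (?a - ?N)) (at t)"
    if "has_velocity X A (\<lambda>s. fst (\<gamma> s)) ?v t"
  proof -
    have "?a = coord_field A c V' ?p + ?N \<longleftrightarrow> V' = tangent_coord A c ?p (?a - ?N)" for V'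
      using tangent_coord_coord_field_same[OF c p, of V'] coord_field_tangent_coord[OF c p, of "?a -
          ?N"]
      by (auto simp: algebra_simps)
    then show ?thesis
      using has_covariant_derivative_chart[where q = "\<lambda>s. fst (\<gamma> s)" and t = t, OF c p that]
      unfolding covariant_in_chart_def by simp
  qed
  have "((\<lambda>s. bundle_chart c (\<gamma> s)) has_vector_derivative spray c F (bundle_chart c (\<gamma> t))) (at t) \<longleftrightarrow>
      (?x has_vector_derivative ?y) (at t) \<and> (?V has_vector_derivative tangent_coord A c ?p (?a -
          ?N)) (at t)"
  proof
    assume "((\<lambda>s. bundle_chart c (\<gamma> s)) has_vector_derivative spray c F (bundle_chart c (\<gamma> t))) (at t)"
    from bounded_linear.has_vector_derivative[OF bounded_linear_fst this]
      bounded_linear.has_vector_derivative[OF bounded_linear_snd this]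
    show "(?x has_vector_derivative ?y) (at t) \<and> (?V has_vector_derivative tangent_coord A c ?p
        (?a - ?N)) (at t)"
      by (simp add: spray)
  next
    assume "(?x has_vector_derivative ?y) (at t) \<and> (?V has_vector_derivative tangent_coord A c ?p
        (?a - ?N)) (at t)"
    then show "((\<lambda>s. bundle_chart c (\<gamma> s)) has_vector_derivative spray c F (bundle_chart c (\<gamma> t)))
        (at t)"
      unfolding spray by (intro has_vector_derivative_Pair) auto
  qed
  then show ?thesis
    unfolding thermostat_equation_def using vel cov by blast
qed

text \<open>The function n = |v|^2 - 1 satisfies the homogeneous linear equation n' = - 2 <F, v> n,
  so it vanishes identically once it vanishes at \<open>a\<close>.\<close>

lemma thermostat_preserves_speed:
  assumes J: "open_interval J" and \<gamma>: "\<And>t. t \<in> J \<Longrightarrow> thermostat_equation F \<gamma> t"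
    and h: "continuous_on J (\<lambda>s. g (fst (\<gamma> s)) (F (fst (\<gamma> s))) (snd (\<gamma> s)))"
    and a: "a \<in> J" "\<gamma> a \<in> unit_tangent_bundle X g" and t: "t \<in> J"
  shows "\<gamma> t \<in> unit_tangent_bundle X g"
proof -
  let ?n = "\<lambda>s. g (fst (\<gamma> s)) (snd (\<gamma> s)) (snd (\<gamma> s)) - 1"
  let ?h = "\<lambda>s. - 2 * g (fst (\<gamma> s)) (F (fst (\<gamma> s))) (snd (\<gamma> s))"
  have top: "fst (\<gamma> s) \<in> topspace X" if "s \<in> J" for s
    using \<gamma>[OF that] has_velocity_topspace[where q = "\<lambda>s. fst (\<gamma> s)" and t = s]
        unfolding thermostat_equation_def by blast
  have "?n t = 0"
  proof (rule linear_ode_zero[OF J _ _ a(1) _ t])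
    show "continuous_on J ?h" by (intro continuous_intros h)
    show "?n a = 0" using a(2) by (auto simp: unit_tangent_bundle_def)
    fix s assume s: "s \<in> J"
    have l: "linear (\<lambda>u. g (fst (\<gamma> s)) u (snd (\<gamma> s)))"
      using metric_bilinear[OF top[OF s]] unfolding bilinear_def by auto
    have "((\<lambda>s. g (fst (\<gamma> s)) (snd (\<gamma> s)) (snd (\<gamma> s))) has_real_derivative
        2 * g (fst (\<gamma> s)) (thermostat F (fst (\<gamma> s)) (snd (\<gamma> s))) (snd (\<gamma> s))) (at s)"
      using \<gamma>[OF s] metric_along_curve[where q = "\<lambda>s. fst (\<gamma> s)" and V = "\<lambda>s. snd (\<gamma> s)" and t = s]
      unfolding thermostat_equation_def by blast
    moreover have "2 * g (fst (\<gamma> s)) (thermostat F (fst (\<gamma> s)) (snd (\<gamma> s))) (snd (\<gamma> s)) = ?h s * ?n s"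
      by (simp add: thermostat_def linear_diff[OF l] linear_cmul[OF l] algebra_simps)
    ultimately show "(?n has_real_derivative ?h s * ?n s) (at s)"
      using DERIV_diff[OF _ DERIV_const] by fastforce
  qed
  then show ?thesis using top[OF t] by (cases "\<gamma> t") (simp add: unit_tangent_bundle_def)
qed

text \<open>Unit length is demanded near \<open>t\<close> and not only at \<open>t\<close>:
  convergence in the subspace topology, which \<open>D_cont\<close> requires, needs the neighbouring
  values to lie in the subspace.\<close>

definition sphere_equation :: "('a \<Rightarrow> 'e) \<Rightarrow> (real \<Rightarrow> 'a \<times> 'e) \<Rightarrow> real \<Rightarrow> bool" where
  "sphere_equation F \<gamma> t \<longleftrightarrow>
     thermostat_equation F \<gamma> t \<and> (\<forall>\<^sub>F s in nhds t. \<gamma> s \<in> unit_tangent_bundle X g)"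

text \<open>Differentiability gives convergence of the bundle coordinates, and the continuous
  inverse chart transports it to the bundle; the limit of the base curve ensures that the curve lies
  over the chart domain near \<open>t\<close>.\<close>

lemma thermostat_limitin:
  assumes "thermostat_equation F \<gamma> t"
  shows "limitin (tangent_topology X A) \<gamma> (\<gamma> t) (at t)"
proof -
  have lim: "limitin X (\<lambda>s. fst (\<gamma> s)) (fst (\<gamma> t)) (at t)"
    using assms has_velocity_limitin[where q = "\<lambda>s. fst (\<gamma> s)"] unfolding thermostat_equation_def
        by blast
  then have "fst (\<gamma> t) \<in> topspace X" using limitin_topspace by metis
  then obtain c where c: "c \<in> A" "fst (\<gamma> t) \<in> fst c" using topspace_charts by blast
  have cont: "((\<lambda>s. bundle_chart c (\<gamma> s)) \<longlongrightarrow> bundle_chart c (\<gamma> t)) (nhds t)"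
  proof -
    have "isCont (\<lambda>s. bundle_chart c (\<gamma> s)) t"
      using assms thermostat_equation_chart[where \<gamma> = \<gamma>
          and t = t, OF c] has_vector_derivative_continuous by blast
    then show ?thesis
      using tendsto_at_iff_tendsto_nhds[of "\<lambda>s. bundle_chart c (\<gamma> s)" t] by (simp add: isCont_def)
  qed
  have near: "\<forall>\<^sub>F s in nhds t. fst (\<gamma> s) \<in> fst c"
    using limitin_at_nhds[where q = "\<lambda>s. fst (\<gamma> s)", OF lim chart_openin[OF c(1)] c(2)] .
  show ?thesis
  proof (rule limitin_atI)
    show "\<gamma> t \<in> topspace (tangent_topology X A)"
      using \<open>fst (\<gamma> t) \<in> topspace X\<close> by (simp add: topspace_tangent mem_Times_iff)
    fix U assume U: "openin (tangent_topology X A) U" "\<gamma> t \<in> U"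
    let ?O = "{z \<in> snd c ` fst c \<times> UNIV. bundle_chart_inv c z \<in> U}"
    have "openin (top_of_set (snd c ` fst c \<times> UNIV)) ?O"
      using openin_continuous_map_preimage[OF bundle_chart_inv_continuous[OF c(1)] U(1)] by simp
    then have "open ?O"
      using openin_open_trans[OF _ open_Times[OF chart_image_open[OF c(1)] open_UNIV]] by blast
    moreover have "bundle_chart c (\<gamma> t) \<in> ?O"
      using U(2) c bundle_chart_inv_bundle_chart[OF c] by (simp add: mem_Times_iff)
    ultimately have "\<forall>\<^sub>F s in nhds t. bundle_chart c (\<gamma> s) \<in> ?O"
      using cont topological_tendstoD by blast
    with near show "\<forall>\<^sub>F s in nhds t. \<gamma> s \<in> U"
    proof eventually_elim
      case (elim s)
      then show ?case using bundle_chart_inv_bundle_chart[OF c(1) elim(1)] by simp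
    qed
  qed
qed

lemma thermostat_cong:
  assumes "thermostat_equation F \<gamma> t" "\<forall>\<^sub>F s in nhds t. \<delta> s = \<gamma> s"
  shows "thermostat_equation F \<delta> t"
proof -
  have ev: "\<forall>\<^sub>F s in nhds t. fst (\<gamma> s) = fst (\<delta> s)" "\<forall>\<^sub>F s in nhds t. snd (\<gamma> s) = snd (\<delta> s)"
    using assms(2) by (eventually_elim, simp)+
  have t: "\<delta> t = \<gamma> t" using assms(2) by (rule eventually_nhds_x_imp_x)
  note \<gamma> = assms(1)[unfolded thermostat_equation_def]
  have "has_velocity X A (\<lambda>s. fst (\<delta> s)) (snd (\<gamma> t)) t"
    by (rule has_velocity_cong[OF conjunct1[OF \<gamma>] ev(1)])
  moreover have "has_covariant_derivative X A nabla (\<lambda>s. fst (\<delta> s)) (\<lambda>s. snd (\<delta> s))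
      (thermostat F (fst (\<gamma> t)) (snd (\<gamma> t))) t"
    by (rule has_covariant_derivative_cong[OF conjunct2[OF \<gamma>] ev])
  ultimately show ?thesis unfolding thermostat_equation_def t by simp
qed

lemma thermostat_shift:
  assumes "thermostat_equation F \<gamma> (s + t)"
  shows "thermostat_equation F (\<lambda>x. \<gamma> (s + x)) t"
proof -
  have d: "((\<lambda>x. s + x) has_real_derivative 1) (at t)" "((\<lambda>x. 1) has_real_derivative 0) (at t)"
    by (auto intro!: derivative_eq_intros)
  note \<gamma> = assms[unfolded thermostat_equation_def]
  show ?thesis
    using reparametrize[where r = "\<lambda>s. fst (\<gamma> s)" and u = "\<lambda>s. snd (\<gamma> s)",
        OF conjunct1[OF \<gamma>] conjunct2[OF \<gamma>] d]
    unfolding thermostat_equation_def by simp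
qed

text \<open>Near \<open>t\<close> both curves lie over one chart and, in coordinates, inside a set
  \<open>K\<close> on which the field is Lipschitz, so uniqueness for ordinary differential
  equations applies on a ball around \<open>t\<close>.\<close>

lemma thermostat_unique:
  assumes F: "locally_lipschitz_field F"
    and \<gamma>: "\<forall>\<^sub>F s in nhds t. thermostat_equation F \<gamma> s"
    and \<delta>: "\<forall>\<^sub>F s in nhds t. thermostat_equation F \<delta> s" and eq: "\<gamma> t = \<delta> t"
  shows "\<forall>\<^sub>F s in nhds t. \<gamma> s = \<delta> s"
proof -
  have \<gamma>t: "thermostat_equation F \<gamma> t" and \<delta>t: "thermostat_equation F \<delta> t"
    using \<gamma> \<delta> by (auto dest: eventually_nhds_x_imp_x)
  note lim = thermostat_limitin[OF \<gamma>t] thermostat_limitin[OF \<delta>t]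
  have "fst (\<gamma> t) \<in> topspace X"
    using limitin_topspace[OF lim(1)] by (simp add: topspace_tangent mem_Times_iff)
  then obtain c where c: "c \<in> A" "fst (\<gamma> t) \<in> fst c" using topspace_charts by blast
  obtain K where "compact K" "convex K" and K0: "bundle_chart c (\<gamma> t) \<in> interior K"
    and "K \<subseteq> snd c ` fst c \<times> UNIV" and K: "lipschitz K (spray c F)"
    "lipschitz K (\<lambda>z. let p = chart_inv c (fst z) in g p (F p) (coord_field A c (snd z) p))"
    by (rule spray_lipschitz[OF F c(1) imageI[OF c(2)]])
  let ?U = "{z. fst z \<in> fst c \<and> bundle_chart c z \<in> interior K}"
  have U: "openin (tangent_topology X A) ?U" "\<gamma> t \<in> ?U"
    using bundle_chart_openin[OF c(1) open_interior] c(2) K0 by auto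
  have "\<forall>\<^sub>F s in nhds t. (thermostat_equation F \<gamma> s \<and> \<gamma> s \<in> ?U) \<and> (thermostat_equation F \<delta> s \<and>
      \<delta> s \<in> ?U)"
    using \<gamma> \<delta> limitin_at_nhds[OF lim(1) U] limitin_at_nhds[OF lim(2) U(1)] U(2) eq
    by (simp add: eventually_conj_iff)
  then obtain O' where O': "open O'" "t \<in> O'"
    "\<And>s. s \<in> O' \<Longrightarrow> (thermostat_equation F \<gamma> s \<and> \<gamma> s \<in> ?U) \<and> (thermostat_equation F \<delta> s \<and> \<delta> s \<in> ?U)"
    unfolding eventually_nhds by blast
  obtain e where e: "e > 0" "ball t e \<subseteq> O'" using O' open_contains_ball by blast
  have "\<gamma> s = \<delta> s" if s: "s \<in> ball t e" for s
  proof -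
    have ode: "bundle_chart c (\<beta> s) \<in> K \<and>
        ((\<lambda>s. bundle_chart c (\<beta> s)) has_vector_derivative spray c F (bundle_chart c (\<beta> s))) (at s)"
      if "thermostat_equation F \<beta> s \<and> \<beta> s \<in> ?U" for \<beta> s
      using that thermostat_equation_chart[where \<gamma> = \<beta> and t = s, OF c(1)] interior_subset by auto
    have "bundle_chart c (\<gamma> s) = bundle_chart c (\<delta> s)"
      by (rule ode_unique[where x = "\<lambda>s. bundle_chart c (\<gamma> s)" and y = "\<lambda>s. bundle_chart c (\<delta> s)"
            and J = "ball t e" and a = t and t = s, OF K(1)])
        (use s e eq O'(3) ode in \<open>auto simp: is_interval_ball_real\<close>)
    moreover have "fst (\<gamma> s) \<in> fst c" "fst (\<delta> s) \<in> fst c" using O'(3)[of s] s e by auto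
    ultimately show ?thesis using bundle_chart_inv_bundle_chart[OF c(1)] by metis
  qed
  then show ?thesis unfolding eventually_nhds using e(1) open_ball centre_in_ball by blast
qed

text \<open>The Picard flow of the spray is transported from coordinates to the bundle. It moves
  vectors of any length near \<open>\<zeta>\<close>; that unit vectors remain unit vectors follows
  from \<open>thermostat_preserves_speed\<close>, not from the construction.\<close>

lemma thermostat_local_existence:
  assumes F: "locally_lipschitz_field F" and \<zeta>: "\<zeta> \<in> unit_tangent_bundle X g"
  shows "\<exists>N \<epsilon> \<phi>. openin sphere_bundle N \<and> \<zeta> \<in> N \<and> \<epsilon> > 0 \<and>
      flow_box sphere_bundle (sphere_equation F) N \<epsilon> \<phi>"
proof -
  have "fst \<zeta> \<in> topspace X" using \<zeta> by (auto simp: unit_tangent_bundle_def)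
  then obtain c where c: "c \<in> A" "fst \<zeta> \<in> fst c" using topspace_charts by blast
  obtain K where K: "compact K" "convex K" "bundle_chart c \<zeta> \<in> interior K" "K \<subseteq> snd c ` fst c \<times> UNIV"
    "lipschitz K (spray c F)"
    "lipschitz K (\<lambda>z. let p = chart_inv c (fst z) in g p (F p) (coord_field A c (snd z) p))"
    by (rule spray_lipschitz[OF F c(1) imageI[OF c(2)]])
  obtain r \<epsilon> \<psi> where \<psi>: "r > 0" "\<epsilon> > 0" "continuous_on UNIV (\<lambda>(t, z). \<psi> t z)" "\<And>z. \<psi> 0 z = z"
    "\<And>t z. z \<in> ball (bundle_chart c \<zeta>) r \<Longrightarrow> \<psi> t z \<in> K"
    "\<And>t z. z \<in> ball (bundle_chart c \<zeta>) r \<Longrightarrow> \<bar>t\<bar> < \<epsilon> \<Longrightarrow> ((\<lambda>t. \<psi> t z) has_vector_derivative spray c F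
        (\<psi> t z)) (at t)"
    using picard_local[OF K(5,1,2,3)] by blast
  define N where "N = unit_tangent_bundle X g \<inter> {z. fst z \<in> fst c \<and>
      bundle_chart c z \<in> ball (bundle_chart c \<zeta>) r}"
  define \<phi> where "\<phi> t z = bundle_chart_inv c (\<psi> t (bundle_chart c z))" for t z
  have Kdom: "fst z \<in> snd c ` fst c" if "z \<in> K" for z using K(4) that by auto
  have \<psi>K: "\<psi> t (bundle_chart c y) \<in> K" if "y \<in> N" for t y
    using \<psi>(5) that by (simp add: N_def)
  have bc: "bundle_chart c (\<phi> t y) = \<psi> t (bundle_chart c y)" if "y \<in> N" for t y
    using bundle_chart_bundle_chart_inv[OF c(1) Kdom[OF \<psi>K[OF that]]] unfolding \<phi>_def .
  have dom: "fst (\<phi> t y) \<in> fst c" if "y \<in> N" for t y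
    using chart_inv_dom[OF Kdom[OF \<psi>K[OF that]]] by (simp add: \<phi>_def)
  have N: "openin sphere_bundle N" "\<zeta> \<in> N"
    using bundle_chart_openin[OF c(1) open_ball] \<zeta> c(2) \<psi>(1)
    by (auto simp: N_def openin_subtopology_Int2)
  have cont\<psi>: "continuous_on UNIV (\<lambda>s. \<psi> s z)" for z
    using continuous_on_compose2[OF \<psi>(3), of UNIV "\<lambda>s. (s, z)"]
    by (simp add: continuous_on_Pair continuous_on_const continuous_on_id)
  have eqn: "thermostat_equation F (\<lambda>t. \<phi> t y) t" if y: "y \<in> N" and t: "\<bar>t\<bar> < \<epsilon>" for t y
  proof -
    have "limitin X (\<lambda>s. fst (\<phi> s y)) (fst (\<phi> t y)) (at t)"
    proof (rule limitin_atI[of "\<lambda>s. fst (\<phi> s y)"])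
      show "fst (\<phi> t y) \<in> topspace X" using dom[OF y] chart_subset[OF c(1)] by blast
      fix U assume U: "openin X U" "fst (\<phi> t y) \<in> U"
      let ?W = "snd c ` (U \<inter> fst c)"
      have "continuous_on UNIV (\<lambda>s. fst (\<psi> s (bundle_chart c y)))"
        using cont\<psi> by (rule continuous_on_fst)
      then have op: "open ((\<lambda>s. fst (\<psi> s (bundle_chart c y))) -` ?W)"
        using chart_open_image[OF c(1) U(1)] open_vimage by blast
      have V: "s \<in> (\<lambda>s. fst (\<psi> s (bundle_chart c y))) -` ?W \<longleftrightarrow> fst (\<phi> s y) \<in> U" for s
      proof -
        have "fst (\<psi> s (bundle_chart c y)) = snd c (fst (\<phi> s y))"
          using bc[OF y] by (metis fst_conv)
        moreover have "snd c (fst (\<phi> s y)) \<in> ?W \<longleftrightarrow> fst (\<phi> s y) \<in> U"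
          using dom[OF y] chart_inj[OF c(1)] by (auto simp: inj_on_def)
        ultimately show ?thesis by simp
      qed
      have "(\<lambda>s. fst (\<psi> s (bundle_chart c y))) -` ?W = {s. fst (\<phi> s y) \<in> U}"
        by (intro set_eqI) (simp only: V mem_Collect_eq)
      then show "\<forall>\<^sub>F s in nhds t. fst (\<phi> s y) \<in> U"
        unfolding eventually_nhds using op U(2) by (intro exI[of _ "{s. fst (\<phi> s y) \<in> U}"]) auto
    qed
    moreover have "((\<lambda>s. bundle_chart c (\<phi> s y)) has_vector_derivative spray c F (bundle_chart c
        (\<phi> t y))) (at t)"
      unfolding bc[OF y] by (rule \<psi>(6)[OF _ t]) (use y in \<open>simp add: N_def\<close>)
    ultimately show ?thesis
      using thermostat_equation_chart[where \<gamma> = "\<lambda>s. \<phi> s y" and t = t, OF c(1) dom[OF y]] by blast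
  qed
  have \<phi>0: "\<phi> 0 y = y" if "y \<in> N" for y
    using bundle_chart_inv_bundle_chart[OF c(1), of y] that unfolding \<phi>_def \<psi>(4) by (simp add: N_def)
  have unit: "\<phi> t y \<in> unit_tangent_bundle X g" if y: "y \<in> N" and t: "t \<in> {-\<epsilon><..<\<epsilon>}" for t y
  proof (rule thermostat_preserves_speed[where \<gamma> = "\<lambda>t. \<phi> t y" and J = "{-\<epsilon><..<\<epsilon>}" and a = 0])
    show "open_interval {-\<epsilon><..<\<epsilon>}" using \<psi>(2) by (simp add: open_interval_def is_interval_oo)
    show "thermostat_equation F (\<lambda>t. \<phi> t y) t" if "t \<in> {-\<epsilon><..<\<epsilon>}" for t
      by (rule eqn[OF y]) (use that in auto)
    show "\<phi> 0 y \<in> unit_tangent_bundle X g" using y by (simp add: \<phi>0 N_def)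
    \<comment> \<open>Continuity of <F, v> along the solution is read off in coordinates, where the
      solution stays in \<open>K\<close>.\<close>
    have "continuous_on {-\<epsilon><..<\<epsilon>} (\<lambda>s. (\<lambda>z. let p = chart_inv c (fst z) in g p (F p) (coord_field A
        c (snd z) p)) (\<psi> s (bundle_chart c y)))"
      by (rule continuous_on_compose2[OF lipschitz_continuous_on[OF K(6)] continuous_on_subset[OF
          cont\<psi>]])
        (use \<psi>K[OF y] in auto)
    then show "continuous_on {-\<epsilon><..<\<epsilon>} (\<lambda>s. g (fst (\<phi> s y)) (F (fst (\<phi> s y))) (snd (\<phi> s y)))"
      by (simp add: \<phi>_def Let_def)
  qed (use t \<psi>(2) in auto)
  have sol: "sphere_equation F (\<lambda>t. \<phi> t y) t" if y: "y \<in> N" and t: "t \<in> {-\<epsilon><..<\<epsilon>}" for t y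
  proof -
    have "\<forall>\<^sub>F s in nhds t. \<phi> s y \<in> unit_tangent_bundle X g"
      unfolding eventually_nhds using unit[OF y] t by (intro exI[of _ "{-\<epsilon><..<\<epsilon>}"]) auto
    then show ?thesis using eqn[OF y, of t] t by (auto simp: sphere_equation_def)
  qed
  let ?P = "subtopology (prod_topology euclideanreal sphere_bundle) ({-\<epsilon><..<\<epsilon>} \<times> N)"
  have cont: "continuous_map ?P sphere_bundle (\<lambda>(t, y). \<phi> t y)"
  proof (rule continuous_map_into_subtopology)
    have topP: "topspace ?P \<subseteq> {-\<epsilon><..<\<epsilon>} \<times> N" by auto
    have s: "continuous_map ?P (subtopology (tangent_topology X A) (fst c \<times> UNIV)) snd"
    proof (rule continuous_map_into_subtopology)
      have "continuous_map ?P sphere_bundle snd"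
        by (intro continuous_map_from_subtopology continuous_map_snd)
      then show "continuous_map ?P (tangent_topology X A) snd"
        using continuous_map_in_subtopology by blast
      show "snd \<in> topspace ?P \<rightarrow> fst c \<times> UNIV" by (auto simp: N_def mem_Times_iff)
    qed
    have "continuous_map ?P euclidean (\<lambda>z. bundle_chart c (snd z))"
      using continuous_map_compose[OF s bundle_chart_continuous[OF c(1)]] by (simp add: o_def)
    moreover have "continuous_map ?P euclidean fst"
      by (intro continuous_map_from_subtopology continuous_map_fst)
    ultimately have "continuous_map ?P euclidean (\<lambda>z. (fst z, bundle_chart c (snd z)))"
      using continuous_map_pairedI[of ?P euclidean fst euclidean "\<lambda>z. bundle_chart c (snd z)"]
      by (simp only: prod_topology_euclidean)
    moreover have "continuous_map euclidean euclidean (\<lambda>(t, z). \<psi> t z)"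
      using \<psi>(3) by simp
    ultimately have "continuous_map ?P euclidean (\<lambda>z. \<psi> (fst z) (bundle_chart c (snd z)))"
      using continuous_map_compose[of ?P euclidean _ euclidean "\<lambda>(t, z). \<psi> t z"]
          by (fastforce simp: o_def)
    then have "continuous_map ?P (top_of_set (snd c ` fst c \<times> UNIV)) (\<lambda>z. \<psi> (fst z) (bundle_chart c
        (snd z)))"
      by (rule continuous_map_into_subtopology) (use \<psi>K K(4) topP in fastforce)
    from continuous_map_compose[OF this bundle_chart_inv_continuous[OF c(1)]]
    show "continuous_map ?P (tangent_topology X A) (\<lambda>(t, y). \<phi> t y)"
      by (simp add: o_def \<phi>_def case_prod_unfold)
    show "(\<lambda>(t, y). \<phi> t y) \<in> topspace ?P \<rightarrow> unit_tangent_bundle X g"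
      using unit topP by auto
  qed
  show ?thesis
    by (intro exI[of _ N] exI[of _ \<epsilon>] exI[of _ \<phi>] conjI ballI N \<psi>(2) cont \<phi>0 sol)
qed

text \<open>The domain is open, so unit length at each of its points is the same as unit length near
  each of its points, which is the form of \<open>sphere_equation\<close>.\<close>

lemma isokinetic_iff:
  "isokinetic_curves X A g nabla F J r u \<longleftrightarrow>
    open_interval J \<and> (\<forall>t\<in>J. sphere_equation F (\<lambda>t. (r t, u t)) t)"
proof -
  have "has_velocity X A r (u t) t \<Longrightarrow> r t \<in> topspace X" for t
    by (rule has_velocity_topspace)
  then have 1: "isokinetic_curves X A g nabla F J r u \<longleftrightarrow>
      open_interval J \<and> (\<forall>t\<in>J. thermostat_equation F (\<lambda>t. (r t, u t)) t \<and>
          (r t, u t) \<in> unit_tangent_bundle X g)"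
    by (auto simp: isokinetic_curves_def thermostat_equation_def thermostat_def unit_tangent_bundle_def)
  have "(\<forall>t\<in>J. P t \<and> Q t) \<longleftrightarrow> (\<forall>t\<in>J. P t \<and> (\<forall>\<^sub>F s in nhds t. Q s))" if "open J" for P Q :: "real \<Rightarrow> bool"
  proof
    assume *: "\<forall>t\<in>J. P t \<and> Q t"
    then have "\<forall>\<^sub>F s in nhds t. Q s" if "t \<in> J" for t
      unfolding eventually_nhds using that \<open>open J\<close> by (intro exI[of _ J]) auto
    then show "\<forall>t\<in>J. P t \<and> (\<forall>\<^sub>F s in nhds t. Q s)" using * by simp
  qed (auto dest: eventually_nhds_x_imp_x)
  from this[of "thermostat_equation F (\<lambda>t. (r t, u t))" "\<lambda>t. (r t, u t) \<in> unit_tangent_bundle X g"]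
  show ?thesis
    unfolding 1 sphere_equation_def by (simp add: open_interval_def cong: conj_cong)
qed

theorem isokinetic_flow_exists:
  assumes "compact_space X" "locally_lipschitz_field F"
  shows "\<exists>\<Phi>. defines_flow X A g (isokinetic_curves X A g nabla F) \<Phi>"
proof -
  interpret local_flow sphere_bundle "sphere_equation F"
  proof
    show "compact_space sphere_bundle" by (rule compact_sphere_bundle[OF assms(1)])
    show "Hausdorff_space sphere_bundle" by (rule Hausdorff_space_subtopology[OF Hausdorff_tangent])
    show "limitin sphere_bundle \<gamma> (\<gamma> t) (at t)" if "sphere_equation F \<gamma> t" for \<gamma> t
      using that thermostat_limitin[of F \<gamma> t] eventually_nhds_x_imp_x[of _ t]
      unfolding sphere_equation_def limitin_subtopology
      by (auto simp: eventually_at_filter elim: eventually_mono)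
    show "sphere_equation F \<delta> t" if "sphere_equation F \<gamma> t" "\<forall>\<^sub>F s in nhds t. \<delta> s = \<gamma> s" for \<gamma> \<delta> t
      using that thermostat_cong[of F \<gamma> t \<delta>] unfolding sphere_equation_def
      by (auto elim: eventually_elim2)
    show "sphere_equation F (\<lambda>x. \<gamma> (s + x)) t" if "sphere_equation F \<gamma> (s + t)" for \<gamma> s t
    proof -
      have "filterlim (\<lambda>x. s + x) (nhds (s + t)) (nhds t)"
        using tendsto_add[OF tendsto_const filterlim_ident[of "nhds t"]] .
      then have "\<forall>\<^sub>F x in nhds t. \<gamma> (s + x) \<in> unit_tangent_bundle X g"
        using that unfolding sphere_equation_def by (auto intro: eventually_compose_filterlim)
      then show ?thesis using that thermostat_shift unfolding sphere_equation_def by blast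
    qed
    show "\<forall>\<^sub>F s in nhds t. \<gamma> s = \<delta> s"
      if "\<forall>\<^sub>F s in nhds t. sphere_equation F \<gamma> s" "\<forall>\<^sub>F s in nhds t. sphere_equation F \<delta> s" "\<gamma> t =
          \<delta> t" for \<gamma> \<delta> t
      using that thermostat_unique[OF assms(2)] unfolding sphere_equation_def
          by (simp add: eventually_conj_iff)
    show "\<exists>N \<epsilon> \<phi>. openin sphere_bundle N \<and> z \<in> N \<and> \<epsilon> > 0 \<and>
      flow_box sphere_bundle (sphere_equation F) N \<epsilon> \<phi>" if "z \<in> topspace sphere_bundle" for z
      using thermostat_local_existence[OF assms(2)] that unfolding topspace_sphere_bundle by blast
  qed
  obtain \<Phi> where \<Phi>: "is_flow sphere_bundle \<Phi>"
    "\<And>z t. z \<in> topspace sphere_bundle \<Longrightarrow> sphere_equation F (\<lambda>t. \<Phi> t z) t"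
    "\<And>J \<gamma> s t. open_interval J \<Longrightarrow> (\<And>t. t \<in> J \<Longrightarrow> sphere_equation F \<gamma> t) \<Longrightarrow> s \<in> J \<Longrightarrow> s + t \<in> J \<Longrightarrow>
        \<Phi> t (\<gamma> s) = \<gamma> (s + t)"
    using flow_exists by blast
  have "defines_flow X A g (isokinetic_curves X A g nabla F) \<Phi>"
    unfolding defines_flow_def isokinetic_iff
  proof (intro conjI ballI allI impI \<Phi>(1))
    show "open_interval UNIV" by (simp add: open_interval_def)
    show "sphere_equation F (\<lambda>t. (fst (\<Phi> t x), snd (\<Phi> t x))) t" if "x \<in> unit_tangent_bundle X g" for x t
      using \<Phi>(2) that by (simp only: topspace_sphere_bundle prod.collapse)
    show "\<Phi> t (r s, u s) = (r (s + t), u (s + t))"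
      if "open_interval J \<and> (\<forall>t\<in>J. sphere_equation F (\<lambda>t. (r t, u t)) t)" "s \<in> J" "s + t \<in> J"
          for J r u s t
      using \<Phi>(3)[of J "\<lambda>t. (r t, u t)" s t] that by simp
  qed
  then show ?thesis by blast
qed

end

section \<open>Arc length lifts\<close>

text \<open>Perturbation of a coercive linear system: \<open>G x\<close> is the matrix,
  \<open>\<beta> x\<close> the right-hand side and \<open>y x\<close> the solution. Coercivity with
  constant \<open>m\<close> bounds the solution and then its variation, so the matrix is never
  inverted. The application is the gradient.\<close>

lemma lipschitz_linear_solution:
  fixes G :: "'d::metric_space \<Rightarrow> 'e::euclidean_space \<Rightarrow> 'e \<Rightarrow> real"
  assumes K: "compact K" and m: "m > 0"
    and G: "\<And>x u v. x \<in> K \<Longrightarrow> G x u v = (\<Sum>a\<in>Basis. \<Sum>b\<in>Basis. (u \<bullet> a) * (v \<bullet> b) * G x a b)"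
    and Gl: "\<And>a b. lipschitz K (\<lambda>x. G x a b)"
    and \<beta>: "\<And>x v. x \<in> K \<Longrightarrow> \<beta> x v = (\<Sum>b\<in>Basis. (v \<bullet> b) * \<beta> x b)"
    and \<beta>l: "\<And>b. lipschitz K (\<lambda>x. \<beta> x b)"
    and pos: "\<And>x v. x \<in> K \<Longrightarrow> m * (norm v)\<^sup>2 \<le> G x v v"
    and y: "\<And>x v. x \<in> K \<Longrightarrow> G x (y x) v = \<beta> x v"
  shows "lipschitz K y"
proof -
  obtain L where L: "\<And>a b. (L a b)-lipschitz_on K (\<lambda>x. G x a b)" using Gl unfolding lipschitz_def
      by metis
  obtain M where M: "\<And>b. (M b)-lipschitz_on K (\<lambda>x. \<beta> x b)" using \<beta>l unfolding lipschitz_def by metis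
  have "\<exists>C. \<forall>x\<in>K. \<bar>\<beta> x b\<bar> \<le> C" for b
  proof -
    have "bounded ((\<lambda>x. \<beta> x b) ` K)"
      using lipschitz_continuous_on[OF \<beta>l] K compact_continuous_image compact_imp_bounded by blast
    then show ?thesis by (simp add: bounded_iff)
  qed
  then obtain C where C: "\<And>b x. x \<in> K \<Longrightarrow> \<bar>\<beta> x b\<bar> \<le> C b" by metis
  define LS MS CS where "LS = (\<Sum>a\<in>Basis. \<Sum>b\<in>Basis. L a b)" and "MS = (\<Sum>b\<in>Basis. M b)"
    and "CS = (\<Sum>b\<in>Basis. \<bar>C b\<bar>)"
  have nonneg: "LS \<ge> 0" "MS \<ge> 0" "CS \<ge> 0"
    unfolding LS_def MS_def CS_def using lipschitz_on_nonneg[OF L] lipschitz_on_nonneg[OF M]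
    by (auto intro!: sum_nonneg)
  have Gd: "\<bar>G x u v - G x' u v\<bar> \<le> norm u * norm v * (LS * dist x x')" if "x \<in> K" "x' \<in> K" for x x' u v
  proof -
    have "\<bar>G x u v - G x' u v\<bar> = \<bar>\<Sum>a\<in>Basis. \<Sum>b\<in>Basis. (u \<bullet> a) * (v \<bullet> b) * (G x a b - G x' a b)\<bar>"
      by (simp add: G[OF that(1), of u v] G[OF that(2), of u v] sum_subtractf[symmetric]
          right_diff_distrib)
    also have "\<dots> \<le> (\<Sum>a\<in>Basis. \<Sum>b\<in>Basis. norm u * norm v * (L a b * dist x x'))"
    proof (rule order_trans[OF sum_abs], rule sum_mono, rule order_trans[OF sum_abs], rule sum_mono)
      fix a b :: 'e assume "a \<in> Basis" "b \<in> Basis"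
      moreover have "\<bar>G x a b - G x' a b\<bar> \<le> L a b * dist x x'"
        using lipschitz_onD[OF L that] by (simp add: dist_real_def)
      ultimately show "\<bar>(u \<bullet> a) * (v \<bullet> b) * (G x a b - G x' a b)\<bar> \<le>
          norm u * norm v * (L a b * dist x x')"
        by (simp add: abs_mult mult_mono Basis_le_norm)
    qed
    finally show ?thesis by (simp add: LS_def sum_distrib_left sum_distrib_right)
  qed
  have \<beta>d: "\<bar>\<beta> x v - \<beta> x' v\<bar> \<le> norm v * (MS * dist x x')" if "x \<in> K" "x' \<in> K" for x x' v
  proof -
    have "\<bar>\<beta> x v - \<beta> x' v\<bar> = \<bar>\<Sum>b\<in>Basis. (v \<bullet> b) * (\<beta> x b - \<beta> x' b)\<bar>"
      by (simp add: \<beta>[OF that(1), of v] \<beta>[OF that(2), of v] sum_subtractf[symmetric] right_diff_distrib)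
    also have "\<dots> \<le> (\<Sum>b\<in>Basis. norm v * (M b * dist x x'))"
    proof (rule order_trans[OF sum_abs], rule sum_mono)
      fix b :: 'e assume "b \<in> Basis"
      moreover have "\<bar>\<beta> x b - \<beta> x' b\<bar> \<le> M b * dist x x'"
        using lipschitz_onD[OF M that] by (simp add: dist_real_def)
      ultimately show "\<bar>(v \<bullet> b) * (\<beta> x b - \<beta> x' b)\<bar> \<le> norm v * (M b * dist x x')"
        by (simp add: abs_mult mult_mono Basis_le_norm)
    qed
    finally show ?thesis by (simp add: MS_def sum_distrib_left sum_distrib_right)
  qed
  have bound: "norm (y x) \<le> CS / m" if x: "x \<in> K" for x
  proof (cases "y x = 0")
    case True
    then show ?thesis using nonneg m by simp
  next
    case False
    \<comment> \<open>Testing the equation with the vector \<open>y x\<close> itself bounds the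
      solution.\<close>
    have "m * (norm (y x))\<^sup>2 \<le> \<bar>\<Sum>b\<in>Basis. (y x \<bullet> b) * \<beta> x b\<bar>"
      using pos[OF x, of "y x"] y[OF x, of "y x"] \<beta>[OF x, of "y x"] by simp
    also have "\<dots> \<le> (\<Sum>b\<in>Basis. norm (y x) * \<bar>C b\<bar>)"
    proof (rule order_trans[OF sum_abs], rule sum_mono)
      fix b :: 'e assume "b \<in> Basis"
      moreover have "\<bar>\<beta> x b\<bar> \<le> \<bar>C b\<bar>" using C[OF x, of b] by simp
      ultimately show "\<bar>(y x \<bullet> b) * \<beta> x b\<bar> \<le> norm (y x) * \<bar>C b\<bar>"
        by (simp add: abs_mult mult_mono Basis_le_norm)
    qed
    also have "\<dots> = norm (y x) * CS" by (simp add: CS_def sum_distrib_left)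
    finally have "norm (y x) * (m * norm (y x)) \<le> norm (y x) * CS"
      by (simp add: power2_eq_square ac_simps)
    then have "m * norm (y x) \<le> CS" using False by simp
    then show ?thesis using m by (simp add: field_simps)
  qed
  have "((MS + CS / m * LS) / m)-lipschitz_on K y"
  proof (rule lipschitz_onI)
    fix x x' assume x: "x \<in> K" "x' \<in> K"
    define \<delta> where "\<delta> = y x - y x'"
    show "dist (y x) (y x') \<le> (MS + CS / m * LS) / m * dist x x'"
    proof (cases "\<delta> = 0")
      case True
      then show ?thesis using nonneg m by (simp add: \<delta>_def)
    next
      case False
      \<comment> \<open>The difference of the two solutions is tested against itself. Its size is
        then controlled by the change of the right-hand side and by the change of the matrix, the
        latter acting on \<open>y x'\<close>, which is bounded.\<close>
      have "G x \<delta> \<delta> = G x (y x) \<delta> - G x (y x') \<delta>"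
        unfolding G[OF x(1), of \<delta> \<delta>] G[OF x(1), of "y x" \<delta>] G[OF x(1), of "y x'" \<delta>]
        by (simp add: \<delta>_def inner_diff_left left_diff_distrib sum_subtractf)
      also have "\<dots> = (\<beta> x \<delta> - \<beta> x' \<delta>) + (G x' (y x') \<delta> - G x (y x') \<delta>)"
        using y x by simp
      also have "\<dots> \<le> norm \<delta> * (MS * dist x x') + norm (y x') * norm \<delta> * (LS * dist x x')"
        using \<beta>d[OF x, of \<delta>] Gd[OF x(2,1), of "y x'" \<delta>] by (simp add: dist_commute)
      also have "\<dots> \<le> norm \<delta> * (MS * dist x x') + CS / m * norm \<delta> * (LS * dist x x')"
        using mult_right_mono[OF bound[OF x(2)], of "norm \<delta> * (LS * dist x x')"] nonneg
        by (simp add: mult.assoc)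
      finally have "m * (norm \<delta>)\<^sup>2 \<le> norm \<delta> * (MS * dist x x') + CS / m * norm \<delta> * (LS * dist x x')"
        using pos[OF x(1), of \<delta>] by linarith
      then have "norm \<delta> * (m * norm \<delta>) \<le> norm \<delta> * ((MS + CS / m * LS) * dist x x')"
        by (simp add: power2_eq_square algebra_simps)
      then have "m * norm \<delta> \<le> (MS + CS / m * LS) * dist x x'"
        using False by simp
      then show ?thesis using m by (simp add: \<delta>_def dist_norm field_simps)
    qed
  qed (use nonneg m in simp)
  then show ?thesis unfolding lipschitz_def by blast
qed

section \<open>Weyl geodesics and changes of time\<close>

context riemannian
begin

text \<open>The correction in \<open>weyl_connection\<close> depends on a field only through its
  value at the point, where the coordinate field of the chosen chart is \<open>b\<close>. Summed
  against the components of \<open>w t\<close>, the first two correction terms coincide and give 2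
  <F, w> w, and the last gives - |w|^2 F.\<close>

lemma weyl_geodesic_equation:
  assumes v: "has_velocity X A q (w t) t"
  shows "has_covariant_derivative X A (weyl_connection g nabla F) q w 0 t \<longleftrightarrow>
    has_covariant_derivative X A nabla q w
      (g (q t) (w t) (w t) *\<^sub>R F (q t) - (2 * g (q t) (F (q t)) (w t)) *\<^sub>R w t) t"
proof -
  let ?k = "chart_at A (q t)" let ?p = "q t"
  have p: "?p \<in> topspace X" using has_velocity_topspace[OF v] .
  have k: "?k \<in> A" "?p \<in> fst ?k" using chart_at_in chart_at_dom p by auto
  have l: "linear (\<lambda>v. g ?p u v)" for u
    using metric_bilinear[OF p] unfolding bilinear_def by auto
  define N where "N = (\<Sum>b\<in>Basis. (w t \<bullet> b) *\<^sub>R nabla ?p (w t) (coord_field A ?k b))"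
  have "(\<Sum>b\<in>Basis. (w t \<bullet> b) *\<^sub>R weyl_connection g nabla F ?p (w t) (coord_field A ?k b)) =
      N + (\<Sum>b\<in>Basis. (w t \<bullet> b) * g ?p (F ?p) b) *\<^sub>R w t +
      g ?p (F ?p) (w t) *\<^sub>R (\<Sum>b\<in>Basis. (w t \<bullet> b) *\<^sub>R b) -
      (\<Sum>b\<in>Basis. (w t \<bullet> b) * g ?p (w t) b) *\<^sub>R F ?p"
    by (simp add: weyl_connection_def coord_field_chart_at[OF k] N_def scaleR_sum_left scaleR_sum_right
        sum.distrib sum_subtractf algebra_simps)
  also have "\<dots> = N + g ?p (F ?p) (w t) *\<^sub>R w t + g ?p (F ?p) (w t) *\<^sub>R w t - g ?p (w t) (w t) *\<^sub>R F ?p"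
    using linear_Basis_expansion[OF l, of "F ?p" "w t"] linear_Basis_expansion[OF l, of "w t" "w t"]
    by (simp add: euclidean_representation)
  finally have eq: "(\<Sum>b\<in>Basis. (w t \<bullet> b) *\<^sub>R weyl_connection g nabla F ?p (w t) (coord_field A ?k b)) =
      N - (g ?p (w t) (w t) *\<^sub>R F ?p - (2 * g ?p (F ?p) (w t)) *\<^sub>R w t)"
    by (simp add: algebra_simps scaleR_2[symmetric])
  have cov: "has_covariant_derivative X A conn q w a t \<longleftrightarrow>
      (\<exists>V'. ((\<lambda>s. tangent_coord A ?k (q s) (w s)) has_vector_derivative V') (at t) \<and>
        a = V' + (\<Sum>b\<in>Basis. (w t \<bullet> b) *\<^sub>R conn ?p (w t) (coord_field A ?k b)))" for conn a
    unfolding has_covariant_derivative_def Let_def using v has_velocity_unique[OF v] by blast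
  have "0 = V' + (N - z) \<longleftrightarrow> z = V' + N" for V' z :: 'e
    by (auto simp: algebra_simps)
  then show ?thesis unfolding cov eq N_def[symmetric] by simp
qed

text \<open>The tangential coefficient \<open>\<kappa>\<close> is arbitrary, so one computation
  covers geodesics and isoenergetic trajectories. It disappears because the normalizing factor has
  derivative - (<F, v> + \<kappa>) / |v|^2, whose second part compensates the tangential
  acceleration.\<close>

lemma arc_length_lift_isokinetic:
  assumes I: "open_interval I"
    and v: "\<And>t. t \<in> I \<Longrightarrow> has_velocity X A q (v t) t"
    and cov: "\<And>t. t \<in> I \<Longrightarrow> has_covariant_derivative X A nabla q v
      (g (q t) (v t) (v t) *\<^sub>R F (q t) + \<kappa> t *\<^sub>R v t) t"
    and rep: "arc_length_reparam X A g I q J r"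
    and u: "\<And>s. s \<in> J \<Longrightarrow> has_velocity X A r (u s) s"
  shows "isokinetic_curves X A g nabla F J r u"
proof -
  let ?G = "\<lambda>t. g (q t) (v t) (v t)"
  obtain \<sigma> where bij: "bij_betw \<sigma> I J" and r: "\<And>t. t \<in> I \<Longrightarrow> r (\<sigma> t) = q t"
    and v0: "\<And>t. t \<in> I \<Longrightarrow> v t \<noteq> 0 \<and> (\<sigma> has_real_derivative sqrt (?G t)) (at t)"
    using rep has_velocity_unique[OF v] unfolding arc_length_reparam_def by metis
  have top: "q t \<in> topspace X" if "t \<in> I" for t using has_velocity_topspace[OF v[OF that]] .
  have G: "?G t > 0" if "t \<in> I" for t using metric_pos[OF top[OF that]] v0[OF that] by blast
  let ?\<theta> = "inv_into I \<sigma>"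
  have J: "J = \<sigma> ` I" using bij by (simp add: bij_betw_def)
  have \<sigma>: "(\<sigma> has_real_derivative sqrt (?G t)) (at t)" "sqrt (?G t) > 0" if "t \<in> I" for t
    using v0 G that by auto
  note inv = increasing_inverse_function[OF I \<sigma>]
  have J_open: "open_interval J" using inv(2) J by simp
  have \<theta>J: "?\<theta> s \<in> I" "\<sigma> (?\<theta> s) = s" if "s \<in> J" for s
    using that unfolding J by (auto simp: inv_into_into f_inv_into_f)
  have ev: "\<forall>\<^sub>F s' in nhds s. P s'" if "s \<in> J" "\<And>s'. s' \<in> J \<Longrightarrow> P s'" for P s
    unfolding eventually_nhds using J_open that by (intro exI[of _ J]) (auto simp: open_interval_def)
  \<comment> \<open>The reciprocal speed plays two roles: it is the derivative of the inverse arc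
    length, and it normalizes the velocity.\<close>
  define \<rho> where "\<rho> s = 1 / sqrt (?G (?\<theta> s))" for s
  have at_s: "has_velocity X A r (\<rho> s *\<^sub>R v (?\<theta> s)) s \<and>
      has_covariant_derivative X A nabla r (\<lambda>s. \<rho> s *\<^sub>R v (?\<theta> s))
        (thermostat F (r s) (\<rho> s *\<^sub>R v (?\<theta> s))) s" if s: "s \<in> J" for s
  proof -
    let ?t = "?\<theta> s" let ?a = "?G ?t *\<^sub>R F (q ?t) + \<kappa> ?t *\<^sub>R v ?t"
    note t = \<theta>J[OF s]
    have l: "linear (\<lambda>u. g (q ?t) u (v ?t))" "linear (\<lambda>v. g (q ?t) u v)" for u
      using metric_bilinear[OF top[OF t(1)]] unfolding bilinear_def by auto
    have \<theta>': "(?\<theta> has_real_derivative 1 / sqrt (?G ?t)) (at s)"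
      using inv(3)[OF _ _ t(1)] t(2) by simp
    have "((\<lambda>s. ?G (?\<theta> s)) has_real_derivative 2 * g (q ?t) ?a (v ?t) * (1 / sqrt (?G ?t))) (at s)"
      by (rule DERIV_chain2[OF metric_along_curve[OF cov[OF t(1)]] \<theta>'])
    then have "(\<rho> has_real_derivative
        - (inverse (sqrt (?G ?t)) / 2 * (2 * g (q ?t) ?a (v ?t) * (1 / sqrt (?G ?t)))) / (sqrt
            (?G ?t) * sqrt (?G ?t))) (at s)"
      unfolding \<rho>_def using G[OF t(1)]
      by (auto intro!: derivative_eq_intros simp: field_simps)
    moreover have "- (inverse (sqrt (?G ?t)) / 2 * (2 * g (q ?t) ?a (v ?t) * (1 / sqrt (?G ?t)))) /
        (sqrt (?G ?t) * sqrt (?G ?t)) =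
        - (g (q ?t) (F (q ?t)) (v ?t) + \<kappa> ?t) / ?G ?t"
    proof -
      have "g (q ?t) ?a (v ?t) = ?G ?t * (g (q ?t) (F (q ?t)) (v ?t) + \<kappa> ?t)"
        by (simp add: linear_add[OF l(1)] linear_cmul[OF l(1)] algebra_simps)
      moreover have "sqrt (?G ?t) * sqrt (?G ?t) = ?G ?t" using G[OF t(1)] by simp
      ultimately show ?thesis using G[OF t(1)] by (simp add: field_simps)
    qed
    ultimately have \<rho>': "(\<rho> has_real_derivative - (g (q ?t) (F (q ?t)) (v ?t) + \<kappa> ?t) / ?G ?t) (at s)"
      by simp
    note rp = reparametrize[OF v[OF t(1)] cov[OF t(1)] \<theta>' \<rho>']
    have rq: "\<forall>\<^sub>F s' in nhds s. q (?\<theta> s') = r s'"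
      by (rule ev[OF s]) (metis \<theta>J r)
    have "has_velocity X A r (\<rho> s *\<^sub>R v ?t) s"
      using has_velocity_cong[OF rp(1) rq] by (simp add: \<rho>_def)
    moreover have "(- (g (q ?t) (F (q ?t)) (v ?t) + \<kappa> ?t) / ?G ?t) *\<^sub>R v ?t + (\<rho> s * (1 / sqrt
        (?G ?t))) *\<^sub>R ?a =
        thermostat F (r s) (\<rho> s *\<^sub>R v ?t)"
    proof -
      have "\<rho> s * (1 / sqrt (?G ?t)) = 1 / ?G ?t" and \<rho>2: "\<rho> s * \<rho> s = 1 / ?G ?t"
        using G[OF t(1)] by (simp_all add: \<rho>_def)
      moreover have "r s = q ?t" using r[OF t(1)] t(2) by simp
      moreover have "\<rho> s * z * \<rho> s = z / ?G ?t" for z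
      proof -
        have "\<rho> s * z * \<rho> s = z * (\<rho> s * \<rho> s)" by simp
        then show ?thesis unfolding \<rho>2 by simp
      qed
      then have "thermostat F (q ?t) (\<rho> s *\<^sub>R v ?t) = F (q ?t) - (g (q ?t) (F (q ?t)) (v ?t) / ?G
          ?t) *\<^sub>R v ?t"
        by (simp only: thermostat_def linear_cmul[OF l(2)] real_scaleR_def scaleR_scaleR)
      ultimately show ?thesis
        using G[OF t(1)] by (simp add: scaleR_add_right scaleR_add_left[symmetric] diff_divide_distrib
            add_divide_distrib algebra_simps)
    qed
    ultimately show ?thesis
      using has_covariant_derivative_cong[OF rp(2) rq] by simp
  qed
  \<comment> \<open>The lift \<open>u\<close> is given only as the velocity of \<open>r\<close>;
    uniqueness of velocities identifies it with the normalized vector.\<close>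
  have u_eq: "u s = \<rho> s *\<^sub>R v (?\<theta> s)" if "s \<in> J" for s
    using has_velocity_unique[OF u[OF that]] at_s[OF that] by blast
  show ?thesis
    unfolding isokinetic_curves_def
  proof (intro conjI ballI J_open)
    fix s assume s: "s \<in> J"
    show "has_velocity X A r (u s) s" using u[OF s] .
    have "\<forall>\<^sub>F s' in nhds s. \<rho> s' *\<^sub>R v (?\<theta> s') = u s'" by (rule ev[OF s]) (simp add: u_eq)
    from has_covariant_derivative_cong[OF conjunct2[OF at_s[OF s]] _ this]
    show "has_covariant_derivative X A nabla r u (F (r s) - g (r s) (F (r s)) (u s) *\<^sub>R u s) s"
      by (simp add: u_eq[OF s] thermostat_def)
    have l: "linear (\<lambda>u. g (r s) u v)" "linear (\<lambda>v. g (r s) u v)" for u v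
      using metric_bilinear[OF has_velocity_topspace[OF u[OF s]]] unfolding bilinear_def by auto
    have "r s = q (?\<theta> s)" using r[OF \<theta>J(1)[OF s]] \<theta>J(2)[OF s] by simp
    moreover have "g (r s) (u s) (u s) = \<rho> s * (\<rho> s * g (r s) (v (?\<theta> s)) (v (?\<theta> s)))"
      by (simp only: u_eq[OF s] linear_cmul[OF l(1)] linear_cmul[OF l(2)] real_scaleR_def)
    ultimately show "g (r s) (u s) (u s) = 1"
      using G[OF \<theta>J(1)[OF s]] by (simp add: \<rho>_def)
  qed
qed

text \<open>The new time is an antiderivative \<open>\<theta>\<close> of \<open>1 / \<rho>\<close>,
  so the curve is traversed with speed \<open>\<rho>\<close>, and the inverse of
  \<open>\<theta>\<close> is an arc length. The parameter \<open>s\<close> stays visible in the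
  conclusion because \<open>\<rho>\<close> is prescribed as a function of arc length.\<close>

lemma isokinetic_time_change:
  assumes iso: "isokinetic_curves X A g nabla F J r u"
    and \<rho>: "\<And>s. s \<in> J \<Longrightarrow> \<rho> s > 0" "\<And>s. s \<in> J \<Longrightarrow> (\<rho> has_real_derivative \<rho>' s) (at s)"
  obtains I q v where "open_interval I" "arc_length_reparam X A g I q J r"
    "\<And>t. t \<in> I \<Longrightarrow> has_velocity X A q (v t) t \<and> (\<exists>s\<in>J. q t = r s \<and> v t = \<rho> s *\<^sub>R u s \<and>
      has_covariant_derivative X A nabla q v
        ((\<rho> s * \<rho>' s) *\<^sub>R u s + (\<rho> s)\<^sup>2 *\<^sub>R thermostat F (r s) (u s)) t)"
proof -
  have J: "open_interval J" and u: "\<And>s. s \<in> J \<Longrightarrow> has_velocity X A r (u s) s"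
    and cov: "\<And>s. s \<in> J \<Longrightarrow> has_covariant_derivative X A nabla r u (thermostat F (r s) (u s)) s"
    and unit: "\<And>s. s \<in> J \<Longrightarrow> g (r s) (u s) (u s) = 1"
    using iso unfolding isokinetic_curves_def thermostat_def by auto
  have "continuous_on J (\<lambda>s. 1 / \<rho> s)"
    by (intro continuous_intros continuous_at_imp_continuous_on ballI DERIV_isCont[OF \<rho>(2)])
      (auto dest: \<rho>(1))
  then obtain \<theta> where \<theta>: "\<And>s. s \<in> J \<Longrightarrow> (\<theta> has_real_derivative 1 / \<rho> s) (at s)"
    using real_antiderivative_open_interval[OF J] by blast
  have pos: "1 / \<rho> s > 0" if "s \<in> J" for s using \<rho>(1)[OF that] by simp
  note inv = increasing_inverse_function[OF J \<theta> pos]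
  let ?I = "\<theta> ` J" let ?\<sigma> = "inv_into J \<theta>"
  define v where "v t = \<rho> (?\<sigma> t) *\<^sub>R u (?\<sigma> t)" for t
  have at_s: "has_velocity X A (\<lambda>t. r (?\<sigma> t)) (v t) t \<and> (\<exists>s\<in>J. r (?\<sigma> t) = r s \<and> v t = \<rho> s *\<^sub>R u s \<and>
      has_covariant_derivative X A nabla (\<lambda>t. r (?\<sigma> t)) v
        ((\<rho> s * \<rho>' s) *\<^sub>R u s + (\<rho> s)\<^sup>2 *\<^sub>R thermostat F (r s) (u s)) t) \<and>
      v t \<noteq> 0 \<and> (?\<sigma> has_real_derivative sqrt (g (r (?\<sigma> t)) (v t) (v t))) (at t)" if t: "t \<in> ?I" for t
  proof -
    obtain s where s: "s \<in> J" "t = \<theta> s" using t by blast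
    have \<sigma>t: "?\<sigma> t = s" using inv(1) s by simp
    have \<sigma>': "(?\<sigma> has_real_derivative \<rho> s) (at t)" using inv(3)[OF _ _ s(1)] s(2) by simp
    have \<rho>\<sigma>: "((\<lambda>t. \<rho> (?\<sigma> t)) has_real_derivative \<rho>' s * \<rho> s) (at t)"
      by (rule DERIV_chain2[OF _ \<sigma>']) (simp add: \<sigma>t \<rho>(2)[OF s(1)])
    have u': "has_velocity X A r (u s) (?\<sigma> t)" "has_covariant_derivative X A nabla r u (thermostat F
        (r s) (u s)) (?\<sigma> t)"
      using u cov s \<sigma>t by auto
    have l: "linear (\<lambda>u. g (r s) u v)" "linear (\<lambda>v. g (r s) u v)" for u v
      using metric_bilinear[OF has_velocity_topspace[OF u[OF s(1)]]] unfolding bilinear_def by auto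
    note rp = reparametrize[OF u' \<sigma>' \<rho>\<sigma>]
    have "has_velocity X A (\<lambda>t. r (?\<sigma> t)) (v t) t" using rp(1) by (simp add: v_def \<sigma>t)
    moreover have "has_covariant_derivative X A nabla (\<lambda>t. r (?\<sigma> t)) v
        ((\<rho> s * \<rho>' s) *\<^sub>R u s + (\<rho> s)\<^sup>2 *\<^sub>R thermostat F (r s) (u s)) t"
      using rp(2) unfolding v_def[symmetric] by (simp add: \<sigma>t power2_eq_square mult.commute)
    moreover have "g (r (?\<sigma> t)) (v t) (v t) = (\<rho> s)\<^sup>2"
      using unit[OF s(1)] by (simp add: v_def \<sigma>t linear_cmul[OF l(1)] linear_cmul[OF l(2)]
          power2_eq_square)
    moreover have "u s \<noteq> 0" using unit[OF s(1)] linear_0[OF l(1)] by force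
    then have "v t \<noteq> 0" using \<rho>(1)[OF s(1)] by (simp add: v_def \<sigma>t)
    ultimately show ?thesis using \<sigma>t s(1) \<sigma>' \<rho>(1)[OF s(1)] by (auto simp: v_def)
  qed
  have "bij_betw ?\<sigma> ?I J" using inv(1) by (simp add: bij_betw_inv_into inj_on_imp_bij_betw)
  then have "arc_length_reparam X A g ?I (\<lambda>t. r (?\<sigma> t)) J r"
    unfolding arc_length_reparam_def using at_s by blast
  then show ?thesis using that[of ?I "\<lambda>t. r (?\<sigma> t)" v] inv(2) at_s by blast
qed

text \<open>Continuity of <F, u> provides the antiderivative used in the time change for geodesics.
  It is read off in a bundle chart, where <F, u> is Lipschitz in the coordinates.\<close>

lemma thermostat_multiplier_continuous:
  assumes F: "locally_lipschitz_field F" and \<gamma>: "thermostat_equation F \<gamma> t"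
  shows "isCont (\<lambda>s. g (fst (\<gamma> s)) (F (fst (\<gamma> s))) (snd (\<gamma> s))) t"
proof -
  note lim = thermostat_limitin[OF \<gamma>]
  have "fst (\<gamma> t) \<in> topspace X"
    using limitin_topspace[OF lim] by (simp add: topspace_tangent mem_Times_iff)
  then obtain c where c: "c \<in> A" "fst (\<gamma> t) \<in> fst c" using topspace_charts by blast
  obtain K where "compact K" "convex K" and K0: "bundle_chart c (\<gamma> t) \<in> interior K"
    and "K \<subseteq> snd c ` fst c \<times> UNIV" and "lipschitz K (spray c F)"
    and K: "lipschitz K (\<lambda>z. let p = chart_inv c (fst z) in g p (F p) (coord_field A c (snd z) p))"
    by (rule spray_lipschitz[OF F c(1) imageI[OF c(2)]])
  let ?h = "\<lambda>z. g (chart_inv c (fst z)) (F (chart_inv c (fst z))) (coord_field A c (snd z)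
      (chart_inv c (fst z)))"
  have "isCont ?h (bundle_chart c (\<gamma> t))"
    using lipschitz_continuous_on[OF K] K0 interior_subset continuous_on_interior unfolding Let_def
        by blast
  moreover have "isCont (\<lambda>s. bundle_chart c (\<gamma> s)) t"
    using \<gamma> thermostat_equation_chart[where \<gamma> = \<gamma> and t = t, OF c] has_vector_derivative_continuous
        by blast
  ultimately have cont: "isCont (\<lambda>s. ?h (bundle_chart c (\<gamma> s))) t"
    using isCont_o2[where f = "\<lambda>s. bundle_chart c (\<gamma> s)" and g = ?h and a = t] by blast
  have "openin (tangent_topology X A) (fst c \<times> UNIV)"
    by (rule tangent_projection_openin[OF chart_openin[OF c(1)]])
  then have "\<forall>\<^sub>F s in nhds t. \<gamma> s \<in> fst c \<times> UNIV"
    by (rule limitin_at_nhds[OF lim]) (use c in \<open>simp add: mem_Times_iff\<close>)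
  then have "\<forall>\<^sub>F s in nhds t. ?h (bundle_chart c (\<gamma> s)) = g (fst (\<gamma> s)) (F (fst (\<gamma> s))) (snd (\<gamma> s))"
    by eventually_elim (simp add: mem_Times_iff chart_inv_chart[OF c(1)]
        coord_field_tangent_coord[OF c(1)])
  from isCont_cong[OF this] cont show ?thesis by blast
qed

theorem arc_length_lifts_geodesics:
  assumes F: "locally_lipschitz_field F"
  shows "arc_length_lifts X A g (geodesics X A (weyl_connection g nabla F)) =
      isokinetic_curves X A g nabla F"
proof (intro ext iffI)
  fix J r u assume "arc_length_lifts X A g (geodesics X A (weyl_connection g nabla F)) J r u"
  then obtain I q w where I: "open_interval I"
    and w: "\<And>t. t \<in> I \<Longrightarrow> has_velocity X A q (w t) t"
      "\<And>t. t \<in> I \<Longrightarrow> has_covariant_derivative X A (weyl_connection g nabla F) q w 0 t"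
    and rep: "arc_length_reparam X A g I q J r" and u: "\<And>s. s \<in> J \<Longrightarrow> has_velocity X A r (u s) s"
    unfolding arc_length_lifts_def geodesics_def by blast
  have "has_covariant_derivative X A nabla q w
      (g (q t) (w t) (w t) *\<^sub>R F (q t) + (- (2 * g (q t) (F (q t)) (w t))) *\<^sub>R w t) t" if "t \<in> I" for t
    using weyl_geodesic_equation[where q = q and w = w
        and t = t, OF w(1)[OF that], of F] w(2)[OF that] by simp
  from arc_length_lift_isokinetic[OF I w(1) this rep u]
  show "isokinetic_curves X A g nabla F J r u" by simp
next
  fix J r u assume iso: "isokinetic_curves X A g nabla F J r u"
  have J: "open_interval J" and u: "\<And>s. s \<in> J \<Longrightarrow> has_velocity X A r (u s) s"
    and unit: "\<And>s. s \<in> J \<Longrightarrow> g (r s) (u s) (u s) = 1"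
    using iso unfolding isokinetic_curves_def by auto
  let ?m = "\<lambda>s. g (r s) (F (r s)) (u s)"
  have "isCont ?m s" if "s \<in> J" for s
    using thermostat_multiplier_continuous[OF F, of "\<lambda>s. (r s, u s)" s] iso that
    unfolding isokinetic_iff sphere_equation_def by simp
  then have "continuous_on J ?m" by (simp add: continuous_at_imp_continuous_on)
  then obtain H where H: "\<And>s. s \<in> J \<Longrightarrow> (H has_real_derivative ?m s) (at s)"
    using real_antiderivative_open_interval[OF J] by blast
  \<comment> \<open>The positive solution of \<rho>' = - <F, u> \<rho>; the additive constant in
    \<open>H\<close> only rescales the affine parameter of the geodesic.\<close>
  let ?\<rho> = "\<lambda>s. exp (- H s)"
  have \<rho>': "(?\<rho> has_real_derivative - ?m s * ?\<rho> s) (at s)" if "s \<in> J" for s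
    by (auto intro!: derivative_eq_intros H[OF that])
  obtain I q v where I: "open_interval I" "arc_length_reparam X A g I q J r"
    and q: "\<And>t. t \<in> I \<Longrightarrow> has_velocity X A q (v t) t \<and> (\<exists>s\<in>J. q t = r s \<and> v t = ?\<rho> s *\<^sub>R u s \<and>
      has_covariant_derivative X A nabla q v
        ((?\<rho> s * (- ?m s * ?\<rho> s)) *\<^sub>R u s + (?\<rho> s)\<^sup>2 *\<^sub>R thermostat F (r s) (u s)) t)"
    using isokinetic_time_change[OF iso _ \<rho>'] by (metis exp_gt_zero)
  have "geodesics X A (weyl_connection g nabla F) I q"
    unfolding geodesics_def
  proof (intro conjI exI[of _ v] ballI I(1))
    fix t assume t: "t \<in> I"
    obtain s where s: "s \<in> J" "q t = r s" "v t = ?\<rho> s *\<^sub>R u s"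
      "has_covariant_derivative X A nabla q v
        ((?\<rho> s * (- ?m s * ?\<rho> s)) *\<^sub>R u s + (?\<rho> s)\<^sup>2 *\<^sub>R thermostat F (r s) (u s)) t"
      using q[OF t] by blast
    have l: "linear (\<lambda>u. g (r s) u v)" "linear (\<lambda>v. g (r s) u v)" for u v
      using metric_bilinear[OF has_velocity_topspace[OF u[OF s(1)]]] unfolding bilinear_def by auto
    show "has_velocity X A q (v t) t" using q[OF t] by blast
    have "u s \<noteq> 0" using unit[OF s(1)] linear_0[OF l(1)] by force
    then show "v t \<noteq> 0" using s(3) by simp
    \<comment> \<open>Since \<open>v t\<close> is \<rho> u, both sides equal \<rho>^2 (F - 2 <F, u>
      u). One multiple of <F, u> u comes from the thermostat, the other from the change of
      speed.\<close>
    have "(?\<rho> s * (- ?m s * ?\<rho> s)) *\<^sub>R u s + (?\<rho> s)\<^sup>2 *\<^sub>R thermostat F (r s) (u s) =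
        g (q t) (v t) (v t) *\<^sub>R F (q t) - (2 * g (q t) (F (q t)) (v t)) *\<^sub>R v t"
      using unit[OF s(1)]
      by (simp add: s(2,3) thermostat_def linear_cmul[OF l(1)] linear_cmul[OF l(2)] power2_eq_square
          algebra_simps scaleR_2[symmetric])
    then show "has_covariant_derivative X A (weyl_connection g nabla F) q v 0 t"
      using weyl_geodesic_equation[where q = q and w = v and t = t, of F] q[OF t] s(4) by simp
  qed
  then show "arc_length_lifts X A g (geodesics X A (weyl_connection g nabla F)) J r u"
    unfolding arc_length_lifts_def using I(2) u by blast
qed

section \<open>The potential and its gradient\<close>

context
  fixes W :: "'a \<Rightarrow> real" assumes W: "smooth_fun A (topspace X) W"
begin

lemma smooth_fun_chart: "c \<in> A \<Longrightarrow> smooth_on (snd c ` fst c) (\<lambda>x. W (chart_inv c x))"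
  using W[unfolded smooth_fun_def, THEN bspec, of c] chart_subset[of c] by (simp add: Int_absorb1)

lemma dfun_chart_derivative:
  assumes "c \<in> A" "p \<in> fst c"
  shows "dfun A W p v = frechet_derivative (\<lambda>x. W (chart_inv c x)) (at (snd c p)) (tangent_coord A c
      p v)"
  by (rule dfun_chart[OF assms smooth_on_has_derivative[OF chart_image_open smooth_fun_chart]])
    (use assms in auto)

lemma dfun_linear:
  assumes "p \<in> topspace X"
  shows "linear (dfun A W p)"
proof -
  note k = chart_at_in[OF assms] chart_at_dom[OF assms]
  have "linear (frechet_derivative (\<lambda>x. W (chart_inv (chart_at A p) x)) (at (snd (chart_at A p) p)))"
    using has_derivative_linear[OF smooth_on_has_derivative[OF chart_image_open smooth_fun_chart]] k
        by blast
  then show ?thesis unfolding dfun_def Let_def by (simp add: eta_contract_eq)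
qed

text \<open>The description in \<open>gradient\<close> is meaningful by a finite-dimensional Riesz
  argument: the map that sends \<open>u\<close> to its inner products with the basis is linear and,
  by positivity of the metric, injective, hence surjective.\<close>

lemma gradient_metric:
  assumes p: "p \<in> topspace X"
  shows "g p (gradient A g W p) v = dfun A W p v"
proof -
  have l: "linear (\<lambda>u. g p u v)" "linear (\<lambda>v. g p u v)" for u v
    using metric_bilinear[OF p] unfolding bilinear_def by auto
  let ?L = "\<lambda>u. \<Sum>b\<in>Basis. g p u b *\<^sub>R b"
  have Lb: "?L u \<bullet> b = g p u b" if "b \<in> Basis" for u b
    using that by (simp add: inner_sum_left inner_Basis if_distrib cong: if_cong)
  have eqI: "u = u'" if "\<And>b. b \<in> Basis \<Longrightarrow> g p u b = g p u' b" for u u'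
  proof (rule ccontr)
    assume "u \<noteq> u'"
    then have "g p (u - u') (u - u') > 0" using metric_pos[OF p] by simp
    moreover have "g p (u - u') (u - u') = (\<Sum>b\<in>Basis. ((u - u') \<bullet> b) *\<^sub>R g p (u - u') b)"
      by (rule linear_Basis_expansion[OF l(2)])
    ultimately show False using that by (simp add: linear_diff[OF l(1)])
  qed
  have "linear ?L"
    by (rule linearI) (simp_all add: linear_add[OF l(1)] linear_cmul[OF l(1)] scaleR_add_left
        sum.distrib scaleR_sum_right)
  moreover have "inj ?L"
  proof (rule injI)
    fix u u' assume eq: "?L u = ?L u'"
    show "u = u'"
    proof (rule eqI)
      fix b :: 'e assume b: "b \<in> Basis"
      from arg_cong[OF eq, of "\<lambda>z. z \<bullet> b"] show "g p u b = g p u' b" by (simp only: Lb[OF b])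
    qed
  qed
  ultimately have "surj ?L" by (rule linear_inj_imp_surj)
  from surjD[OF this, of "\<Sum>b\<in>Basis. dfun A W p b *\<^sub>R b"]
  obtain u where u: "?L u = (\<Sum>b\<in>Basis. dfun A W p b *\<^sub>R b)" by (auto dest: sym)
  have ub: "g p u b = dfun A W p b" if "b \<in> Basis" for b
    using Lb[OF that, of u] that unfolding u by (simp add: inner_sum_left inner_Basis if_distrib
        cong: if_cong)
  have "g p u v = dfun A W p v" for v
    unfolding linear_Basis_expansion[OF l(2), of u v] linear_Basis_expansion[OF dfun_linear[OF p], of v]
    using ub by simp
  then have "\<exists>!u. \<forall>v. g p u v = dfun A W p v" using eqI by (metis (no_types, lifting))
  from theI'[OF this] show ?thesis unfolding gradient_def by blast
qed

text \<open>In coordinates the gradient solves the linear system whose matrix is the Gram matrix and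
  whose right-hand side is the differential of \<open>W\<close>. Both are smooth, and
  \<open>gram_lower_bound\<close> supplies the coercivity.\<close>

lemma gradient_lipschitz:
  assumes "c \<in> A" "compact K" "convex K" "K \<subseteq> snd c ` fst c"
  shows "lipschitz K (\<lambda>x. tangent_coord A c (chart_inv c x) (gradient A g W (chart_inv c x)))"
proof -
  obtain m where m: "m > 0" "\<And>x y. x \<in> K \<Longrightarrow> m * (norm y)\<^sup>2 \<le> gram c x y y"
    using gram_lower_bound[OF assms(1,2,4)] by blast
  let ?\<beta> = "\<lambda>x. frechet_derivative (\<lambda>x. W (chart_inv c x)) (at x)"
  note op = chart_image_open[OF assms(1)]
  have lin: "linear (?\<beta> x)" if "x \<in> K" for x
    using has_derivative_linear[OF smooth_on_has_derivative[OF op smooth_fun_chart[OF assms(1)]]]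
        that assms(4) by blast
  show ?thesis
  proof (rule lipschitz_linear_solution[OF assms(2) m(1), where G = "gram c" and \<beta> = ?\<beta>])
    fix x u v assume x: "x \<in> K"
    then have x': "x \<in> snd c ` fst c" using assms(4) by blast
    show "gram c x u v = (\<Sum>a\<in>Basis. \<Sum>b\<in>Basis. (u \<bullet> a) * (v \<bullet> b) * gram c x a b)"
      by (rule gram_expansion[OF assms(1) x'])
    show "m * (norm v)\<^sup>2 \<le> gram c x v v" by (rule m(2)[OF x])
    show "?\<beta> x v = (\<Sum>b\<in>Basis. (v \<bullet> b) * ?\<beta> x b)"
      using linear_Basis_expansion[OF lin[OF x], of v] by simp
    note p = chart_inv_dom[OF x'] and pX = chart_inv_topspace[OF assms(1) x']
    show "gram c x (tangent_coord A c (chart_inv c x) (gradient A g W (chart_inv c x))) v = ?\<beta> x v"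
      using gradient_metric[OF pX, of "coord_field A c v (chart_inv c x)"]
      by (simp add: coord_field_tangent_coord[OF assms(1) p] dfun_chart_derivative[OF assms(1) p]
          tangent_coord_coord_field_same[OF assms(1) p] chart_chart_inv[OF x'])
  next
    fix a b
    show "lipschitz K (\<lambda>x. gram c x a b)"
      by (rule smooth_on_lipschitz[OF metric_smooth[OF assms(1)] op assms(2-4)])
    show "lipschitz K (\<lambda>x. ?\<beta> x b)"
      by (rule smooth_on_lipschitz[OF smooth_on_derivative[OF smooth_fun_chart[OF assms(1)]] op
          assms(2-4)])
  qed
qed

lemma potential_along_curve:
  assumes v: "has_velocity X A r v s"
  shows "((\<lambda>s. W (r s)) has_real_derivative g (r s) (gradient A g W (r s)) v) (at s)"
proof -
  let ?k = "chart_at A (r s)"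
  have p: "r s \<in> topspace X" using has_velocity_topspace[OF v] .
  note k = chart_at_in[OF p] chart_at_dom[OF p]
  have r': "((\<lambda>s. snd ?k (r s)) has_vector_derivative v) (at s)" and lim: "limitin X r (r s) (at s)"
    using v unfolding has_velocity_def by auto
  let ?D = "frechet_derivative (\<lambda>x. W (chart_inv ?k x)) (at (snd ?k (r s)))"
  have D: "((\<lambda>x. W (chart_inv ?k x)) has_derivative ?D) (at (snd ?k (r s)))"
    using smooth_on_has_derivative[OF chart_image_open smooth_fun_chart] k by blast
  have "((\<lambda>s. W (chart_inv ?k (snd ?k (r s)))) has_vector_derivative ?D v) (at s)"
    using vector_derivative_diff_chain_within[OF r' has_derivative_at_withinI[OF D]]
        by (simp add: o_def)
  moreover have "\<forall>\<^sub>F s in nhds s. W (chart_inv ?k (snd ?k (r s))) = W (r s)"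
    using limitin_at_nhds[OF lim chart_openin[OF k(1)] k(2)]
    by eventually_elim (simp add: chart_inv_chart[OF k(1)])
  ultimately have "((\<lambda>s. W (r s)) has_vector_derivative ?D v) (at s)"
    by (rule has_vector_derivative_eventually_cong)
  moreover have "?D v = g (r s) (gradient A g W (r s)) v"
    unfolding gradient_metric[OF p] by (simp add: dfun_def Let_def)
  ultimately show ?thesis by (simp add: has_real_derivative_iff_has_vector_derivative)
qed

end

lemma smooth_field_locally_lipschitz:
  assumes "smooth_field A (topspace X) E"
  shows "locally_lipschitz_field E"
  unfolding locally_lipschitz_field_def
proof (intro ballI)
  fix c x assume c: "c \<in> A" and x: "x \<in> snd c ` fst c"
  obtain d where d: "d > 0" "cball x d \<subseteq> snd c ` fst c"
    using chart_image_open[OF c] x open_contains_cball by blast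
  have "smooth_on (snd c ` fst c) (\<lambda>x. tangent_coord A c (chart_inv c x) (E (chart_inv c x)))"
    using assms[unfolded smooth_field_def, THEN bspec, OF c] chart_subset[OF c]
        by (simp add: Int_absorb1)
  then have "lipschitz (cball x d) (\<lambda>x. tangent_coord A c (chart_inv c x) (E (chart_inv c x)))"
    by (rule smooth_on_lipschitz[OF _ chart_image_open[OF c] compact_cball convex_cball d(2)])
  then show "\<exists>r>0. cball x r \<subseteq> snd c ` fst c \<and>
      lipschitz (cball x r) (\<lambda>x. tangent_coord A c (chart_inv c x) (E (chart_inv c x)))"
    using d by blast
qed

section \<open>The isoenergetic dynamics\<close>

definition weyl_field :: "('a \<Rightarrow> real) \<Rightarrow> ('a \<Rightarrow> 'e) \<Rightarrow> real \<Rightarrow> 'a \<Rightarrow> 'e" where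
  "weyl_field W E h p = (1 / (2 * (h - W p))) *\<^sub>R (- gradient A g W p + E p)"

text \<open>The denominator is positive and continuous on a closed coordinate ball, so its
  reciprocal is Lipschitz there, and compactness of the ball lets the product rule apply.\<close>

lemma weyl_field_locally_lipschitz:
  assumes W: "smooth_fun A (topspace X) W" and E: "smooth_field A (topspace X) E"
    and h: "\<forall>p\<in>topspace X. W p < h"
  shows "locally_lipschitz_field (weyl_field W E h)"
  unfolding locally_lipschitz_field_def
proof (intro ballI)
  fix c x assume c: "c \<in> A" and x: "x \<in> snd c ` fst c"
  obtain d where d: "d > 0" "cball x d \<subseteq> snd c ` fst c"
      "lipschitz (cball x d) (\<lambda>x. tangent_coord A c (chart_inv c x) (E (chart_inv c x)))"
    using smooth_field_locally_lipschitz[OF E] c x unfolding locally_lipschitz_field_def by blast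
  let ?K = "cball x d"
  have K: "compact ?K" "convex ?K" by auto
  have "lipschitz ?K (\<lambda>x. W (chart_inv c x))"
    by (rule smooth_on_lipschitz[OF smooth_fun_chart[OF W c] chart_image_open[OF c] K d(2)])
  then have "lipschitz ?K (\<lambda>x. 2 * (h - W (chart_inv c x)))"
    by (intro lipschitz_mult lipschitz_diff lipschitz_const K)
  moreover have "2 * (h - W (chart_inv c x)) > 0" if "x \<in> ?K" for x
    using h chart_inv_topspace[OF c, of x] d(2) that by (simp add: subset_iff)
  ultimately have "lipschitz ?K (\<lambda>x. 1 / (2 * (h - W (chart_inv c x))))"
    using lipschitz_inverse_real[OF _ K(1)] by blast
  then have lip: "lipschitz ?K (\<lambda>x. (1 / (2 * (h - W (chart_inv c x)))) *\<^sub>R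
      (- tangent_coord A c (chart_inv c x) (gradient A g W (chart_inv c x)) +
        tangent_coord A c (chart_inv c x) (E (chart_inv c x))))"
    by (intro lipschitz_scaleR lipschitz_add lipschitz_minus gradient_lipschitz[OF W c K d(2)] d(3) K)
  have eq: "(1 / (2 * (h - W (chart_inv c x)))) *\<^sub>R
      (- tangent_coord A c (chart_inv c x) (gradient A g W (chart_inv c x)) +
        tangent_coord A c (chart_inv c x) (E (chart_inv c x))) =
      tangent_coord A c (chart_inv c x) (weyl_field W E h (chart_inv c x))" if "x \<in> ?K" for x
  proof -
    have "chart_inv c x \<in> fst c" by (rule chart_inv_dom[OF subsetD[OF d(2) that]])
    note l = tangent_coord_linear[OF c this]
    show ?thesis by (simp only: weyl_field_def linear_cmul[OF l] linear_add[OF l] linear_neg[OF l])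
  qed
  have "lipschitz ?K (\<lambda>x. tangent_coord A c (chart_inv c x) (weyl_field W E h (chart_inv c x)))"
    by (rule lipschitz_cong[OF lip eq])
  then show "\<exists>r>0. cball x r \<subseteq> snd c ` fst c \<and>
      lipschitz (cball x r) (\<lambda>x. tangent_coord A c (chart_inv c x) (weyl_field W E h (chart_inv c x)))"
    using d by blast
qed

text \<open>One inclusion is \<open>arc_length_lift_isokinetic\<close> with \<kappa> = - <E, v> /
  |v|^2. In the other the energy prescribes the speed, and the change of speed restores the
  tangential part of the potential force, which the thermostat had removed.\<close>

theorem arc_length_lifts_isoenergetic:
  assumes W: "smooth_fun A (topspace X) W" and h: "\<forall>p\<in>topspace X. W p < h"
  shows "arc_length_lifts X A g (isoenergetic_curves X A g nabla W E h) =
    isokinetic_curves X A g nabla (weyl_field W E h)"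
proof (intro ext iffI)
  fix J r u assume "arc_length_lifts X A g (isoenergetic_curves X A g nabla W E h) J r u"
  then obtain I q where q: "isoenergetic_curves X A g nabla W E h I q"
    and rep: "arc_length_reparam X A g I q J r" and u: "\<And>s. s \<in> J \<Longrightarrow> has_velocity X A r (u s) s"
    unfolding arc_length_lifts_def by blast
  have I: "open_interval I" using q by (simp add: isoenergetic_curves_def)
  from q obtain v where "\<forall>t\<in>I. has_velocity X A q (v t) t \<and> has_covariant_derivative X A nabla q v
      (- gradient A g W (q t) + E (q t) - (g (q t) (E (q t)) (v t) / g (q t) (v t) (v t)) *\<^sub>R v t) t \<and>
      g (q t) (v t) (v t) / 2 + W (q t) = h"
    unfolding isoenergetic_curves_def by (elim conjE exE) (rule that)
  then have v: "\<And>t. t \<in> I \<Longrightarrow> has_velocity X A q (v t) t"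
    and cov: "\<And>t. t \<in> I \<Longrightarrow> has_covariant_derivative X A nabla q v
      (- gradient A g W (q t) + E (q t) - (g (q t) (E (q t)) (v t) / g (q t) (v t) (v t)) *\<^sub>R v t) t"
    and energy: "\<And>t. t \<in> I \<Longrightarrow> g (q t) (v t) (v t) / 2 + W (q t) = h"
    by simp_all
  have "has_covariant_derivative X A nabla q v
      (g (q t) (v t) (v t) *\<^sub>R weyl_field W E h (q t) + (- (g (q t) (E (q t)) (v t) / g (q t) (v t)
          (v t))) *\<^sub>R v t) t"
    if t: "t \<in> I" for t
  proof -
    have "g (q t) (v t) (v t) = 2 * (h - W (q t))" using energy[OF t] by simp
    moreover have "h - W (q t) > 0" using h has_velocity_topspace[OF v[OF t]] by simp
    ultimately have "g (q t) (v t) (v t) *\<^sub>R weyl_field W E h (q t) = - gradient A g W (q t) + E (q t)"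
      by (simp add: weyl_field_def)
    then show ?thesis using cov[OF t] by simp
  qed
  from arc_length_lift_isokinetic[OF I v this rep u]
  show "isokinetic_curves X A g nabla (weyl_field W E h) J r u" by simp
next
  fix J r u assume iso: "isokinetic_curves X A g nabla (weyl_field W E h) J r u"
  have u: "\<And>s. s \<in> J \<Longrightarrow> has_velocity X A r (u s) s"
    and unit: "\<And>s. s \<in> J \<Longrightarrow> g (r s) (u s) (u s) = 1"
    using iso unfolding isokinetic_curves_def by auto
  let ?\<rho> = "\<lambda>s. sqrt (2 * (h - W (r s)))"
  let ?\<rho>' = "\<lambda>s. - g (r s) (gradient A g W (r s)) (u s) / ?\<rho> s"
  have pos: "2 * (h - W (r s)) > 0" if "s \<in> J" for s
    using h has_velocity_topspace[OF u[OF that]] by simp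
  have \<rho>0: "?\<rho> s > 0" if "s \<in> J" for s using pos[OF that] by simp
  have \<rho>': "(?\<rho> has_real_derivative ?\<rho>' s) (at s)" if "s \<in> J" for s
    using pos[OF that]
    by (auto intro!: derivative_eq_intros potential_along_curve[OF W u[OF that]] simp: field_simps)
  obtain I q v where I: "open_interval I" "arc_length_reparam X A g I q J r"
    and q: "\<And>t. t \<in> I \<Longrightarrow> has_velocity X A q (v t) t \<and> (\<exists>s\<in>J. q t = r s \<and> v t = ?\<rho> s *\<^sub>R u s \<and>
      has_covariant_derivative X A nabla q v
        ((?\<rho> s * ?\<rho>' s) *\<^sub>R u s + (?\<rho> s)\<^sup>2 *\<^sub>R thermostat (weyl_field W E h) (r s) (u s)) t)"
    using isokinetic_time_change[OF iso \<rho>0 \<rho>'] by metis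
  have "isoenergetic_curves X A g nabla W E h I q"
    unfolding isoenergetic_curves_def
  proof (intro conjI exI[of _ v] ballI I(1))
    fix t assume t: "t \<in> I"
    obtain s where s: "s \<in> J" "q t = r s" "v t = ?\<rho> s *\<^sub>R u s"
      "has_covariant_derivative X A nabla q v
        ((?\<rho> s * ?\<rho>' s) *\<^sub>R u s + (?\<rho> s)\<^sup>2 *\<^sub>R thermostat (weyl_field W E h) (r s) (u s)) t"
      using q[OF t] by blast
    have l: "linear (\<lambda>u. g (r s) u v)" "linear (\<lambda>v. g (r s) u v)" for u v
      using metric_bilinear[OF has_velocity_topspace[OF u[OF s(1)]]] unfolding bilinear_def by auto
    show "has_velocity X A q (v t) t" using q[OF t] by blast
    have \<rho>2: "(?\<rho> s)\<^sup>2 = 2 * (h - W (r s))" using pos[OF s(1)] by simp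
    have gv: "g (q t) (v t) (v t) = (?\<rho> s)\<^sup>2"
      using unit[OF s(1)] by (simp only: s(2,3) linear_cmul[OF l(1)] linear_cmul[OF l(2)])
        (simp add: power2_eq_square)
    then show "g (q t) (v t) (v t) / 2 + W (q t) = h" using \<rho>2 s(2) by (simp add: field_simps)
    let ?Z = "- gradient A g W (r s) + E (r s)"
    have "(?\<rho> s)\<^sup>2 *\<^sub>R weyl_field W E h (r s) = ?Z"
      unfolding \<rho>2 weyl_field_def using pos[OF s(1)] by simp
    moreover have "(?\<rho> s)\<^sup>2 *\<^sub>R thermostat (weyl_field W E h) (r s) (u s) =
        (?\<rho> s)\<^sup>2 *\<^sub>R weyl_field W E h (r s) - g (r s) ((?\<rho> s)\<^sup>2 *\<^sub>R weyl_field W E h (r s))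
            (u s) *\<^sub>R u s"
      by (simp only: thermostat_def linear_cmul[OF l(1)] scaleR_diff_right) simp
    ultimately have 1: "(?\<rho> s)\<^sup>2 *\<^sub>R thermostat (weyl_field W E h) (r s) (u s) =
        ?Z - g (r s) ?Z (u s) *\<^sub>R u s"
      by simp
    \<comment> \<open>Differentiating \<rho>^2 = 2 (h - W) along the curve gives the tangential
      component of the potential force. It compensates the corresponding part of \<open>3\<close>,
      so that only the tangential component of \<open>E\<close> stays subtracted.\<close>
    have 2: "?\<rho> s * ?\<rho>' s = - g (r s) (gradient A g W (r s)) (u s)" using \<rho>0[OF s(1)] by simp
    have 3: "g (r s) ?Z (u s) = - g (r s) (gradient A g W (r s)) (u s) + g (r s) (E (r s)) (u s)"
      by (simp only: linear_add[OF l(1)] linear_neg[OF l(1)])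
    have 4: "(g (q t) (E (q t)) (v t) / g (q t) (v t) (v t)) *\<^sub>R v t = g (r s) (E (r s)) (u s) *\<^sub>R u s"
    proof -
      have "((k * e) / k\<^sup>2) *\<^sub>R (k *\<^sub>R z) = e *\<^sub>R z" if "k > 0" for k e :: real and z :: 'e
        using that by (simp add: power2_eq_square)
      from this[OF \<rho>0[OF s(1)]] show ?thesis
        unfolding gv unfolding s(2,3) linear_cmul[OF l(2)] real_scaleR_def .
    qed
    have "(?\<rho> s * ?\<rho>' s) *\<^sub>R u s + (?\<rho> s)\<^sup>2 *\<^sub>R thermostat (weyl_field W E h) (r s) (u s) =
        - gradient A g W (q t) + E (q t) - (g (q t) (E (q t)) (v t) / g (q t) (v t) (v t)) *\<^sub>R v t"
      unfolding 4 unfolding 1 2 3 s(2) by (simp add: algebra_simps)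
    then show "has_covariant_derivative X A nabla q v
        (- gradient A g W (q t) + E (q t) - (g (q t) (E (q t)) (v t) / g (q t) (v t) (v t)) *\<^sub>R v t) t"
      using s(4) by simp
  qed
  then show "arc_length_lifts X A g (isoenergetic_curves X A g nabla W E h) J r u"
    unfolding arc_length_lifts_def using I(2) u by blast
qed

end

theorem theorem2p4:
  fixes X :: "'a topology"
    and A :: "('a, 'e::euclidean_space) chart set"
    and g :: "'a \<Rightarrow> 'e \<Rightarrow> 'e \<Rightarrow> real"
    and nabla :: "('a, 'e) connection"
    and W :: "'a \<Rightarrow> real"
    and E :: "'a \<Rightarrow> 'e"
    and h :: real
  assumes "riemannian_manifold X A g"
    and "compact_space X"
    and "levi_civita X A g nabla"
    and "smooth_fun A (topspace X) W"
    and "smooth_field A (topspace X) E"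
    and "\<forall>p\<in>topspace X. W p < h"
  defines "E' \<equiv> \<lambda>p. (1 / (2 * (h - W p))) *\<^sub>R (- gradient A g W p + E p)"
  shows
    "(\<exists>\<Phi>. defines_flow X A g
             (arc_length_lifts X A g (isoenergetic_curves X A g nabla W E h)) \<Phi>) \<and>
     (\<forall>\<Phi>. defines_flow X A g
             (arc_length_lifts X A g (isoenergetic_curves X A g nabla W E h)) \<Phi>
           \<longleftrightarrow> W_flow X A g nabla E' \<Phi>) \<and>
     (\<exists>\<Phi>. defines_flow X A g (isokinetic_curves X A g nabla E) \<Phi>) \<and>
     (\<forall>\<Phi>. defines_flow X A g (isokinetic_curves X A g nabla E) \<Phi>
           \<longleftrightarrow> W_flow X A g nabla E \<Phi>)"
proof -
  interpret riemannian X A g nabla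
    using assms(1,3) by unfold_locales (auto simp: riemannian_manifold_def)
  have E': "E' = weyl_field W E h"
    unfolding E'_def weyl_field_def ..
  note geo = arc_length_lifts_geodesics[OF smooth_field_locally_lipschitz[OF assms(5)]]
    arc_length_lifts_geodesics[OF weyl_field_locally_lipschitz[OF assms(4-6)]]
  note flow = isokinetic_flow_exists[OF assms(2) smooth_field_locally_lipschitz[OF assms(5)]]
    isokinetic_flow_exists[OF assms(2) weyl_field_locally_lipschitz[OF assms(4-6)]]
  \<comment> \<open>After unfolding, the two sides of each equivalence refer to the same family of
    isokinetic curves, so only the existence of the two flows is left.\<close>
  show ?thesis
    unfolding W_flow_def E' geo arc_length_lifts_isoenergetic[OF assms(4,6)] using flow by blast
qed

end
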